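(* Let $p:\mathcal D\to\mathcal C$ be a functor and suppose that $\mathcal C$ satisfies either of the following conditions: (1) $\mathcal C$ is locally finite (all homsets are finite), or (2) $\mathcal C$ is factorization preordered. Then for any two proofs $\alpha_1,\alpha_2:S\Rightarrow_f T$ of the bifibrational calculus generated by $p$, it is decidable whether $\alpha_1\sim\alpha_2$.
   Context: Composition is in diagrammatic order. $\mathcal C$ is factorization preordered if for all composable $f$, $g,h$ (parallel), $k$: $fg=fh$ and $gk=hk$ imply $g=h$; equivalently every commuting square has at most one diagonal filler. Effectivity convention: objects and arrows of $\mathcal C$ and $\mathcal D$ are given by finite data, with computable composition and $p$ and decidable equality of arrows; conditions (1) and (2) are interpreted constructively: in (1) the finite homset $\mathcal C(A,B)$ can be effectively enumerated; in (2) for any given commuting square one can decide whether it has a diagonal filler and compute one if so. Calculus. Formulas: each object $X$ of $\mathcal D$ is an atomic formula over $p(X)$; if $S$ is over $A$ and $f:A\to B$ then $f^+S$ is a formula over $B$; if $T$ is over $C$ and $g:B\to C$ then $g^-T$ is a formula over $B$. For $S$ over $A$, $T$ over $C$, $h:A\to C$, proofs $\alpha:S\Rightarrow_h T$ are generated by: - each $\delta:X\to Y$ in $\mathcal D$ with $p(\delta)=f$ is a proof $X\Rightarrow_f Y$; - if $\alpha:S\Rightarrow_{fg}T$ then $\mathsf L^+_{f,g}(\alpha):f^+S\Rightarrow_g T$; - if $\alpha:S'\Rightarrow_{f'}S$ then $\mathsf R^+_f(\alpha):S'\Rightarrow_{f'f}f^+S$; - if $\alpha:T\Rightarrow_{g'}T'$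 then $\mathsf L^-_g(\alpha):g^-T\Rightarrow_{gg'}T'$; - if $\alpha:S\Rightarrow_{fg}T$ then $\mathsf R^-_{f,g}(\alpha):S\Rightarrow_f g^-T$. Permutation equivalence $\sim$ is the least equivalence relation on proofs of each sequent, closed under these rules, containing (whenever both sides are valid) $\mathsf R^+_h\mathsf L^-_f\alpha\sim\mathsf L^-_f\mathsf R^+_h\alpha$ ($\alpha$ over $g$); $\mathsf R^+_h\mathsf L^+_{f,g}\alpha\sim\mathsf L^+_{f,gh}\mathsf R^+_h\alpha$ ($\alpha$ over $fg$); $\mathsf R^-_{fg,h}\mathsf L^-_f\alpha\sim\mathsf L^-_f\mathsf R^-_{g,h}\alpha$ ($\alpha$ over $gh$); $\mathsf R^-_{g,h}\mathsf L^+_{f,gh}\alpha\sim\mathsf L^+_{f,g}\mathsf R^-_{fg,h}\alpha$ ($\alpha$ over $fgh$). *)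

theory Defs
  imports Main "HOL-Library.Nat_Bijection"
begin

section \<open>Categories and functors\<close>

text \<open>Composition is in diagrammatic order: \<open>f \<cdot>\<^bsub>C\<^esub> g\<close> is meaningful when \<open>Tgt C f = Src C g\<close>.\<close>

record ('o, 'a) cat =
  Obj :: "'o set"
  Arr :: "'a set"
  Src :: "'a \<Rightarrow> 'o"
  Tgt :: "'a \<Rightarrow> 'o"
  Idn :: "'o \<Rightarrow> 'a"
  Comp :: "'a \<Rightarrow> 'a \<Rightarrow> 'a"  (infixl \<open>\<cdot>\<index>\<close> 70)

definition Hom :: "('o, 'a) cat \<Rightarrow> 'o \<Rightarrow> 'o \<Rightarrow> 'a set" where
  "Hom C A B = {f \<in> Arr C. Src C f = A \<and> Tgt C f = B}"

locale category =
  fixes C :: "('o, 'a) cat" (structure)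
  assumes src_obj: "f \<in> Arr C \<Longrightarrow> Src C f \<in> Obj C"
    and tgt_obj: "f \<in> Arr C \<Longrightarrow> Tgt C f \<in> Obj C"
    and idn_hom: "A \<in> Obj C \<Longrightarrow> Idn C A \<in> Hom C A A"
    and comp_hom: "f \<in> Hom C A B \<Longrightarrow> g \<in> Hom C B E \<Longrightarrow> f \<cdot> g \<in> Hom C A E"
    and idn_left: "f \<in> Hom C A B \<Longrightarrow> Idn C A \<cdot> f = f"
    and idn_right: "f \<in> Hom C A B \<Longrightarrow> f \<cdot> Idn C B = f"
    and comp_assoc: "f \<in> Hom C A B \<Longrightarrow> g \<in> Hom C B E \<Longrightarrow> h \<in> Hom C E F \<Longrightarrow>
      (f \<cdot> g) \<cdot> h = f \<cdot> (g \<cdot> h)"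

locale cat_functor = D: category D + C: category C
  for D :: "('do, 'da) cat" and C :: "('co, 'ca) cat" +
  fixes po :: "'do \<Rightarrow> 'co" and pa :: "'da \<Rightarrow> 'ca"
  assumes po_obj: "X \<in> Obj D \<Longrightarrow> po X \<in> Obj C"
    and pa_hom: "\<delta> \<in> Hom D X Y \<Longrightarrow> pa \<delta> \<in> Hom C (po X) (po Y)"
    and pa_idn: "X \<in> Obj D \<Longrightarrow> pa (Idn D X) = Idn C (po X)"
    and pa_comp: "\<delta> \<in> Hom D X Y \<Longrightarrow> \<epsilon> \<in> Hom D Y Z \<Longrightarrow>
      pa (\<delta> \<cdot>\<^bsub>D\<^esub> \<epsilon>) = pa \<delta> \<cdot>\<^bsub>C\<^esub> pa \<epsilon>"

definition locally_finite :: "('o, 'a) cat \<Rightarrow> bool" where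
  "locally_finite C \<longleftrightarrow> (\<forall>A\<in>Obj C. \<forall>B\<in>Obj C. finite (Hom C A B))"

definition factorization_preordered :: "('o, 'a) cat \<Rightarrow> bool" where
  "factorization_preordered C \<longleftrightarrow>
    (\<forall>A B E F. \<forall>f\<in>Hom C A B. \<forall>g\<in>Hom C B E. \<forall>h\<in>Hom C B E. \<forall>k\<in>Hom C E F.
      f \<cdot>\<^bsub>C\<^esub> g = f \<cdot>\<^bsub>C\<^esub> h \<and> g \<cdot>\<^bsub>C\<^esub> k = h \<cdot>\<^bsub>C\<^esub> k \<longrightarrow> g = h)"

text \<open>\<open>f \<cdot> k = m \<cdot> h\<close> is a commuting square with left side \<open>f\<close> and right side \<open>h\<close>; a filler goes
  from the target of \<open>f\<close> to the source of \<open>h\<close>.\<close>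

definition commuting_square :: "('o, 'a) cat \<Rightarrow> 'a \<Rightarrow> 'a \<Rightarrow> 'a \<Rightarrow> 'a \<Rightarrow> bool" where
  "commuting_square C f k m h \<longleftrightarrow>
    (\<exists>A B E F. f \<in> Hom C A B \<and> k \<in> Hom C B F \<and> m \<in> Hom C A E \<and> h \<in> Hom C E F) \<and>
    f \<cdot>\<^bsub>C\<^esub> k = m \<cdot>\<^bsub>C\<^esub> h"

definition fillers :: "('o, 'a) cat \<Rightarrow> 'a \<Rightarrow> 'a \<Rightarrow> 'a \<Rightarrow> 'a \<Rightarrow> 'a set" where
  "fillers C f k m h =
    {g \<in> Hom C (Tgt C f) (Src C h). f \<cdot>\<^bsub>C\<^esub> g = m \<and> g \<cdot>\<^bsub>C\<^esub> h = k}"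


section \<open>The bifibrational calculus\<close>

datatype ('do, 'ca) form =
    At 'do
  | Push 'ca "('do, 'ca) form"
  | Pull 'ca "('do, 'ca) form"

inductive over :: "('do, 'da) cat \<Rightarrow> ('co, 'ca) cat \<Rightarrow> ('do \<Rightarrow> 'co) \<Rightarrow>
    ('do, 'ca) form \<Rightarrow> 'co \<Rightarrow> bool"
  for D C po where
  "X \<in> Obj D \<Longrightarrow> over D C po (At X) (po X)"
| "over D C po S A \<Longrightarrow> f \<in> Hom C A B \<Longrightarrow> over D C po (Push f S) B"
| "over D C po T E \<Longrightarrow> g \<in> Hom C B E \<Longrightarrow> over D C po (Pull g T) B"

text \<open>Proof terms carry exactly the subscripts of the rules; the end sequent of a valid term is
  determined by the term.\<close>

datatype ('ca, 'da) proof_term =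
    Ax 'da
  | LPush 'ca 'ca "('ca, 'da) proof_term"
  | RPush 'ca "('ca, 'da) proof_term"
  | LPull 'ca "('ca, 'da) proof_term"
  | RPull 'ca 'ca "('ca, 'da) proof_term"

text \<open>\<open>proves D C pa \<alpha> S h T\<close>: \<open>\<alpha>\<close> is a proof of the sequent \<open>S \<Rightarrow>\<^sub>h T\<close>. That \<open>S\<close> and \<open>T\<close> lie over the
  source and target of \<open>h\<close> is a consequence (\<open>proves_over\<close> below).\<close>

inductive proves :: "('do, 'da) cat \<Rightarrow> ('co, 'ca) cat \<Rightarrow> ('da \<Rightarrow> 'ca) \<Rightarrow>
    ('ca, 'da) proof_term \<Rightarrow> ('do, 'ca) form \<Rightarrow> 'ca \<Rightarrow> ('do, 'ca) form \<Rightarrow> bool"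
  for D C pa where
  Ax: "\<delta> \<in> Hom D X Y \<Longrightarrow> proves D C pa (Ax \<delta>) (At X) (pa \<delta>) (At Y)"
| LPush: "proves D C pa \<alpha> S (f \<cdot>\<^bsub>C\<^esub> g) T \<Longrightarrow> f \<in> Hom C A B \<Longrightarrow> g \<in> Hom C B E \<Longrightarrow>
    proves D C pa (LPush f g \<alpha>) (Push f S) g T"
| RPush: "proves D C pa \<alpha> S' f' S \<Longrightarrow> f' \<in> Hom C E A \<Longrightarrow> f \<in> Hom C A B \<Longrightarrow>
    proves D C pa (RPush f \<alpha>) S' (f' \<cdot>\<^bsub>C\<^esub> f) (Push f S)"
| LPull: "proves D C pa \<alpha> T g' T' \<Longrightarrow> g \<in> Hom C B E \<Longrightarrow> g' \<in> Hom C E F \<Longrightarrow>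
    proves D C pa (LPull g \<alpha>) (Pull g T) (g \<cdot>\<^bsub>C\<^esub> g') T'"
| RPull: "proves D C pa \<alpha> S (f \<cdot>\<^bsub>C\<^esub> g) T \<Longrightarrow> f \<in> Hom C A B \<Longrightarrow> g \<in> Hom C B E \<Longrightarrow>
    proves D C pa (RPull f g \<alpha>) S f (Pull g T)"

lemma proves_over:
  assumes "cat_functor D C po pa" and "proves D C pa \<alpha> S h T"
  shows "h \<in> Arr C \<and> over D C po S (Src C h) \<and> over D C po T (Tgt C h)"
proof -
  interpret cat_functor D C po pa by fact
  have app: "Src C (f \<cdot>\<^bsub>C\<^esub> g) = A" "Tgt C (f \<cdot>\<^bsub>C\<^esub> g) = E" "f \<cdot>\<^bsub>C\<^esub> g \<in> Arr C"
    if "f \<in> Hom C A B" "g \<in> Hom C B E" for f g A B E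
    using C.comp_hom[OF that] by (auto simp: Hom_def)
  from assms(2) show ?thesis
  proof induction
    case (Ax \<delta> X Y)
    then show ?case
      using pa_hom[OF Ax] D.src_obj D.tgt_obj by (auto simp: Hom_def intro: over.intros)
  next
    case (LPush \<alpha> S f g T A B E)
    then have "over D C po S A" by (metis app(1))
    then show ?case
      using LPush app(2)[OF LPush.hyps(2,3)] by (auto simp: Hom_def intro: over.intros)
  next
    case (RPush \<alpha> S' f' S E A f B)
    then show ?case
      using app[OF RPush.hyps(2,3)] by (auto simp: Hom_def intro: over.intros)
  next
    case (LPull \<alpha> T g' T' g B E F)
    then show ?case
      using app[OF LPull.hyps(2,3)] by (auto simp: Hom_def intro: over.intros)
  next
    case (RPull \<alpha> S f g T A B E)
    then have "over D C po T E" by (metis app(2))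
    then show ?case
      using RPull app(1)[OF RPull.hyps(2,3)] by (auto simp: Hom_def intro: over.intros)
  qed
qed

text \<open>\<open>perm D C pa S k T \<alpha> \<beta>\<close>: the proofs \<open>\<alpha>\<close> and \<open>\<beta>\<close> of \<open>S \<Rightarrow>\<^sub>k T\<close> are permutation equivalent. The last
  four clauses are the generators; their premises say that both sides are valid proofs of the
  same sequent.\<close>

inductive perm :: "('do, 'da) cat \<Rightarrow> ('co, 'ca) cat \<Rightarrow> ('da \<Rightarrow> 'ca) \<Rightarrow>
    ('do, 'ca) form \<Rightarrow> 'ca \<Rightarrow> ('do, 'ca) form \<Rightarrow> ('ca, 'da) proof_term \<Rightarrow> ('ca, 'da) proof_term \<Rightarrow> bool"
  for D C pa where
  refl: "proves D C pa \<alpha> S k T \<Longrightarrow> perm D C pa S k T \<alpha> \<alpha>"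
| sym: "perm D C pa S k T \<alpha> \<beta> \<Longrightarrow> perm D C pa S k T \<beta> \<alpha>"
| trans: "perm D C pa S k T \<alpha> \<beta> \<Longrightarrow> perm D C pa S k T \<beta> \<gamma> \<Longrightarrow> perm D C pa S k T \<alpha> \<gamma>"
| LPush: "perm D C pa S (f \<cdot>\<^bsub>C\<^esub> g) T \<alpha> \<beta> \<Longrightarrow> f \<in> Hom C A B \<Longrightarrow> g \<in> Hom C B E \<Longrightarrow>
    perm D C pa (Push f S) g T (LPush f g \<alpha>) (LPush f g \<beta>)"
| RPush: "perm D C pa S' f' S \<alpha> \<beta> \<Longrightarrow> f' \<in> Hom C E A \<Longrightarrow> f \<in> Hom C A B \<Longrightarrow>
    perm D C pa S' (f' \<cdot>\<^bsub>C\<^esub> f) (Push f S) (RPush f \<alpha>) (RPush f \<beta>)"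
| LPull: "perm D C pa T g' T' \<alpha> \<beta> \<Longrightarrow> g \<in> Hom C B E \<Longrightarrow> g' \<in> Hom C E F \<Longrightarrow>
    perm D C pa (Pull g T) (g \<cdot>\<^bsub>C\<^esub> g') T' (LPull g \<alpha>) (LPull g \<beta>)"
| RPull: "perm D C pa S (f \<cdot>\<^bsub>C\<^esub> g) T \<alpha> \<beta> \<Longrightarrow> f \<in> Hom C A B \<Longrightarrow> g \<in> Hom C B E \<Longrightarrow>
    perm D C pa S f (Pull g T) (RPull f g \<alpha>) (RPull f g \<beta>)"
| RPush_LPull:
    "proves D C pa (RPush h (LPull f \<alpha>)) S k T \<Longrightarrow>
     proves D C pa (LPull f (RPush h \<alpha>)) S k T \<Longrightarrow>
     perm D C pa S k T (RPush h (LPull f \<alpha>)) (LPull f (RPush h \<alpha>))"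
| RPush_LPush:
    "proves D C pa (RPush h (LPush f g \<alpha>)) S k T \<Longrightarrow>
     proves D C pa (LPush f (g \<cdot>\<^bsub>C\<^esub> h) (RPush h \<alpha>)) S k T \<Longrightarrow>
     perm D C pa S k T (RPush h (LPush f g \<alpha>)) (LPush f (g \<cdot>\<^bsub>C\<^esub> h) (RPush h \<alpha>))"
| RPull_LPull:
    "proves D C pa (RPull (f \<cdot>\<^bsub>C\<^esub> g) h (LPull f \<alpha>)) S k T \<Longrightarrow>
     proves D C pa (LPull f (RPull g h \<alpha>)) S k T \<Longrightarrow>
     perm D C pa S k T (RPull (f \<cdot>\<^bsub>C\<^esub> g) h (LPull f \<alpha>)) (LPull f (RPull g h \<alpha>))"
| RPull_LPush:
    "proves D C pa (RPull g h (LPush f (g \<cdot>\<^bsub>C\<^esub> h) \<alpha>)) S k T \<Longrightarrow>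
     proves D C pa (LPush f g (RPull (f \<cdot>\<^bsub>C\<^esub> g) h \<alpha>)) S k T \<Longrightarrow>
     perm D C pa S k T (RPull g h (LPush f (g \<cdot>\<^bsub>C\<^esub> h) \<alpha>)) (LPush f g (RPull (f \<cdot>\<^bsub>C\<^esub> g) h \<alpha>))"

lemma perm_proves:
  "perm D C pa S k T \<alpha> \<beta> \<Longrightarrow> proves D C pa \<alpha> S k T \<and> proves D C pa \<beta> S k T"
  by (induction rule: perm.induct) (auto intro: proves.intros)


section \<open>Computability and effective presentations\<close>

text \<open>The total recursive functions, as unary functions on \<open>nat\<close> with several arguments packed by
  \<open>prod_encode\<close>. Minimization is restricted to the regular case, which by Kleene's normal form
  theorem loses no total recursive function.\<close>

inductive recursive :: "(nat \<Rightarrow> nat) \<Rightarrow> bool" where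
  zero: "recursive (\<lambda>_. 0)"
| suc: "recursive Suc"
| left: "recursive (\<lambda>n. fst (prod_decode n))"
| right: "recursive (\<lambda>n. snd (prod_decode n))"
| pair: "recursive f \<Longrightarrow> recursive g \<Longrightarrow> recursive (\<lambda>n. prod_encode (f n, g n))"
| comp: "recursive f \<Longrightarrow> recursive g \<Longrightarrow> recursive (\<lambda>n. f (g n))"
| prec: "recursive f \<Longrightarrow> recursive g \<Longrightarrow>
    recursive (\<lambda>n. case prod_decode n of (a, m) \<Rightarrow>
      rec_nat (f a) (\<lambda>i r. g (prod_encode (a, prod_encode (i, r)))) m)"
| mu: "recursive f \<Longrightarrow> (\<And>a. \<exists>i. f (prod_encode (a, i)) = 0) \<Longrightarrow>
    recursive (\<lambda>a. LEAST i. f (prod_encode (a, i)) = 0)"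

text \<open>Finite data are presented by natural numbers through a numbering: \<open>\<nu> n = Some x\<close> means that
  \<open>n\<close> is a name of \<open>x\<close>. An element may have many names, so decidability of equality is a genuine
  condition. Algorithms are only constrained on names of legitimate inputs.\<close>

definition numbering :: "(nat \<Rightarrow> 'x option) \<Rightarrow> 'x set \<Rightarrow> bool" where
  "numbering \<nu> X \<longleftrightarrow> ran \<nu> = X"

definition computable_map :: "(nat \<Rightarrow> 'x option) \<Rightarrow> (nat \<Rightarrow> 'y option) \<Rightarrow> ('x \<Rightarrow> 'y) \<Rightarrow> bool" where
  "computable_map \<nu> \<mu> f \<longleftrightarrow>
    (\<exists>r. recursive r \<and> (\<forall>n x. \<nu> n = Some x \<longrightarrow> \<mu> (r n) = Some (f x)))"

definition decidable_equality :: "(nat \<Rightarrow> 'x option) \<Rightarrow> bool" where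
  "decidable_equality \<nu> \<longleftrightarrow>
    (\<exists>r. recursive r \<and> (\<forall>m n x y. \<nu> m = Some x \<longrightarrow> \<nu> n = Some y \<longrightarrow>
      r (prod_encode (m, n)) = (if x = y then 1 else 0)))"

definition computable_comp :: "('o, 'a) cat \<Rightarrow> (nat \<Rightarrow> 'a option) \<Rightarrow> bool" where
  "computable_comp C \<nu> \<longleftrightarrow>
    (\<exists>r. recursive r \<and> (\<forall>m n f g. \<nu> m = Some f \<longrightarrow> \<nu> n = Some g \<longrightarrow> Tgt C f = Src C g \<longrightarrow>
      \<nu> (r (prod_encode (m, n))) = Some (f \<cdot>\<^bsub>C\<^esub> g)))"

definition effective_cat ::
  "('o, 'a) cat \<Rightarrow> (nat \<Rightarrow> 'o option) \<Rightarrow> (nat \<Rightarrow> 'a option) \<Rightarrow> bool" where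
  "effective_cat C \<nu>o \<nu>a \<longleftrightarrow>
    numbering \<nu>o (Obj C) \<and> numbering \<nu>a (Arr C) \<and>
    computable_map \<nu>a \<nu>o (Src C) \<and> computable_map \<nu>a \<nu>o (Tgt C) \<and>
    computable_comp C \<nu>a \<and> decidable_equality \<nu>a"

definition effective_hom_enumeration ::
  "('o, 'a) cat \<Rightarrow> (nat \<Rightarrow> 'o option) \<Rightarrow> (nat \<Rightarrow> 'a option) \<Rightarrow> bool" where
  "effective_hom_enumeration C \<nu>o \<nu>a \<longleftrightarrow>
    (\<exists>r. recursive r \<and> (\<forall>m n A B. \<nu>o m = Some A \<longrightarrow> \<nu>o n = Some B \<longrightarrow>
      \<nu>a ` set (list_decode (r (prod_encode (m, n)))) = Some ` Hom C A B))"

text \<open>The output \<open>0\<close> means that there is no filler, \<open>Suc i\<close> that \<open>i\<close> is a name of one.\<close>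

definition effective_fillers :: "('o, 'a) cat \<Rightarrow> (nat \<Rightarrow> 'a option) \<Rightarrow> bool" where
  "effective_fillers C \<nu> \<longleftrightarrow>
    (\<exists>r. recursive r \<and> (\<forall>a b c d f k m h.
      \<nu> a = Some f \<longrightarrow> \<nu> b = Some k \<longrightarrow> \<nu> c = Some m \<longrightarrow> \<nu> d = Some h \<longrightarrow>
      commuting_square C f k m h \<longrightarrow>
      (case r (list_encode [a, b, c, d]) of
         0 \<Rightarrow> fillers C f k m h = {}
       | Suc i \<Rightarrow> \<exists>g\<in>fillers C f k m h. \<nu> i = Some g)))"

text \<open>A proof is presented to an algorithm as the code of a proof term in which each arrow is
  replaced by one of its names.\<close>

fun proof_code :: "(nat, nat) proof_term \<Rightarrow> nat" where
  "proof_code (Ax d) = list_encode [0, d]"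
| "proof_code (LPush f g a) = list_encode [1, f, g, proof_code a]"
| "proof_code (RPush f a) = list_encode [2, f, proof_code a]"
| "proof_code (LPull g a) = list_encode [3, g, proof_code a]"
| "proof_code (RPull f g a) = list_encode [4, f, g, proof_code a]"

definition proof_name ::
  "(nat \<Rightarrow> 'ca option) \<Rightarrow> (nat \<Rightarrow> 'da option) \<Rightarrow> nat \<Rightarrow> ('ca, 'da) proof_term \<Rightarrow> bool" where
  "proof_name \<nu>c \<nu>d n \<alpha> \<longleftrightarrow>
    (\<exists>P. n = proof_code P \<and> rel_proof_term (\<lambda>i f. \<nu>c i = Some f) (\<lambda>i \<delta>. \<nu>d i = Some \<delta>) P \<alpha>)"

end

theory Submission
  imports Defs
begin

text \<open>Let \<open>S\<close> have \<open>m\<close> and \<open>T\<close> have \<open>n\<close> connectives. Read from its root, a proof of \<open>S \<Rightarrow>\<^sub>h T\<close> strips the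
  outermost connective of the left formula (a left rule) or of the right formula (a right rule)
  until an axiom remains. It is therefore a lattice path from \<open>(0, 0)\<close> to \<open>(m, n)\<close>, decorated at the
  point \<open>(i, j)\<close> with the arrow of the sequent between what is left of \<open>S\<close> and of \<open>T\<close>. Consecutive
  decorations are tied by the equation of the rule in between, and the two formulas, the final
  axiom and the decorated path (the trace) determine the proof (\<open>proves_inj\<close>).

  In these terms the four generators of permutation equivalence say the same thing: one interior
  point of the path is moved to the opposite corner of a unit square, and the new path is again
  correctly decorated. So two proofs are equivalent iff they end in the same axiom and their traces
  are connected by such steps (\<open>perm_iff_steps\<close>). Across a square whose left and right connectives
  have mixed directions, or when the move goes the forced way, the new decoration is a composite; in
  the remaining two cases it is a diagonal filler of a commuting square (\<open>left_corners_eq\<close>,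
  \<open>right_corners_eq\<close>).

  The class of a trace is finite, with a computable bound on its size. If all homsets are finite,
  this holds because steps do not change the sources and targets of decorations
  (\<open>class_finite_locally_finite\<close>). If fillers are unique, a class contains at most one decoration of
  any given path (\<open>steps_unique\<close>): in a sequence of steps during which the path leaves a lattice
  point and returns to it, the last move is the inverse of the first at the same square, the other
  two corners of that square carry the same arrows at both times by induction on the length of the
  sequence, and so the returning decoration, which
  these arrows determine, is the same again. Hence a class has no more
  elements than there are lattice paths (\<open>class_finite_preordered\<close>).

  The decision procedure runs through all instruction lists up to a computable bound. An instruction
  consists of a position and, for homsets that are enumerated, the index of the arrow to try as a
  filler. Each list is executed from the trace of the first proof, where useless instructions do
  nothing, and the result is compared with the trace of the second (\<open>decideN_correct\<close>). The search
  is bounded by a function of the input number alone, because the procedure must also halt on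
  numbers that name no proof.\<close>

section \<open>Closure properties of the recursive functions\<close>

abbreviation pfst :: "nat \<Rightarrow> nat" where "pfst n \<equiv> fst (prod_decode n)"
abbreviation psnd :: "nat \<Rightarrow> nat" where "psnd n \<equiv> snd (prod_decode n)"

lemma recursive_id: "recursive (\<lambda>n. n)"
  using recursive.pair[OF recursive.left recursive.right] by simp

lemma recursive_const: "recursive (\<lambda>_. c)"
proof (induction c)
  case (Suc c)
  then show ?case using recursive.comp[OF recursive.suc] by simp
qed (rule recursive.zero)

lemma recursive_Suc: "recursive f \<Longrightarrow> recursive (\<lambda>n. Suc (f n))"
  by (rule recursive.comp[OF recursive.suc])

lemma recursive_pfst: "recursive f \<Longrightarrow> recursive (\<lambda>n. pfst (f n))"
  by (rule recursive.comp[OF recursive.left])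

lemma recursive_psnd: "recursive f \<Longrightarrow> recursive (\<lambda>n. psnd (f n))"
  by (rule recursive.comp[OF recursive.right])

text \<open>The rules below build recursive functions by structure. A bound variable in a primitive recursion,
  a sum or a quantifier is handled by packing it with the environment, so that \<open>\<lambda>n i. F n i\<close> is
  represented by \<open>\<lambda>z. F (pfst z) (psnd z)\<close>.\<close>

named_theorems rec_intros

lemmas [rec_intros] = recursive_id recursive_const recursive_Suc recursive_pfst recursive_psnd
  recursive.pair

lemma recursive_rec_nat [rec_intros]:
  assumes f: "recursive f"
    and g: "recursive (\<lambda>z. g (pfst z) (pfst (psnd z)) (psnd (psnd z)))"
    and m: "recursive m"
  shows "recursive (\<lambda>n. rec_nat (f n) (g n) (m n))"
proof -
  have "recursive (\<lambda>n. prod_encode (n, m n))"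
    by (intro rec_intros m)
  from recursive.comp[OF recursive.prec[OF f g] this] show ?thesis
    by simp
qed

lemma recursive_funpow [rec_intros]:
  assumes "recursive (\<lambda>z. F (pfst z) (psnd z))" "recursive k" "recursive x"
  shows "recursive (\<lambda>n. (F n ^^ k n) (x n))"
proof -
  have eq: "(F n ^^ m) y = rec_nat y (\<lambda>_ r. F n r) m" for n m y
    by (induction m) auto
  have "recursive (\<lambda>z. F (pfst (prod_encode (pfst z, psnd (psnd z)))) (psnd (prod_encode (pfst z, psnd (psnd z)))))"
    by (rule recursive.comp[OF assms(1)]) (intro rec_intros)
  then show ?thesis
    unfolding eq by (intro rec_intros assms) simp
qed

lemma recursive_plus [rec_intros]:
  assumes "recursive f" "recursive g"
  shows "recursive (\<lambda>n. f n + g n)"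
proof -
  have eq: "rec_nat a (\<lambda>_ r. Suc r) b = a + b" for a b :: nat
    by (induction b) auto
  have "recursive (\<lambda>n. rec_nat (f n) (\<lambda>_ r. Suc r) (g n))"
    by (intro rec_intros assms)
  then show ?thesis by (simp add: eq)
qed

lemma recursive_minus [rec_intros]:
  assumes "recursive f" "recursive g"
  shows "recursive (\<lambda>n. f n - g n)"
proof -
  have pred: "recursive (\<lambda>n. h n - Suc 0)" if "recursive h" for h
  proof -
    have eq: "rec_nat 0 (\<lambda>i r. i) b = b - Suc 0" for b
      by (cases b) auto
    have "recursive (\<lambda>n. rec_nat 0 (\<lambda>i r. i) (h n))"
      by (intro rec_intros that)
    then show ?thesis by (simp add: eq)
  qed
  have eq: "rec_nat a (\<lambda>_ r. r - Suc 0) b = a - b" for a b :: nat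
    by (induction b) auto
  have "recursive (\<lambda>n. rec_nat (f n) (\<lambda>_ r. r - Suc 0) (g n))"
    by (intro rec_intros assms pred)
  then show ?thesis by (simp add: eq)
qed

lemma recursive_times [rec_intros]:
  assumes "recursive f" "recursive g"
  shows "recursive (\<lambda>n. f n * g n)"
proof -
  have eq: "rec_nat 0 (\<lambda>_ r. r + a) b = a * b" for a b :: nat
    by (induction b) auto
  have "recursive (\<lambda>n. rec_nat 0 (\<lambda>_ r. r + f n) (g n))"
    by (intro rec_intros assms recursive.comp[OF assms(1)])
  then show ?thesis by (simp add: eq)
qed

lemma recursive_power [rec_intros]:
  assumes "recursive f" "recursive g"
  shows "recursive (\<lambda>n. f n ^ g n)"
proof -
  have eq: "rec_nat (Suc 0) (\<lambda>_ r. r * a) b = a ^ b" for a b :: nat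
    by (induction b) auto
  have "recursive (\<lambda>n. rec_nat (Suc 0) (\<lambda>_ r. r * f n) (g n))"
    by (intro rec_intros assms recursive.comp[OF assms(1)])
  then show ?thesis by (simp add: eq)
qed

lemma recursive_sum [rec_intros]:
  assumes "recursive (\<lambda>z. F (pfst z) (psnd z))" "recursive m"
  shows "recursive (\<lambda>n. \<Sum>i<m n. F n i)"
proof -
  have eq: "rec_nat 0 (\<lambda>i r. r + F n i) b = (\<Sum>i<b. F n i)" for n b
    by (induction b) auto
  have "recursive (\<lambda>z. F (pfst (prod_encode (pfst z, pfst (psnd z)))) (psnd (prod_encode (pfst z, pfst (psnd z)))))"
    by (rule recursive.comp[OF assms(1)]) (intro rec_intros)
  then have "recursive (\<lambda>n. rec_nat 0 (\<lambda>i r. r + F n i) (m n))"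
    by (intro rec_intros assms) simp
  then show ?thesis by (simp add: eq)
qed

text \<open>Decidable sets of numbers, given by a recursive characteristic function.\<close>

definition decidable :: "(nat \<Rightarrow> bool) \<Rightarrow> bool" where
  "decidable P \<longleftrightarrow> recursive (\<lambda>n. if P n then 1 else 0)"

lemma recursive_if [rec_intros]:
  assumes "decidable P" "recursive f" "recursive g"
  shows "recursive (\<lambda>n. if P n then f n else g n)"
proof -
  have eq: "(if P n then f n else g n) =
    (if P n then 1 else 0) * f n + (1 - (if P n then 1 else 0)) * g n" for n
    by simp
  show ?thesis
    unfolding eq by (intro rec_intros assms assms(1)[unfolded decidable_def])
qed

lemma decidable_pos: "recursive f \<Longrightarrow> decidable (\<lambda>n. 0 < f n)"
proof -
  assume f: "recursive f"
  have eq: "(if 0 < f n then 1 else 0) = 1 - (1 - f n)" for n by simp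
  show ?thesis unfolding decidable_def eq by (intro rec_intros f)
qed

lemma decidable_not [rec_intros]: "decidable P \<Longrightarrow> decidable (\<lambda>n. \<not> P n)"
proof -
  assume P: "decidable P"
  have eq: "(if \<not> P n then 1 else 0::nat) = (if P n then 0 else 1)" for n by simp
  show ?thesis unfolding decidable_def[of "\<lambda>n. \<not> P n"] eq by (intro rec_intros P)
qed

lemma decidable_conj [rec_intros]: "decidable P \<Longrightarrow> decidable Q \<Longrightarrow> decidable (\<lambda>n. P n \<and> Q n)"
proof -
  assume a: "decidable P" "decidable Q"
  have eq: "(if P n \<and> Q n then 1 else 0::nat) = (if P n then if Q n then 1 else 0 else 0)" for n
    by simp
  show ?thesis unfolding decidable_def[of "\<lambda>n. P n \<and> Q n"] eq by (intro rec_intros a)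
qed

lemma decidable_disj [rec_intros]: "decidable P \<Longrightarrow> decidable Q \<Longrightarrow> decidable (\<lambda>n. P n \<or> Q n)"
  using decidable_not[OF decidable_conj[OF decidable_not decidable_not], of P Q] by simp

lemma decidable_less [rec_intros]:
  assumes "recursive f" "recursive g" shows "decidable (\<lambda>n. f n < g n)"
proof -
  have "decidable (\<lambda>n. 0 < g n - f n)" by (intro decidable_pos rec_intros assms)
  then show ?thesis by simp
qed

lemma decidable_eq [rec_intros]:
  assumes "recursive f" "recursive g" shows "decidable (\<lambda>n. f n = g n)"
proof -
  have "decidable (\<lambda>n. \<not> f n < g n \<and> \<not> g n < f n)" by (intro rec_intros assms)
  moreover have "(\<not> a < b \<and> \<not> b < a) = (a = b)" for a b :: nat by auto
  ultimately show ?thesis by simp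
qed

lemma decidable_bex [rec_intros]:
  assumes "decidable (\<lambda>z. P (pfst z) (psnd z))" "recursive m"
  shows "decidable (\<lambda>n. \<exists>i<m n. P n i)"
proof -
  have "recursive (\<lambda>n. \<Sum>i<m n. if P n i then 1 else 0)"
    by (intro rec_intros assms)
  then have "decidable (\<lambda>n. 0 < (\<Sum>i<m n. if P n i then 1 else 0 :: nat))"
    by (rule decidable_pos)
  moreover have "(0 < (\<Sum>i<k. if P n i then 1 else 0 :: nat)) = (\<exists>i<k. P n i)" for n k
    by (auto simp: sum_pos2 simp flip: neq0_conv)
  ultimately show ?thesis by simp
qed

lemma decidable_ball [rec_intros]:
  assumes "decidable (\<lambda>z. P (pfst z) (psnd z))" "recursive m"
  shows "decidable (\<lambda>n. \<forall>i<m n. P n i)"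
proof -
  have "decidable (\<lambda>n. \<not> (\<exists>i<m n. \<not> P n i))"
    by (intro rec_intros assms)
  then show ?thesis by simp
qed

text \<open>Operations on the codes of lists. All are total: outside of their range they produce junk values.
  \<open>tab m g\<close> is the code of \<open>[g 0, \<dots>, g (m - 1)]\<close>.\<close>

definition chd :: "nat \<Rightarrow> nat" where "chd c = pfst (c - 1)"
definition ctl :: "nat \<Rightarrow> nat" where "ctl c = psnd (c - 1)"
definition cnth :: "nat \<Rightarrow> nat \<Rightarrow> nat" where "cnth c k = chd ((ctl ^^ k) c)"
definition tab :: "nat \<Rightarrow> (nat \<Rightarrow> nat) \<Rightarrow> nat" where "tab m g = list_encode (map g [0..<m])"

lemma recursive_chd [rec_intros]: "recursive f \<Longrightarrow> recursive (\<lambda>n. chd (f n))"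
  unfolding chd_def by (intro rec_intros)

lemma recursive_ctl [rec_intros]: "recursive f \<Longrightarrow> recursive (\<lambda>n. ctl (f n))"
  unfolding ctl_def by (intro rec_intros)

lemma recursive_cnth [rec_intros]:
  "recursive f \<Longrightarrow> recursive g \<Longrightarrow> recursive (\<lambda>n. cnth (f n) (g n))"
  unfolding cnth_def by (intro rec_intros)

lemma recursive_tab [rec_intros]:
  assumes "recursive m" "recursive (\<lambda>z. g (pfst z) (psnd z))"
  shows "recursive (\<lambda>n. tab (m n) (g n))"
proof -
  \<comment> \<open>the list is built from its end\<close>
  have shift: "rec_nat 0 (\<lambda>i r. Suc (prod_encode (h (b - Suc i), r))) k =
      list_encode (map h [b - k..<b])" if "k \<le> b" for h b k
    using that
  proof (induction k)
    case (Suc k)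
    then have "[b - Suc k..<b] = (b - Suc k) # [b - k..<b]"
      by (metis Suc_diff_Suc Suc_le_lessD diff_less upt_conv_Cons zero_less_Suc less_le_trans)
    then show ?case using Suc by simp
  qed simp
  have eq: "tab b h = rec_nat 0 (\<lambda>i r. Suc (prod_encode (h (b - Suc i), r))) b" for h b
    unfolding tab_def by (subst shift) auto
  have "recursive (\<lambda>z. (\<lambda>w. g (pfst w) (psnd w)) (prod_encode (pfst z, m (pfst z) - Suc (pfst (psnd z)))))"
    by (rule recursive.comp[OF assms(1)[THEN recursive.comp[OF assms(2)]], of "\<lambda>z. z"] recursive.comp[OF assms(2)])
       (intro rec_intros recursive.comp[OF assms(1)])
  then show ?thesis unfolding eq by (intro rec_intros assms) simp
qed

lemma ctl_Cons [simp]: "ctl (list_encode (x # xs)) = list_encode xs"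
  by (simp add: ctl_def)

lemma ctl_0 [simp]: "ctl 0 = 0"
  by (simp add: ctl_def prod_decode_def prod_decode_aux.simps)

lemma funpow_ctl_0: "(ctl ^^ k) 0 = 0"
  by (induction k) simp_all

lemma funpow_ctl: "(ctl ^^ k) (list_encode xs) = list_encode (drop k xs)"
proof (induction k arbitrary: xs)
  case (Suc k)
  then show ?case by (cases xs) (simp_all add: funpow_ctl_0 funpow_Suc_right del: funpow.simps(2) list_encode.simps(2))
qed simp

lemma cnth_encode: "k < length xs \<Longrightarrow> cnth (list_encode xs) k = xs ! k"
  unfolding cnth_def funpow_ctl by (simp add: chd_def Cons_nth_drop_Suc[symmetric])

lemma cnth_decode: "k < length (list_decode c) \<Longrightarrow> cnth c k = list_decode c ! k"
  using cnth_encode[of k "list_decode c"] by simp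

lemma decode_tab [simp]: "list_decode (tab m g) = map g [0..<m]"
  by (simp add: tab_def)

text \<open>Codes dominate entries, and coding is monotone; this is what makes a bounded search over codes of
  lists possible.\<close>

lemma prod_encode_mono: "a \<le> a' \<Longrightarrow> b \<le> b' \<Longrightarrow> prod_encode (a, b) \<le> prod_encode (a', b')"
proof -
  have "mono triangle" by (rule monoI) (unfold triangle_def, intro div_le_mono mult_le_mono Suc_le_mono[THEN iffD2])
  then show "a \<le> a' \<Longrightarrow> b \<le> b' \<Longrightarrow> ?thesis"
    by (auto simp: prod_encode_def intro!: add_mono dest: monoD)
qed

lemma list_encode_mono: "list_all2 (\<le>) xs ys \<Longrightarrow> list_encode xs \<le> list_encode ys"
  by (induction rule: list_all2_induct) (simp_all add: prod_encode_mono)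

lemma length_le_list_encode: "length xs \<le> list_encode xs"
proof (induction xs)
  case (Cons x xs)
  then show ?case using le_prod_encode_2[of "list_encode xs" x] by simp
qed simp

lemma mem_less_list_encode: "x \<in> set xs \<Longrightarrow> x < list_encode xs"
proof (induction xs)
  case (Cons y xs)
  then show ?case using le_prod_encode_1[of y "list_encode xs"] le_prod_encode_2[of "list_encode xs" y]
    by auto
qed simp

lemma psnd_le: "psnd a \<le> a"
  using le_prod_encode_2[of "psnd a" "pfst a"] by simp

section \<open>Decorated lattice paths\<close>

definition composable :: "('o, 'a) cat \<Rightarrow> 'a \<Rightarrow> 'a \<Rightarrow> bool" where
  "composable C f g \<longleftrightarrow> f \<in> Arr C \<and> g \<in> Arr C \<and> Tgt C f = Src C g"

text \<open>A connective is a pair of its direction (\<^term>\<open>True\<close> for push, \<^term>\<open>False\<close> for pull) and its arrow.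
  \<open>left_edge C c h h'\<close> relates the arrows of the conclusion (\<open>h\<close>) and of the premise (\<open>h'\<close>) of the
  left rule for \<open>c\<close>; \<open>right_edge\<close> does so for right rules.\<close>

definition left_edge :: "('o, 'a) cat \<Rightarrow> bool \<times> 'a \<Rightarrow> 'a \<Rightarrow> 'a \<Rightarrow> bool" where
  "left_edge C c h h' \<longleftrightarrow>
    (if fst c then composable C (snd c) h \<and> h' = snd c \<cdot>\<^bsub>C\<^esub> h
     else composable C (snd c) h' \<and> h = snd c \<cdot>\<^bsub>C\<^esub> h')"

definition right_edge :: "('o, 'a) cat \<Rightarrow> bool \<times> 'a \<Rightarrow> 'a \<Rightarrow> 'a \<Rightarrow> bool" where
  "right_edge C d h h' \<longleftrightarrow>
    (if fst d then composable C h' (snd d) \<and> h = h' \<cdot>\<^bsub>C\<^esub> snd d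
     else composable C h (snd d) \<and> h' = h \<cdot>\<^bsub>C\<^esub> snd d)"

text \<open>A node \<open>(l, h)\<close> at position \<open>k\<close> of a path is the lattice point \<open>(l, k - l)\<close>, reached from the root by
  \<open>l\<close> left and \<open>k - l\<close> right rules, with its decoration \<open>h\<close>. The lists \<open>ls\<close> and \<open>rs\<close> are the connectives
  of the left and the right formula, outermost first.\<close>

definition node_edge ::
  "('o, 'a) cat \<Rightarrow> (bool \<times> 'a) list \<Rightarrow> (bool \<times> 'a) list \<Rightarrow> nat \<Rightarrow> nat \<times> 'a \<Rightarrow> nat \<times> 'a \<Rightarrow> bool" where
  "node_edge C ls rs k p q \<longleftrightarrow>
    (fst q = Suc (fst p) \<and> fst p < length ls \<and> left_edge C (ls ! fst p) (snd p) (snd q)) \<or>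
    (fst q = fst p \<and> fst p \<le> k \<and> k - fst p < length rs \<and>
      right_edge C (rs ! (k - fst p)) (snd p) (snd q))"

text \<open>That the path ends in \<open>(length ls, length rs)\<close> follows from its length, since \<open>node_edge\<close> keeps both
  coordinates in range.\<close>

definition valid_path ::
  "('o, 'a) cat \<Rightarrow> (bool \<times> 'a) list \<Rightarrow> (bool \<times> 'a) list \<Rightarrow> (nat \<times> 'a) list \<Rightarrow> bool" where
  "valid_path C ls rs x \<longleftrightarrow>
    length x = Suc (length ls + length rs) \<and> fst (x ! 0) = 0 \<and> snd (x ! 0) \<in> Arr C \<and>
    (\<forall>k < length ls + length rs. node_edge C ls rs k (x ! k) (x ! Suc k))"

text \<open>A single interior node is replaced, and its lattice point moves. Replacing only the decoration is not
  a swap.\<close>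

definition swap :: "(nat \<times> 'a) list \<Rightarrow> (nat \<times> 'a) list \<Rightarrow> bool" where
  "swap x y \<longleftrightarrow> length x = length y \<and>
    (\<exists>k. 0 < k \<and> Suc k < length x \<and> fst (x ! k) \<noteq> fst (y ! k) \<and> y = x[k := y ! k])"

definition step ::
  "('o, 'a) cat \<Rightarrow> (bool \<times> 'a) list \<Rightarrow> (bool \<times> 'a) list \<Rightarrow> (nat \<times> 'a) list \<Rightarrow> (nat \<times> 'a) list \<Rightarrow> bool" where
  "step C ls rs x y \<longleftrightarrow> valid_path C ls rs x \<and> valid_path C ls rs y \<and> swap x y"

text \<open>The possible decorations of the corner of a unit square between \<open>h\<close> and \<open>h'\<close> that is passed by
  the left rule first, respectively by the right rule first.\<close>

definition left_corners :: "('o, 'a) cat \<Rightarrow> bool \<times> 'a \<Rightarrow> bool \<times> 'a \<Rightarrow> 'a \<Rightarrow> 'a \<Rightarrow> 'a set" where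
  "left_corners C c d h h' = {u. left_edge C c h u \<and> right_edge C d u h'}"

definition right_corners :: "('o, 'a) cat \<Rightarrow> bool \<times> 'a \<Rightarrow> bool \<times> 'a \<Rightarrow> 'a \<Rightarrow> 'a \<Rightarrow> 'a set" where
  "right_corners C c d h h' = {u. right_edge C d h u \<and> left_edge C c u h'}"

context category
begin

lemma composable_iff: "composable C f g \<longleftrightarrow> (\<exists>A B E. f \<in> Hom C A B \<and> g \<in> Hom C B E)"
  by (auto simp: composable_def Hom_def)

lemma composable_comp:
  assumes "composable C f g"
  shows "f \<cdot> g \<in> Arr C" "Src C (f \<cdot> g) = Src C f" "Tgt C (f \<cdot> g) = Tgt C g"
  using assms comp_hom[of f "Src C f" "Tgt C f" g "Tgt C g"]
  by (auto simp: composable_def Hom_def)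

lemma composable_assoc:
  "composable C f g \<Longrightarrow> composable C g h \<Longrightarrow> (f \<cdot> g) \<cdot> h = f \<cdot> (g \<cdot> h)"
  using comp_assoc[of f "Src C f" "Tgt C f" g "Tgt C g" h "Tgt C h"]
  by (auto simp: composable_def Hom_def)

lemma edge_arr:
  "left_edge C c h h' \<Longrightarrow> h \<in> Arr C \<and> h' \<in> Arr C \<and> snd c \<in> Arr C"
  "right_edge C c h h' \<Longrightarrow> h \<in> Arr C \<and> h' \<in> Arr C \<and> snd c \<in> Arr C"
  by (auto simp: left_edge_def right_edge_def composable_comp composable_def split: if_splits)

lemma edge_src_tgt:
  "left_edge C c h h' \<Longrightarrow> Tgt C h' = Tgt C h"
  "right_edge C c h h' \<Longrightarrow> Src C h' = Src C h"
  by (auto simp: left_edge_def right_edge_def composable_comp split: if_splits)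

lemma comp_simps:
  assumes "f \<in> Arr C" "g \<in> Arr C" "Tgt C f = Src C g"
  shows "f \<cdot> g \<in> Arr C" "Src C (f \<cdot> g) = Src C f" "Tgt C (f \<cdot> g) = Tgt C g"
    "h \<in> Arr C \<Longrightarrow> Tgt C g = Src C h \<Longrightarrow> (f \<cdot> g) \<cdot> h = f \<cdot> (g \<cdot> h)"
  using assms composable_comp[of f g] composable_assoc[of f g h] by (simp_all add: composable_def)

text \<open>Unless the corner is a filler, it is determined. The premise that the opposite corner can be
  decorated supplies composability and the remaining equation.\<close>

lemma left_corners_eq:
  assumes "right_corners C (s, f) (t, g) h h' \<noteq> {}"
  shows "left_corners C (s, f) (t, g) h h' =
    (if s then {f \<cdot> h} else if t then {h' \<cdot> g} else fillers C f h' h g)"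
proof -
  from assms obtain u where u: "right_edge C (t, g) h u" "left_edge C (s, f) u h'"
    by (auto simp: right_corners_def)
  then have arr: "f \<in> Arr C" "g \<in> Arr C" "u \<in> Arr C" "h \<in> Arr C" "h' \<in> Arr C"
    using edge_arr by fastforce+
  have "w \<in> left_corners C (s, f) (t, g) h h' \<longleftrightarrow>
    w \<in> (if s then {f \<cdot> h} else if t then {h' \<cdot> g} else fillers C f h' h g)" for w
  proof (cases s; cases t)
    assume "s" "t"
    then have "h = u \<cdot> g" "h' = f \<cdot> u" "Tgt C u = Src C g" "Tgt C f = Src C u"
      using u by (simp_all add: left_edge_def right_edge_def composable_def)
    with \<open>s\<close> \<open>t\<close> arr show ?thesis
      by (auto simp: left_corners_def left_edge_def right_edge_def composable_def comp_simps)
  next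
    assume "s" "\<not> t"
    then have "u = h \<cdot> g" "h' = f \<cdot> (h \<cdot> g)" "Tgt C h = Src C g" "Tgt C f = Src C h"
      using u arr by (simp_all add: left_edge_def right_edge_def composable_def comp_simps)
    with \<open>s\<close> \<open>\<not> t\<close> arr show ?thesis
      by (auto simp: left_corners_def left_edge_def right_edge_def composable_def comp_simps)
  next
    assume "\<not> s" "t"
    then have "u = f \<cdot> h'" "h = f \<cdot> (h' \<cdot> g)" "Tgt C h' = Src C g" "Tgt C f = Src C h'"
      using u arr by (simp_all add: left_edge_def right_edge_def composable_def comp_simps)
    with \<open>\<not> s\<close> \<open>t\<close> arr show ?thesis
      by (auto simp: left_corners_def left_edge_def right_edge_def composable_def comp_simps)
  next
    assume "\<not> s" "\<not> t"
    with arr show ?thesis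
      by (auto simp: left_corners_def left_edge_def right_edge_def composable_def fillers_def Hom_def)
  qed
  then show ?thesis by blast
qed

lemma right_corners_eq:
  assumes "left_corners C (s, f) (t, g) h h' \<noteq> {}"
  shows "right_corners C (s, f) (t, g) h h' =
    (if \<not> t then {h \<cdot> g} else if \<not> s then {f \<cdot> h'} else fillers C f h h' g)"
proof -
  from assms obtain u where u: "left_edge C (s, f) h u" "right_edge C (t, g) u h'"
    by (auto simp: left_corners_def)
  then have arr: "f \<in> Arr C" "g \<in> Arr C" "u \<in> Arr C" "h \<in> Arr C" "h' \<in> Arr C"
    using edge_arr by fastforce+
  have "w \<in> right_corners C (s, f) (t, g) h h' \<longleftrightarrow>
    w \<in> (if \<not> t then {h \<cdot> g} else if \<not> s then {f \<cdot> h'} else fillers C f h h' g)" for w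
  proof (cases s; cases t)
    assume "s" "t"
    with arr show ?thesis
      by (auto simp: right_corners_def left_edge_def right_edge_def composable_def fillers_def Hom_def)
  next
    assume "s" "\<not> t"
    then have "u = f \<cdot> h" "h' = f \<cdot> (h \<cdot> g)" "Tgt C h = Src C g" "Tgt C f = Src C h"
      using u arr by (simp_all add: left_edge_def right_edge_def composable_def comp_simps)
    with \<open>s\<close> \<open>\<not> t\<close> arr show ?thesis
      by (auto simp: right_corners_def left_edge_def right_edge_def composable_def comp_simps)
  next
    assume "\<not> s" "t"
    then have "u = h' \<cdot> g" "h = f \<cdot> (h' \<cdot> g)" "Tgt C h' = Src C g" "Tgt C f = Src C h'"
      using u arr by (simp_all add: left_edge_def right_edge_def composable_def comp_simps)
    with \<open>\<not> s\<close> \<open>t\<close> arr show ?thesis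
      by (auto simp: right_corners_def left_edge_def right_edge_def composable_def comp_simps)
  next
    assume "\<not> s" "\<not> t"
    then have "h = f \<cdot> u" "h' = u \<cdot> g" "Tgt C u = Src C g" "Tgt C f = Src C u"
      using u by (simp_all add: left_edge_def right_edge_def composable_def)
    with \<open>\<not> s\<close> \<open>\<not> t\<close> arr show ?thesis
      by (auto simp: right_corners_def left_edge_def right_edge_def composable_def comp_simps)
  qed
  then show ?thesis by blast
qed

lemma left_corner_square:
  assumes "right_corners C (False, f) (False, g) h h' \<noteq> {}"
  shows "commuting_square C f h' h g"
proof -
  from assms obtain u where "right_edge C (False, g) h u" "left_edge C (False, f) u h'"
    by (auto simp: right_corners_def)
  then have u: "composable C h g" "u = h \<cdot> g" "composable C f h'" "u = f \<cdot> h'"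
    by (auto simp: left_edge_def right_edge_def)
  then have "Src C h = Src C f" "Tgt C h' = Tgt C g"
    using composable_comp[of h g] composable_comp[of f h'] by auto
  then have "f \<in> Hom C (Src C f) (Tgt C f)" "h' \<in> Hom C (Tgt C f) (Tgt C g)"
    "h \<in> Hom C (Src C f) (Src C g)" "g \<in> Hom C (Src C g) (Tgt C g)" "f \<cdot> h' = h \<cdot> g"
    using u by (auto simp: composable_def Hom_def)
  then show ?thesis unfolding commuting_square_def by blast
qed

lemma right_corner_square:
  assumes "left_corners C (True, f) (True, g) h h' \<noteq> {}"
  shows "commuting_square C f h h' g"
proof -
  from assms obtain u where "left_edge C (True, f) h u" "right_edge C (True, g) u h'"
    by (auto simp: left_corners_def)
  then have u: "composable C f h" "u = f \<cdot> h" "composable C h' g" "u = h' \<cdot> g"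
    by (auto simp: left_edge_def right_edge_def)
  then have "Src C h' = Src C f" "Tgt C h = Tgt C g"
    using composable_comp[of f h] composable_comp[of h' g] by auto
  then have "f \<in> Hom C (Src C f) (Tgt C f)" "h \<in> Hom C (Tgt C f) (Tgt C g)"
    "h' \<in> Hom C (Src C f) (Src C g)" "g \<in> Hom C (Src C g) (Tgt C g)" "f \<cdot> h = h' \<cdot> g"
    using u by (auto simp: composable_def Hom_def)
  then show ?thesis unfolding commuting_square_def by blast
qed

lemma corner_unique:
  assumes fp: "factorization_preordered C"
  shows "u \<in> left_corners C c d h h' \<Longrightarrow> v \<in> left_corners C c d h h' \<Longrightarrow> u = v"
    and "u \<in> right_corners C c d h h' \<Longrightarrow> v \<in> right_corners C c d h h' \<Longrightarrow> u = v"
proof -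
  have fill: "u = v" if "f \<cdot> u = f \<cdot> v" "u \<cdot> g = v \<cdot> g"
    "composable C f u" "composable C f v" "composable C u g" "composable C v g" for f g u v
  proof -
    have "Tgt C u = Src C g" "Tgt C v = Src C g" "Src C u = Tgt C f" "Src C v = Tgt C f"
      "{f, u, v, g} \<subseteq> Arr C"
      using that by (auto simp: composable_def)
    then have "f \<in> Hom C (Src C f) (Tgt C f)" "u \<in> Hom C (Tgt C f) (Src C g)"
      "v \<in> Hom C (Tgt C f) (Src C g)" "g \<in> Hom C (Src C g) (Tgt C g)"
      by (auto simp: Hom_def)
    then show ?thesis using fp that(1,2) unfolding factorization_preordered_def by blast
  qed
  show "u \<in> left_corners C c d h h' \<Longrightarrow> v \<in> left_corners C c d h h' \<Longrightarrow> u = v"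
    using fill[of "snd c" u v "snd d"]
    by (auto simp: left_corners_def left_edge_def right_edge_def split: if_splits)
  show "u \<in> right_corners C c d h h' \<Longrightarrow> v \<in> right_corners C c d h h' \<Longrightarrow> u = v"
    using fill[of "snd c" u v "snd d"]
    by (auto simp: right_corners_def left_edge_def right_edge_def split: if_splits)
qed

end

lemma valid_path_edge:
  "valid_path C ls rs x \<Longrightarrow> Suc k < length x \<Longrightarrow> node_edge C ls rs k (x ! k) (x ! Suc k)"
  by (auto simp: valid_path_def)

lemma valid_path_fst_le:
  assumes "valid_path C ls rs x" "k < length x"
  shows "fst (x ! k) \<le> k \<and> fst (x ! k) \<le> length ls"
  using assms(2)
proof (induction k)
  case 0
  then show ?case using assms(1) by (simp add: valid_path_def)
next
  case (Suc k)
  then show ?case using valid_path_edge[OF assms(1) Suc.prems]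
    by (auto simp: node_edge_def)
qed

lemma step_sym: "step C ls rs x y \<Longrightarrow> step C ls rs y x"
  unfolding step_def swap_def by (metis list_update_id list_update_overwrite)

lemma steps_sym: "(step C ls rs)\<^sup>*\<^sup>* x y \<Longrightarrow> (step C ls rs)\<^sup>*\<^sup>* y x"
  by (induction rule: rtranclp_induct) (auto intro: step_sym converse_rtranclp_into_rtranclp)

text \<open>A step takes place at a unit square: the node before it has height \<open>l\<close>, the node after it
  height \<open>l + 1\<close>, and the node itself changes between the two.\<close>

lemma step_cases:
  assumes "step C ls rs x y"
  obtains j u v where "Suc (Suc j) < length x" "y = x[Suc j := v]" "x ! Suc j = u"
    "{fst u, fst v} = {fst (x ! j), Suc (fst (x ! j))}" "fst u \<noteq> fst v"
    "fst (x ! Suc (Suc j)) = Suc (fst (x ! j))"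
proof -
  from assms obtain k where k: "0 < k" "Suc k < length x" "fst (x ! k) \<noteq> fst (y ! k)"
    "y = x[k := y ! k]" and v: "valid_path C ls rs x" "valid_path C ls rs y"
    "length y = length x"
    unfolding step_def swap_def by metis
  obtain j where j: "k = Suc j" using k(1) by (cases k) auto
  have y: "y ! j = x ! j" "y ! Suc k = x ! Suc k"
    by (subst k(4), simp add: j)+
  have inc: "fst q = fst p \<or> fst q = Suc (fst p)" if "node_edge C ls rs i p q" for i p q
    using that by (auto simp: node_edge_def)
  have "fst (x ! Suc j) = fst (x ! j) \<or> fst (x ! Suc j) = Suc (fst (x ! j))"
    "fst (x ! Suc (Suc j)) = fst (x ! Suc j) \<or> fst (x ! Suc (Suc j)) = Suc (fst (x ! Suc j))"
    "fst (y ! Suc j) = fst (x ! j) \<or> fst (y ! Suc j) = Suc (fst (x ! j))"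
    "fst (x ! Suc (Suc j)) = fst (y ! Suc j) \<or> fst (x ! Suc (Suc j)) = Suc (fst (y ! Suc j))"
    using inc[OF valid_path_edge[OF v(1), of j]] inc[OF valid_path_edge[OF v(1), of "Suc j"]]
      inc[OF valid_path_edge[OF v(2), of j]] inc[OF valid_path_edge[OF v(2), of "Suc j"]]
      k(2) v(3) y by (simp_all add: j)
  moreover have "fst (x ! Suc j) \<noteq> fst (y ! Suc j)"
    using k(3) by (simp add: j)
  ultimately have "{fst (x ! Suc j), fst (y ! Suc j)} = {fst (x ! j), Suc (fst (x ! j))}"
    "fst (x ! Suc (Suc j)) = Suc (fst (x ! j))"
    by fastforce+
  then show ?thesis
    using that[of j "y ! k" "x ! k"] k by (simp add: j)
qed

lemma node_edges_left:
  assumes "node_edge C ls rs j p u" "node_edge C ls rs (Suc j) u q"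
    "fst u = Suc (fst p)" "fst q = Suc (fst p)"
  shows "snd u \<in> left_corners C (ls ! fst p) (rs ! (j - fst p)) (snd p) (snd q)"
  using assms by (auto simp: node_edge_def left_corners_def)

lemma node_edges_right:
  assumes "node_edge C ls rs j p u" "node_edge C ls rs (Suc j) u q"
    "fst u = fst p" "fst q = Suc (fst p)"
  shows "snd u \<in> right_corners C (ls ! fst p) (rs ! (j - fst p)) (snd p) (snd q)"
  using assms by (auto simp: node_edge_def right_corners_def)

lemma node_edges_iff:
  assumes "node_edge C ls rs j p u" "node_edge C ls rs (Suc j) u q"
    "fst q = Suc (fst p)" "fst v \<noteq> fst u"
  shows "node_edge C ls rs j p v \<and> node_edge C ls rs (Suc j) v q \<longleftrightarrow>
    (let c = ls ! fst p; d = rs ! (j - fst p) in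
     if fst u = fst p
     then fst v = Suc (fst p) \<and> snd v \<in> left_corners C c d (snd p) (snd q)
     else fst v = fst p \<and> snd v \<in> right_corners C c d (snd p) (snd q))"
proof -
  obtain i h where p: "p = (i, h)" by (cases p)
  obtain l w where u: "u = (l, w)" by (cases u)
  obtain l' w' where v: "v = (l', w')" by (cases v)
  obtain h' where q: "q = (Suc i, h')" using assms(3) p by (cases q) auto
  show ?thesis
  proof (cases "l = i")
    case True
    with assms p u q have "i \<le> j" "j - i < length rs" "i < length ls"
      by (simp_all add: node_edge_def)
    then show ?thesis
      using True assms(4) by (auto simp: p q u v node_edge_def left_corners_def)
  next
    case False
    with assms(1) p u have l: "l = Suc i" "i < length ls"
      by (simp_all add: node_edge_def)
    with assms(2) u q have "i \<le> j" "j - i < length rs"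
      by (simp_all add: node_edge_def)
    then show ?thesis
      using l assms(4) by (auto simp: p q u v node_edge_def right_corners_def)
  qed
qed

text \<open>Replacing a node by one of different height keeps the path valid iff the new node is a decorated
  opposite corner. Both directions of the analysis of the search procedure rest on this.\<close>

lemma valid_path_update_iff:
  assumes x: "valid_path C ls rs x" and j: "Suc (Suc j) < length x"
    and q: "fst (x ! Suc (Suc j)) = Suc (fst (x ! j))"
    and ne: "fst v \<noteq> fst (x ! Suc j)"
  shows "valid_path C ls rs (x[Suc j := v]) \<longleftrightarrow>
    (let c = ls ! fst (x ! j); d = rs ! (j - fst (x ! j)); h = snd (x ! j);
         h' = snd (x ! Suc (Suc j)) in
     if fst (x ! Suc j) = fst (x ! j)
     then fst v = Suc (fst (x ! j)) \<and> snd v \<in> left_corners C c d h h'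
     else fst v = fst (x ! j) \<and> snd v \<in> right_corners C c d h h')"
proof -
  have len: "length x = Suc (length ls + length rs)" using x by (simp add: valid_path_def)
  have e1: "node_edge C ls rs j (x ! j) (x ! Suc j)"
    and e2: "node_edge C ls rs (Suc j) (x ! Suc j) (x ! Suc (Suc j))"
    using valid_path_edge[OF x] j by auto
  have "valid_path C ls rs (x[Suc j := v]) \<longleftrightarrow>
      node_edge C ls rs j (x ! j) v \<and> node_edge C ls rs (Suc j) v (x ! Suc (Suc j))"
    (is "?l \<longleftrightarrow> ?r")
  proof
    assume ?l
    from valid_path_edge[OF this, of j] valid_path_edge[OF this, of "Suc j"] show ?r
      using j by simp
  next
    assume r: ?r
    have "node_edge C ls rs k (x[Suc j := v] ! k) (x[Suc j := v] ! Suc k)"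
      if "k < length ls + length rs" for k
    proof -
      consider "k = j" | "k = Suc j" | "k \<noteq> j" "k \<noteq> Suc j" by blast
      then show ?thesis
      proof cases
        case 3
        then show ?thesis using valid_path_edge[OF x, of k] that len by simp
      qed (use r that len in auto)
    qed
    then show ?l using x by (simp add: valid_path_def)
  qed
  also have "\<dots> \<longleftrightarrow> (let c = ls ! fst (x ! j); d = rs ! (j - fst (x ! j)); h = snd (x ! j);
         h' = snd (x ! Suc (Suc j)) in
     if fst (x ! Suc j) = fst (x ! j)
     then fst v = Suc (fst (x ! j)) \<and> snd v \<in> left_corners C c d h h'
     else fst v = fst (x ! j) \<and> snd v \<in> right_corners C c d h h')"
    unfolding Let_def by (rule node_edges_iff[OF e1 e2 q ne, unfolded Let_def])
  finally show ?thesis .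
qed

section \<open>Uniqueness of decorations when fillers are unique\<close>

lemma step_height:
  assumes "step C ls rs x y" "k < length x"
  shows "length y = length x"
    and "fst (y ! k) \<noteq> fst (x ! k) \<or> y ! k = x ! k"
    and "fst (y ! k) \<le> Suc (fst (x ! k))" "fst (x ! k) \<le> Suc (fst (y ! k))"
proof -
  obtain j u v where s: "Suc (Suc j) < length x" "y = x[Suc j := v]" "x ! Suc j = u"
    "{fst u, fst v} = {fst (x ! j), Suc (fst (x ! j))}" "fst u \<noteq> fst v"
    by (rule step_cases[OF assms(1)])
  show "length y = length x" using s by simp
  have c: "fst u = fst (x ! j) \<and> fst v = Suc (fst (x ! j)) \<or>
      fst v = fst (x ! j) \<and> fst u = Suc (fst (x ! j))"
    using s(4,5) by (auto simp: doubleton_eq_iff)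
  have "y ! k = (if k = Suc j then v else x ! k)"
    using assms(2) s(2) by auto
  then show "fst (y ! k) \<noteq> fst (x ! k) \<or> y ! k = x ! k"
    "fst (y ! k) \<le> Suc (fst (x ! k))" "fst (x ! k) \<le> Suc (fst (y ! k))"
    using c s(3) by auto
qed

text \<open>Heights change by at most one in a step, so a path that avoids a lattice point stays on one side of
  it.\<close>

lemma chain_side:
  assumes X: "\<And>m. i \<le> m \<Longrightarrow> m < n \<Longrightarrow> step C ls rs (X m) (X (Suc m))"
    and k: "k < length (X i)"
    and ne: "\<And>m. i \<le> m \<Longrightarrow> m \<le> n \<Longrightarrow> fst (X m ! k) \<noteq> l"
    and m: "i \<le> m" "m \<le> n"
  shows "length (X m) = length (X i) \<and> (fst (X m ! k) < l \<longleftrightarrow> fst (X i ! k) < l)"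
  using m
proof (induction m rule: dec_induct)
  case (step m)
  then have IH: "length (X m) = length (X i)" "fst (X m ! k) < l \<longleftrightarrow> fst (X i ! k) < l"
    by auto
  have "k < length (X m)" using IH k by simp
  note h = step_height[OF X[of m] this]
  have "fst (X m ! k) \<noteq> l" "fst (X (Suc m) ! k) \<noteq> l" using ne step by auto
  then show ?case using h step IH by fastforce
qed simp

text \<open>The loop argument: if a sequence of steps leads back to the height that node \<open>k\<close> had, it leads back
  to the same decoration. The induction is on the length of the sequence.\<close>

lemma (in category) chain_unique:
  assumes fp: "factorization_preordered C"
    and "\<And>m. i \<le> m \<Longrightarrow> m < n \<Longrightarrow> step C ls rs (X m) (X (Suc m))"
    and "i \<le> n" "k < length (X i)" "fst (X n ! k) = fst (X i ! k)"
  shows "X n ! k = X i ! k"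
  using assms(2-)
proof (induction "n - i" arbitrary: i n k rule: less_induct)
  case less
  note X = less.prems(1)
  let ?l = "fst (X i ! k)"
  have len: "length (X m) = length (X i)" if "i \<le> m" "m \<le> n" for m
    using that
  proof (induction m rule: dec_induct)
    case (step m)
    then show ?case using X[of m] step_def[of C ls rs] by (auto simp: swap_def)
  qed simp
  show ?case
  proof (cases "\<exists>m. i < m \<and> m < n \<and> fst (X m ! k) = ?l")
    case True
    then obtain m where m: "i < m" "m < n" "fst (X m ! k) = ?l" by blast
    have "X m ! k = X i ! k"
      using less m by (intro less.hyps) auto
    moreover have "X n ! k = X m ! k"
      using less m len[of m] by (intro less.hyps) auto
    ultimately show ?thesis by simp
  next
    case False
    consider "n = i" | "n = Suc i" | "Suc (Suc i) \<le> n" using less.prems(2) by linarith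
    then show ?thesis
    proof cases
      case 2
      then show ?thesis using step_height(2)[OF X[of i] less.prems(3)] less.prems(4) by auto
    next
      case 3
      define n' where "n' = n - 1"
      have n': "n = Suc n'" "Suc i \<le> n'" using 3 by (auto simp: n'_def)
      have off: "fst (X m ! k) \<noteq> ?l" if "Suc i \<le> m" "m \<le> n'" for m
        using False that n' by auto
      have s1: "step C ls rs (X i) (X (Suc i))" and s2: "step C ls rs (X n') (X n)"
        using X[of i] X[of n'] n' by auto
      have len': "k < length (X i)" "k < length (X (Suc i))" "k < length (X n')" "k < length (X n)"
        using less.prems(3) len[of "Suc i"] len[of n'] len[of n] n' by auto
      have side: "fst (X n' ! k) < ?l \<longleftrightarrow> fst (X (Suc i) ! k) < ?l"
        using chain_side[of "Suc i" n' C ls rs X k ?l n'] X off len' n' by auto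
      obtain j u v where a: "Suc (Suc j) < length (X i)" "X (Suc i) = (X i)[Suc j := v]"
        "X i ! Suc j = u" "{fst u, fst v} = {fst (X i ! j), Suc (fst (X i ! j))}" "fst u \<noteq> fst v"
        "fst (X i ! Suc (Suc j)) = Suc (fst (X i ! j))"
        by (rule step_cases[OF s1])
      obtain j' u' v' where b: "Suc (Suc j') < length (X n')" "X n = (X n')[Suc j' := v']"
        "X n' ! Suc j' = u'" "{fst u', fst v'} = {fst (X n' ! j'), Suc (fst (X n' ! j'))}"
        "fst u' \<noteq> fst v'" "fst (X n' ! Suc (Suc j')) = Suc (fst (X n' ! j'))"
        by (rule step_cases[OF s2])
      \<comment> \<open>the first and the last step move node \<open>k\<close>\<close>
      have k: "k = Suc j"
        using off[of "Suc i"] n' a(2) by (metis nth_list_update_neq order_refl)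
      have k': "k = Suc j'"
        using off[of n'] n' b(2) less.prems(4) by (metis nth_list_update_neq order_refl)
      have jj: "j' = j" using k k' by simp
      have v: "X (Suc i) ! k = v" and v': "X n ! k = v'"
        using a b k k' len' by auto
      have fv': "fst v' = fst u" using v' less.prems(4) a(3) k by simp
      have lu: "?l = fst u" using a(3) k by simp
      \<comment> \<open>the path returns from the side to which it left, hence across the same square\<close>
      have "fst u' < fst u \<longleftrightarrow> fst v < fst u"
        using side v b(3) k' lu by simp
      then have "fst (X n' ! j) = fst (X i ! j)"
        using a(4,5) b(4,5) fv' jj by (auto simp: doubleton_eq_iff)
      then have eqh: "fst (X n' ! j) = fst (X (Suc i) ! j)"
        "fst (X n' ! Suc (Suc j)) = fst (X (Suc i) ! Suc (Suc j))"
        using a b jj by auto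
      \<comment> \<open>the other two corners of the square carry the same arrows, by induction\<close>
      have "X n' ! j = X (Suc i) ! j"
        using less n' eqh(1) a(1) len[of "Suc i"] by (intro less.hyps) auto
      then have A: "X n ! j = X i ! j" using a(2) b(2) jj by simp
      have "X n' ! Suc (Suc j) = X (Suc i) ! Suc (Suc j)"
        using less n' eqh(2) a(1) len[of "Suc i"] by (intro less.hyps) auto
      then have D: "X n ! Suc (Suc j) = X i ! Suc (Suc j)" using a(2) b(2) jj by simp
      have vi: "valid_path C ls rs (X i)" and vn: "valid_path C ls rs (X n)"
        using s1 s2 by (auto simp: step_def)
      have ei: "node_edge C ls rs j (X i ! j) u" "node_edge C ls rs (Suc j) u (X i ! Suc (Suc j))"
        using valid_path_edge[OF vi] a(1,3) by auto
      have en: "node_edge C ls rs j (X i ! j) v'" "node_edge C ls rs (Suc j) v' (X i ! Suc (Suc j))"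
        using valid_path_edge[OF vn, of j] valid_path_edge[OF vn, of "Suc j"] a(1) len[of n] n' A D v' k
        by auto
      have "snd v' = snd u"
      proof (cases "fst u = fst (X i ! j)")
        case True
        then show ?thesis
          using node_edges_right[OF ei] node_edges_right[OF en] a(6) fv' corner_unique(2)[OF fp]
          by metis
      next
        case False
        then have "fst u = Suc (fst (X i ! j))" using a(4) by (auto simp: doubleton_eq_iff)
        then show ?thesis
          using node_edges_left[OF ei] node_edges_left[OF en] a(6) fv' corner_unique(1)[OF fp]
          by metis
      qed
      then show ?thesis using fv' v' a(3) k by (metis prod_eqI)
    qed simp
  qed
qed

theorem (in category) steps_unique:
  assumes fp: "factorization_preordered C"
    and "(step C ls rs)\<^sup>*\<^sup>* x y" "map fst y = map fst x"
  shows "y = x"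
proof -
  from assms(2) obtain n where "(step C ls rs ^^ n) x y"
    by (auto simp: rtranclp_power)
  then obtain X where X: "X 0 = x" "X n = y" "\<And>m. m < n \<Longrightarrow> step C ls rs (X m) (X (Suc m))"
    by (auto simp: relpowp_fun_conv)
  show ?thesis
  proof (rule nth_equalityI)
    show len: "length y = length x" using assms(3) by (metis length_map)
    fix k assume "k < length y"
    then show "y ! k = x ! k"
      using chain_unique[OF fp, of 0 n ls rs X k] X assms(3) len by (metis le0 nth_map)
  qed
qed

section \<open>Traces of proofs\<close>

text \<open>The connectives of a formula, outermost first.\<close>

fun spine :: "('do, 'ca) form \<Rightarrow> (bool \<times> 'ca) list" where
  "spine (At X) = []"
| "spine (Push f S) = (True, f) # spine S"
| "spine (Pull g S) = (False, g) # spine S"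

text \<open>The arrow of the end sequent of a valid proof term (\<open>proves_arrow\<close>).\<close>

fun arrow :: "('co, 'ca) cat \<Rightarrow> ('da \<Rightarrow> 'ca) \<Rightarrow> ('ca, 'da) proof_term \<Rightarrow> 'ca" where
  "arrow C pa (Ax \<delta>) = pa \<delta>"
| "arrow C pa (LPush f g \<alpha>) = g"
| "arrow C pa (RPush f \<alpha>) = arrow C pa \<alpha> \<cdot>\<^bsub>C\<^esub> f"
| "arrow C pa (LPull g \<alpha>) = g \<cdot>\<^bsub>C\<^esub> arrow C pa \<alpha>"
| "arrow C pa (RPull f g \<alpha>) = f"

text \<open>The decorated path of a proof term, from its root to its axiom. A left rule raises the height of all
  nodes above it by one.\<close>

fun trace :: "('co, 'ca) cat \<Rightarrow> ('da \<Rightarrow> 'ca) \<Rightarrow> ('ca, 'da) proof_term \<Rightarrow> (nat \<times> 'ca) list" where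
  "trace C pa (Ax \<delta>) = [(0, pa \<delta>)]"
| "trace C pa (LPush f g \<alpha>) = (0, g) # map (apfst Suc) (trace C pa \<alpha>)"
| "trace C pa (RPush f \<alpha>) = (0, arrow C pa \<alpha> \<cdot>\<^bsub>C\<^esub> f) # trace C pa \<alpha>"
| "trace C pa (LPull g \<alpha>) = (0, g \<cdot>\<^bsub>C\<^esub> arrow C pa \<alpha>) # map (apfst Suc) (trace C pa \<alpha>)"
| "trace C pa (RPull f g \<alpha>) = (0, f) # trace C pa \<alpha>"

text \<open>The arrow of the axiom of a proof term. Its image in the base is part of the trace, the arrow itself
  is not.\<close>

fun leaf :: "('ca, 'da) proof_term \<Rightarrow> 'da" where
  "leaf (Ax \<delta>) = \<delta>"
| "leaf (LPush f g \<alpha>) = leaf \<alpha>"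
| "leaf (RPush f \<alpha>) = leaf \<alpha>"
| "leaf (LPull g \<alpha>) = leaf \<alpha>"
| "leaf (RPull f g \<alpha>) = leaf \<alpha>"

lemma trace_not_Nil [simp]: "trace C pa \<alpha> \<noteq> []"
  by (cases \<alpha>) auto

lemma trace_nth_0 [simp]: "trace C pa \<alpha> ! 0 = (0, arrow C pa \<alpha>)"
  by (cases \<alpha>) auto

lemma proves_arrow: "proves D C pa \<alpha> S h T \<Longrightarrow> h = arrow C pa \<alpha>"
  by (induction rule: proves.induct) auto

lemma node_edge_Cons_left:
  "node_edge C (c # ls) rs (Suc k) (apfst Suc p) (apfst Suc q) \<longleftrightarrow> node_edge C ls rs k p q"
  by (cases p; cases q) (auto simp: node_edge_def)

lemma node_edge_Cons_right:
  "fst p \<le> k \<Longrightarrow> node_edge C ls (d # rs) (Suc k) p q \<longleftrightarrow> node_edge C ls rs k p q"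
  by (cases p; cases q) (auto simp: node_edge_def Suc_diff_le)

lemma valid_path_Cons_left:
  assumes "fst (x ! 0) = 0" "h \<in> Arr C" "snd (x ! 0) \<in> Arr C"
  shows "valid_path C (c # ls) rs ((0, h) # map (apfst Suc) x) \<longleftrightarrow>
    left_edge C c h (snd (x ! 0)) \<and> valid_path C ls rs x"
proof (cases "length x = Suc (length ls + length rs)")
  case True
  have "(\<forall>k < Suc (length ls + length rs). node_edge C (c # ls) rs k
        (((0, h) # map (apfst Suc) x) ! k) (((0, h) # map (apfst Suc) x) ! Suc k)) \<longleftrightarrow>
      node_edge C (c # ls) rs 0 (0, h) (apfst Suc (x ! 0)) \<and>
      (\<forall>k < length ls + length rs. node_edge C ls rs k (x ! k) (x ! Suc k))"
    using True by (auto simp: All_less_Suc2 node_edge_Cons_left)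
  moreover have "node_edge C (c # ls) rs 0 (0, h) (apfst Suc (x ! 0)) \<longleftrightarrow> left_edge C c h (snd (x ! 0))"
    by (cases "x ! 0") (use assms(1) in \<open>auto simp: node_edge_def\<close>)
  ultimately show ?thesis using True assms by (auto simp: valid_path_def)
qed (auto simp: valid_path_def)

lemma valid_path_Cons_right:
  assumes "fst (x ! 0) = 0" "h \<in> Arr C" "snd (x ! 0) \<in> Arr C"
  shows "valid_path C ls (d # rs) ((0, h) # x) \<longleftrightarrow>
    right_edge C d h (snd (x ! 0)) \<and> valid_path C ls rs x"
proof (cases "length x = Suc (length ls + length rs)")
  case True
  let ?P = "\<lambda>k. node_edge C ls rs k (x ! k) (x ! Suc k)"
  let ?Q = "\<lambda>k. node_edge C ls (d # rs) (Suc k) (x ! k) (x ! Suc k)"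
  \<comment> \<open>by either kind of edge the height of node \<open>k\<close> is at most \<open>k\<close>, so the truncated difference is harmless\<close>
  have inc: "fst (x ! k) \<le> k" if "k < length ls + length rs"
    "\<And>i. i < k \<Longrightarrow> ?P i \<or> ?Q i" for k
    using that
  proof (induction k)
    case (Suc k)
    then have "fst (x ! k) \<le> k" "?P k \<or> ?Q k" by auto
    then show ?case by (auto simp: node_edge_def)
  qed (use assms in simp)
  have PQ: "?P k = ?Q k" if "k < length ls + length rs" "\<And>i. i < k \<Longrightarrow> ?P i \<or> ?Q i" for k
    using inc[OF that] by (simp add: node_edge_Cons_right)
  have eq: "(\<forall>k < length ls + length rs. ?P k) \<longleftrightarrow> (\<forall>k < length ls + length rs. ?Q k)"
  proof (intro iffI allI impI)
    fix k assume "\<forall>k < length ls + length rs. ?P k" "k < length ls + length rs"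
    then show "?Q k" using PQ[of k] by simp
  next
    fix k assume "\<forall>k < length ls + length rs. ?Q k" "k < length ls + length rs"
    then show "?P k" using PQ[of k] by simp
  qed
  have "(\<forall>k < Suc (length ls + length rs). node_edge C ls (d # rs) k
        (((0, h) # x) ! k) (((0, h) # x) ! Suc k)) \<longleftrightarrow>
      node_edge C ls (d # rs) 0 (0, h) (x ! 0) \<and> (\<forall>k < length ls + length rs. ?P k)"
    unfolding eq by (auto simp: All_less_Suc2)
  moreover have "node_edge C ls (d # rs) 0 (0, h) (x ! 0) \<longleftrightarrow> right_edge C d h (snd (x ! 0))"
    by (cases "x ! 0") (use assms(1) in \<open>auto simp: node_edge_def\<close>)
  ultimately show ?thesis using True assms by (auto simp: valid_path_def)
qed (auto simp: valid_path_def)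

text \<open>Conversely, a valid path with at least two nodes begins with a left edge or with a right edge.\<close>

lemma (in category) valid_path_split:
  assumes "valid_path C ls rs ((0, h) # x)" "x \<noteq> []"
  obtains (left) c ls' x' where "ls = c # ls'" "x = map (apfst Suc) x'" "fst (x' ! 0) = 0"
      "left_edge C c h (snd (x' ! 0))" "valid_path C ls' rs x'"
    | (right) d rs' where "rs = d # rs'" "fst (x ! 0) = 0" "right_edge C d h (snd (x ! 0))"
      "valid_path C ls rs' x"
proof -
  have h: "h \<in> Arr C" using assms(1) by (simp add: valid_path_def)
  have e: "node_edge C ls rs 0 (0, h) (x ! 0)"
    using valid_path_edge[OF assms(1), of 0] assms(2) by simp
  show ?thesis
  proof (cases "fst (x ! 0) = 0")
    case True
    with e obtain d rs' where r: "rs = d # rs'" "right_edge C d h (snd (x ! 0))"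
      by (cases rs) (auto simp: node_edge_def)
    then have "valid_path C ls rs' x"
      using assms(1) valid_path_Cons_right[OF True h, of ls d rs'] edge_arr(2)[OF r(2)] by simp
    then show ?thesis using r True that(2) by blast
  next
    case False
    with e obtain c ls' where l: "ls = c # ls'" "left_edge C c h (snd (x ! 0))" "fst (x ! 0) = Suc 0"
      by (cases ls) (auto simp: node_edge_def)
    have pos: "0 < fst (x ! k)" if "k < length x" for k
      using that
    proof (induction k)
      case (Suc k)
      then show ?case
        using valid_path_edge[OF assms(1), of "Suc k"] by (auto simp: node_edge_def)
    qed (use l in simp)
    define x' where "x' = map (apfst (\<lambda>n. n - 1)) x"
    have x: "x = map (apfst Suc) x'"
    proof (rule nth_equalityI)
      fix i assume "i < length x"
      then show "x ! i = map (apfst Suc) x' ! i"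
        using pos[of i] by (cases "x ! i") (simp add: x'_def)
    qed (simp add: x'_def)
    have z: "fst (x' ! 0) = 0" "snd (x' ! 0) = snd (x ! 0)"
      using l assms(2) by (auto simp: x'_def)
    then have "valid_path C ls' rs x'"
      using assms(1) valid_path_Cons_left[OF z(1) h, of c ls' rs] edge_arr(1)[OF l(2)] l x by simp
    then show ?thesis using l x z that(1) by metis
  qed
qed

lemma swap_Cons:
  assumes "swap x y" shows "swap (p # x) (p # y)"
proof -
  from assms obtain k where k: "length x = length y" "Suc k < length x" "fst (x ! k) \<noteq> fst (y ! k)"
    "x[k := y ! k] = y"
    unfolding swap_def by metis
  then show ?thesis unfolding swap_def by (auto intro!: exI[of _ "Suc k"])
qed

lemma swap_ConsD:
  assumes "swap (p # x) (q # y)"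
  shows "p = q" "fst (x ! 0) = fst (y ! 0) \<Longrightarrow> swap x y"
    "fst (x ! 0) \<noteq> fst (y ! 0) \<Longrightarrow> length x = length y \<and> tl x = tl y"
proof -
  from assms obtain k where k: "length (p # x) = length (q # y)" "0 < k" "Suc k < length (p # x)"
    "fst ((p # x) ! k) \<noteq> fst ((q # y) ! k)" "(p # x)[k := (q # y) ! k] = q # y"
    unfolding swap_def by metis
  then obtain j where j: "k = Suc j" by (cases k) auto
  from k j show "p = q" by simp
  have xy: "x[j := y ! j] = y" "fst (x ! j) \<noteq> fst (y ! j)" "Suc j < length x" using k j by auto
  show "swap x y" if "fst (x ! 0) = fst (y ! 0)"
    unfolding swap_def using xy k(1) that
    by (metis length_Cons nat.inject neq0_conv)
  show "length x = length y \<and> tl x = tl y" if "fst (x ! 0) \<noteq> fst (y ! 0)"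
  proof -
    have "j = 0" using xy that by (metis nth_list_update_neq)
    then show ?thesis using xy k(1) by (cases x; cases y) auto
  qed
qed

lemma swap_map:
  "swap (map (apfst Suc) x) (map (apfst Suc) y) \<longleftrightarrow> swap x y"
proof -
  have inj: "inj (apfst Suc :: nat \<times> 'a \<Rightarrow> nat \<times> 'a)"
    by (auto intro!: injI)
  have *: "map (apfst Suc) y = (map (apfst Suc) x)[k := map (apfst Suc) y ! k] \<longleftrightarrow> y = x[k := y ! k]"
    if "length x = length y" "k < length x" for k
    using that inj by (simp flip: map_update add: inj_map_eq_map)
  show ?thesis
    unfolding swap_def using * by (auto simp: nth_map)
qed

context cat_functor
begin

abbreviation "tr \<equiv> trace C pa"
abbreviation "ar \<equiv> arrow C pa"

lemma proves_arr: "proves D C pa \<alpha> S h T \<Longrightarrow> h \<in> Arr C"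
proof (induction rule: proves.induct)
  case (Ax \<delta> X Y)
  then show ?case using pa_hom[OF Ax] by (simp add: Hom_def)
next
  case (RPush \<alpha> S' f' S E A f B)
  then show ?case using C.comp_hom[OF RPush.hyps(2,3)] by (simp add: Hom_def)
next
  case (LPull \<alpha> T g' T' g B E F)
  then show ?case using C.comp_hom[OF LPull.hyps(2,3)] by (simp add: Hom_def)
qed (auto simp: Hom_def)

lemma proves_valid:
  "proves D C pa \<alpha> S h T \<Longrightarrow> valid_path C (spine S) (spine T) (tr \<alpha>)"
proof (induction rule: proves.induct)
  case (Ax \<delta> X Y)
  then show ?case using pa_hom[OF Ax] by (simp add: valid_path_def Hom_def)
next
  case (LPush \<alpha> S f g T A B E)
  then show ?case
    using proves_arrow[OF LPush.hyps(1)] proves_arr[OF LPush.hyps(1)]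
    by (auto simp: valid_path_Cons_left left_edge_def composable_def Hom_def)
next
  case (RPush \<alpha> S' f' S E A f B)
  then show ?case
    using proves_arrow[OF RPush.hyps(1)] proves_arr[OF RPush.hyps(1)]
      proves_arr[OF proves.RPush[OF RPush.hyps(1-3)]]
    by (auto simp: valid_path_Cons_right right_edge_def composable_def Hom_def)
next
  case (LPull \<alpha> T g' T' g B E F)
  then show ?case
    using proves_arrow[OF LPull.hyps(1)] proves_arr[OF LPull.hyps(1)]
      proves_arr[OF proves.LPull[OF LPull.hyps(1-3)]]
    by (auto simp: valid_path_Cons_left left_edge_def composable_def Hom_def)
next
  case (RPull \<alpha> S f g T A B E)
  then show ?case
    using proves_arrow[OF RPull.hyps(1)] proves_arr[OF RPull.hyps(1)]
    by (auto simp: valid_path_Cons_right right_edge_def composable_def Hom_def)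
qed

lemma step_head: "step C ls rs x y \<Longrightarrow> fst (x ! 0) = 0 \<and> y ! 0 = x ! 0"
  unfolding step_def swap_def valid_path_def by (metis nth_list_update_neq less_irrefl)


lemma step_Cons_left:
  assumes "step C ls rs x y" "left_edge C c h (snd (x ! 0))"
  shows "step C (c # ls) rs ((0, h) # map (apfst Suc) x) ((0, h) # map (apfst Suc) y)"
proof -
  note h = step_head[OF assms(1)]
  have arr: "h \<in> Arr C" "snd (x ! 0) \<in> Arr C" using C.edge_arr(1)[OF assms(2)] by auto
  show ?thesis
    using assms h arr
    by (auto simp: step_def valid_path_Cons_left swap_map intro!: swap_Cons)
qed

lemma step_Cons_right:
  assumes "step C ls rs x y" "right_edge C d h (snd (x ! 0))"
  shows "step C ls (d # rs) ((0, h) # x) ((0, h) # y)"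
proof -
  note h = step_head[OF assms(1)]
  have arr: "h \<in> Arr C" "snd (x ! 0) \<in> Arr C" using C.edge_arr(2)[OF assms(2)] by auto
  show ?thesis
    using assms h arr
    by (auto simp: step_def valid_path_Cons_right intro!: swap_Cons)
qed

lemma steps_Cons_left:
  assumes "(step C ls rs)\<^sup>*\<^sup>* x y" "left_edge C c h (snd (x ! 0))"
  shows "(step C (c # ls) rs)\<^sup>*\<^sup>* ((0, h) # map (apfst Suc) x) ((0, h) # map (apfst Suc) y)"
  using assms
proof (induction rule: converse_rtranclp_induct)
  case (step x z)
  then show ?case
    using step_Cons_left[OF step.hyps(1) step.prems] step_head[OF step.hyps(1)]
    by (simp add: converse_rtranclp_into_rtranclp)
qed simp

lemma steps_Cons_right:
  assumes "(step C ls rs)\<^sup>*\<^sup>* x y" "right_edge C d h (snd (x ! 0))"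
  shows "(step C ls (d # rs))\<^sup>*\<^sup>* ((0, h) # x) ((0, h) # y)"
  using assms
proof (induction rule: converse_rtranclp_induct)
  case (step x z)
  then show ?case
    using step_Cons_right[OF step.hyps(1) step.prems] step_head[OF step.hyps(1)]
    by (simp add: converse_rtranclp_into_rtranclp)
qed simp

lemma perm_arrow: "perm D C pa S k T \<alpha> \<beta> \<Longrightarrow> ar \<alpha> = k \<and> ar \<beta> = k"
  using perm_proves proves_arrow by metis

lemma valid_first_left:
  "valid_path C ls rs ((0, h) # map (apfst Suc) x) \<Longrightarrow> x \<noteq> [] \<Longrightarrow> fst (x ! 0) = 0 \<Longrightarrow>
    ls \<noteq> [] \<and> left_edge C (hd ls) h (snd (x ! 0))"
  using valid_path_edge[of C ls rs "(0, h) # map (apfst Suc) x" 0]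
  by (cases ls) (auto simp: node_edge_def)

lemma valid_first_right:
  "valid_path C ls rs ((0, h) # x) \<Longrightarrow> x \<noteq> [] \<Longrightarrow> fst (x ! 0) = 0 \<Longrightarrow>
    rs \<noteq> [] \<and> right_edge C (hd rs) h (snd (x ! 0))"
  using valid_path_edge[of C ls rs "(0, h) # x" 0]
  by (cases rs) (auto simp: node_edge_def)

lemma generator_steps:
  assumes "proves D C pa \<alpha> S k T" "proves D C pa \<beta> S k T" "swap (tr \<alpha>) (tr \<beta>)"
  shows "(step C (spine S) (spine T))\<^sup>*\<^sup>* (tr \<alpha>) (tr \<beta>)"
  using assms proves_valid by (intro r_into_rtranclp) (auto simp: step_def)

text \<open>The congruence rules prolong all paths at their start; each of the four generators moves the second
  node of the trace.\<close>

theorem perm_steps: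
  "perm D C pa S k T \<alpha> \<beta> \<Longrightarrow>
    (step C (spine S) (spine T))\<^sup>*\<^sup>* (tr \<alpha>) (tr \<beta>) \<and> leaf \<alpha> = leaf \<beta>"
proof (induction rule: perm.induct)
  case (sym S k T \<alpha> \<beta>)
  then show ?case using steps_sym by auto
next
  case (trans S k T \<alpha> \<beta> \<gamma>)
  then show ?case by (auto intro: rtranclp_trans)
next
  case (LPush S f g T \<alpha> \<beta> A B E)
  have pr: "proves D C pa (LPush f g \<alpha>) (Push f S) g T"
    using perm_proves[OF LPush.hyps(1)] LPush.hyps(2,3) by (auto intro: proves.LPush)
  have "left_edge C (True, f) g (snd (tr \<alpha> ! 0))"
    using valid_first_left[OF proves_valid[OF pr, simplified]] by simp
  then show ?case using LPush.IH steps_Cons_left by simp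
next
  case (RPush S' f' S \<alpha> \<beta> E A f B)
  have pr: "proves D C pa (RPush f \<alpha>) S' (f' \<cdot>\<^bsub>C\<^esub> f) (Push f S)"
    using perm_proves[OF RPush.hyps(1)] RPush.hyps(2,3) by (auto intro: proves.RPush)
  have "right_edge C (True, f) (f' \<cdot>\<^bsub>C\<^esub> f) (snd (tr \<alpha> ! 0))"
    using valid_first_right[OF proves_valid[OF pr, simplified]] perm_arrow[OF RPush.hyps(1)] by simp
  then show ?case
    using RPush.IH steps_Cons_right perm_arrow[OF RPush.hyps(1)] by simp
next
  case (LPull T g' T' \<alpha> \<beta> g B E F)
  have pr: "proves D C pa (LPull g \<alpha>) (Pull g T) (g \<cdot>\<^bsub>C\<^esub> g') T'"
    using perm_proves[OF LPull.hyps(1)] LPull.hyps(2,3) by (auto intro: proves.LPull)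
  have "left_edge C (False, g) (g \<cdot>\<^bsub>C\<^esub> g') (snd (tr \<alpha> ! 0))"
    using valid_first_left[OF proves_valid[OF pr, simplified]] perm_arrow[OF LPull.hyps(1)] by simp
  then show ?case
    using LPull.IH steps_Cons_left perm_arrow[OF LPull.hyps(1)] by simp
next
  case (RPull S f g T \<alpha> \<beta> A B E)
  have pr: "proves D C pa (RPull f g \<alpha>) S f (Pull g T)"
    using perm_proves[OF RPull.hyps(1)] RPull.hyps(2,3) by (auto intro: proves.RPull)
  have "right_edge C (False, g) f (snd (tr \<alpha> ! 0))"
    using valid_first_right[OF proves_valid[OF pr, simplified]] by simp
  then show ?case using RPull.IH steps_Cons_right by simp
next
  case (RPush_LPull h f \<alpha> S k T)
  then have "ar (RPush h (LPull f \<alpha>)) = ar (LPull f (RPush h \<alpha>))"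
    using proves_arrow by metis
  then have "swap (tr (RPush h (LPull f \<alpha>))) (tr (LPull f (RPush h \<alpha>)))"
    by (auto simp: swap_def intro!: exI[of _ 1])
  then show ?case using generator_steps[OF RPush_LPull] by simp
next
  case (RPush_LPush h f g \<alpha> S k T)
  then have "swap (tr (RPush h (LPush f g \<alpha>))) (tr (LPush f (g \<cdot>\<^bsub>C\<^esub> h) (RPush h \<alpha>)))"
    by (auto simp: swap_def intro!: exI[of _ 1])
  then show ?case using generator_steps[OF RPush_LPush] by simp
next
  case (RPull_LPull f g h \<alpha> S k T)
  then have "ar (RPull (f \<cdot>\<^bsub>C\<^esub> g) h (LPull f \<alpha>)) = ar (LPull f (RPull g h \<alpha>))"
    using proves_arrow by metis
  then have "swap (tr (RPull (f \<cdot>\<^bsub>C\<^esub> g) h (LPull f \<alpha>))) (tr (LPull f (RPull g h \<alpha>)))"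
    by (auto simp: swap_def intro!: exI[of _ 1])
  then show ?case using generator_steps[OF RPull_LPull] by simp
next
  case (RPull_LPush g h f \<alpha> S k T)
  then have "swap (tr (RPull g h (LPush f (g \<cdot>\<^bsub>C\<^esub> h) \<alpha>))) (tr (LPush f g (RPull (f \<cdot>\<^bsub>C\<^esub> g) h \<alpha>)))"
    by (auto simp: swap_def intro!: exI[of _ 1])
  then show ?case using generator_steps[OF RPull_LPush] by simp
qed simp


lemma map_apfst_Suc_inj [simp]: "map (apfst Suc) x = map (apfst Suc) y \<longleftrightarrow> x = y"
  by (rule inj_map_eq_map) (auto intro!: injI)

lemma trace_neq_map [simp]: "tr \<alpha> \<noteq> map (apfst Suc) x" "map (apfst Suc) x \<noteq> tr \<alpha>"
proof -
  show "tr \<alpha> \<noteq> map (apfst Suc) x"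
  proof
    assume "tr \<alpha> = map (apfst Suc) x"
    then have "x \<noteq> []" "fst (map (apfst Suc) x ! 0) = 0"
      using trace_not_Nil trace_nth_0 by (metis list.simps(8), metis fst_conv)
    then show False by (cases x) auto
  qed
  then show "map (apfst Suc) x \<noteq> tr \<alpha>" by metis
qed

text \<open>The end formulas fix the connectives and the heights fix the order of left and right rules; all
  other subscripts of the rules are arrows of the trace.\<close>

lemma proves_inj:
  assumes "proves D C pa \<alpha> S h T" "proves D C pa \<beta> S h' T" "tr \<alpha> = tr \<beta>" "leaf \<alpha> = leaf \<beta>"
  shows "\<alpha> = \<beta>"
  using assms
proof (induction arbitrary: \<beta> h' rule: proves.induct)
  case (Ax \<delta> X Y)
  from Ax.prems(1) show ?case using Ax.prems(2,3) by cases auto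
next
  case (LPush \<alpha> S f g T A B E)
  from LPush.prems(1) show ?case
  proof cases
    case (LPush \<alpha>' A' B' E')
    then show ?thesis using LPush.IH LPush.prems by auto
  next
    case (RPush \<alpha>' f' S' E' A' f'' B')
    then show ?thesis using LPush.prems(2) by simp
  next
    case (RPull \<alpha>' g' T' A' B' E')
    then show ?thesis using LPush.prems(2) by simp
  qed
next
  case (LPull \<alpha> T g' T' g B E F)
  from LPull.prems(1) show ?case
  proof cases
    case (LPull \<alpha>' g'' B' E' F')
    then show ?thesis using LPull.IH LPull.prems by auto
  next
    case (RPush \<alpha>' f' S' E' A' f'' B')
    then show ?thesis using LPull.prems(2) by simp
  next
    case (RPull \<alpha>' g' T' A' B' E')
    then show ?thesis using LPull.prems(2) by simp
  qed
next
  case (RPush \<alpha> S' f' S E A f B)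
  from RPush.prems(1) show ?case
  proof cases
    case (RPush \<alpha>' f'' E' A' B')
    then show ?thesis using RPush.IH RPush.prems by auto
  next
    case (LPush \<alpha>' S1 f1 A' B' E')
    then show ?thesis using RPush.prems(2) by simp
  next
    case (LPull \<alpha>' T1 g1 g' B' E' F')
    then show ?thesis using RPush.prems(2) by simp
  qed
next
  case (RPull \<alpha> S f g T A B E)
  from RPull.prems(1) show ?case
  proof cases
    case (RPull \<alpha>' A' B' E')
    then show ?thesis using RPull.IH RPull.prems by auto
  next
    case (LPush \<alpha>' S1 f1 A' B' E')
    then show ?thesis using RPull.prems(2) by simp
  next
    case (LPull \<alpha>' T1 g1 g' B' E' F')
    then show ?thesis using RPull.prems(2) by simp
  qed
qed

lemma composable_proves:
  "proves D C pa \<alpha> S h T \<Longrightarrow> composable C f g \<Longrightarrow> h = f \<cdot>\<^bsub>C\<^esub> g \<Longrightarrow>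
    proves D C pa (LPush f g \<alpha>) (Push f S) g T"
  "proves D C pa \<alpha> S h T \<Longrightarrow> composable C h f \<Longrightarrow> k = h \<cdot>\<^bsub>C\<^esub> f \<Longrightarrow>
    proves D C pa (RPush f \<alpha>) S k (Push f T)"
  "proves D C pa \<alpha> S h T \<Longrightarrow> composable C g h \<Longrightarrow> k = g \<cdot>\<^bsub>C\<^esub> h \<Longrightarrow>
    proves D C pa (LPull g \<alpha>) (Pull g S) k T"
  "proves D C pa \<alpha> S h T \<Longrightarrow> composable C f g \<Longrightarrow> h = f \<cdot>\<^bsub>C\<^esub> g \<Longrightarrow>
    proves D C pa (RPull f g \<alpha>) S f (Pull g T)"
  unfolding C.composable_iff by (auto intro: proves.intros)

lemma perm_composable:
  "perm D C pa S h T \<alpha> \<beta> \<Longrightarrow> composable C f g \<Longrightarrow> h = f \<cdot>\<^bsub>C\<^esub> g \<Longrightarrow>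
    perm D C pa (Push f S) g T (LPush f g \<alpha>) (LPush f g \<beta>)"
  "perm D C pa S h T \<alpha> \<beta> \<Longrightarrow> composable C h f \<Longrightarrow> k = h \<cdot>\<^bsub>C\<^esub> f \<Longrightarrow>
    perm D C pa S k (Push f T) (RPush f \<alpha>) (RPush f \<beta>)"
  "perm D C pa S h T \<alpha> \<beta> \<Longrightarrow> composable C g h \<Longrightarrow> k = g \<cdot>\<^bsub>C\<^esub> h \<Longrightarrow>
    perm D C pa (Pull g S) k T (LPull g \<alpha>) (LPull g \<beta>)"
  "perm D C pa S h T \<alpha> \<beta> \<Longrightarrow> composable C f g \<Longrightarrow> h = f \<cdot>\<^bsub>C\<^esub> g \<Longrightarrow>
    perm D C pa S f (Pull g T) (RPull f g \<alpha>) (RPull f g \<beta>)"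
  unfolding C.composable_iff by (auto intro: perm.intros)

lemma fst_map_Suc_0: "x \<noteq> [] \<Longrightarrow> fst (map (apfst Suc) x ! 0) = Suc (fst (x ! 0))"
  by (cases x) auto

lemma step_ConsE:
  assumes "step C ls rs ((0, h) # x) y" "x \<noteq> []"
  obtains y' where "y = (0, h) # y'" "y' \<noteq> []" "length y' = length x"
    "swap ((0, h) # x) ((0, h) # y')" "valid_path C ls rs ((0, h) # y')" "tl x \<noteq> []"
proof -
  have s: "swap ((0, h) # x) y" "valid_path C ls rs y" using assms by (auto simp: step_def)
  then have "length y = Suc (length x)" "1 < length x"
    by (auto simp: swap_def)
  then have l: "length y = Suc (length x)" "tl x \<noteq> []"
    by (auto simp flip: length_greater_0_conv)
  then obtain p y' where "y = p # y'" by (cases y) auto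
  then show ?thesis using that[of y'] s l assms(2) swap_ConsD(1)[of "(0, h)" x p y']
    by (cases y') auto
qed

text \<open>A step from a trace that starts with a left rule either takes place in the subproof or
  exchanges that rule with the right rule above it, and dually.\<close>

lemma step_left_cases:
  assumes "step C (c # ls) rs ((0, h) # map (apfst Suc) x) y" "x \<noteq> []" "fst (x ! 0) = 0"
  obtains (deep) y' where "y = (0, h) # map (apfst Suc) y'" "valid_path C ls rs y'" "swap x y'"
    | (top) d rs' x' u where "rs = d # rs'" "y = (0, h) # (0, u) # map (apfst Suc) x'" "tl x = x'"
      "x' \<noteq> []" "fst (x' ! 0) = 0" "right_edge C d h u" "left_edge C c u (snd (x' ! 0))"
proof -
  have "map (apfst Suc) x \<noteq> []" using assms(2) by simp
  then obtain y' where y': "y = (0, h) # y'" "y' \<noteq> []" "length y' = length x"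
    "swap ((0, h) # map (apfst Suc) x) ((0, h) # y')" "valid_path C (c # ls) rs ((0, h) # y')"
    "tl x \<noteq> []"
    by (rule step_ConsE[OF assms(1)]) (auto simp flip: map_tl)
  have fx: "fst (map (apfst Suc) x ! 0) = Suc 0" using assms by simp
  from y'(5,2) show ?thesis
  proof (cases rule: C.valid_path_split)
    case (left c' ls' z)
    then have "z \<noteq> []" using y'(2) by auto
    then have "swap (map (apfst Suc) x) (map (apfst Suc) z)"
      using swap_ConsD(2)[OF y'(4)] fx left by simp
    then show ?thesis using that(1)[of z] left y'(1) by (simp add: swap_map)
  next
    case (right d rs')
    have tl: "tl y' = map (apfst Suc) (tl x)"
      using swap_ConsD(3)[OF y'(4)] fx right by (simp add: map_tl)
    obtain u where u: "y' = (0, u) # map (apfst Suc) (tl x)"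
      using y'(2) right(2) tl by (cases y') auto
    have v: "valid_path C (c # ls) rs' ((0, u) # map (apfst Suc) (tl x))" using right(4) u by simp
    have ne: "map (apfst Suc) (tl x) \<noteq> []" using y'(6) by simp
    from v ne show ?thesis
    proof (cases rule: C.valid_path_split)
      case (left c' ls' z)
      then show ?thesis using that(2)[of d rs' u "tl x"] right u y' by simp
    next
      case (right d' rs'')
      then show ?thesis using fst_map_Suc_0[OF y'(6)] by simp
    qed
  qed
qed

lemma step_right_cases:
  assumes "step C ls (d # rs) ((0, h) # x) y" "x \<noteq> []" "fst (x ! 0) = 0"
  obtains (deep) y' where "y = (0, h) # y'" "valid_path C ls rs y'" "swap x y'"
    | (top) c ls' x' u where "ls = c # ls'" "y = (0, h) # (Suc 0, u) # map (apfst Suc) x'"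
      "tl x = map (apfst Suc) x'"
      "x' \<noteq> []" "fst (x' ! 0) = 0" "left_edge C c h u" "right_edge C d u (snd (x' ! 0))"
proof -
  obtain y' where y': "y = (0, h) # y'" "y' \<noteq> []" "length y' = length x"
    "swap ((0, h) # x) ((0, h) # y')" "valid_path C ls (d # rs) ((0, h) # y')"
    "tl x \<noteq> []"
    by (rule step_ConsE[OF assms(1,2)]) auto
  from y'(5,2) show ?thesis
  proof (cases rule: C.valid_path_split)
    case (right d' rs')
    then have "swap x y'"
      using swap_ConsD(2)[OF y'(4)] assms(3) by simp
    then show ?thesis using that(1)[of y'] right y'(1) by simp
  next
    case (left c ls' z)
    then have zne: "z \<noteq> []" using y'(2) by auto
    have tl: "map (apfst Suc) (tl z) = tl x"
      using swap_ConsD(3)[OF y'(4)] assms left zne by (simp add: map_tl)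
    obtain u where u: "z = (0, u) # tl z"
      using left(3) zne by (cases z) auto
    have ne: "tl z \<noteq> []" using y'(6) tl by auto
    have v: "valid_path C ls' (d # rs) ((0, u) # tl z)" using left(5) u by simp
    from v ne show ?thesis
    proof (cases rule: C.valid_path_split)
      case (right d' rs'')
      then show ?thesis using that(2)[of c ls' u "tl z"] left u y' tl ne
        by (metis apfst_conv list.simps(9) nth_Cons_0 snd_conv list.inject)
    next
      case (left c' ls'' w)
      have vx: "valid_path C ls (d # rs) ((0, h) # x)" using assms(1) by (simp add: step_def)
      have "Suc (Suc 0) < length ((0, h) # x)" using y'(6) by (cases x) auto
      from valid_path_edge[OF vx this] have "fst (x ! 1) \<le> 1"
        using assms(3) by (auto simp: node_edge_def)
      moreover have "x ! 1 = tl x ! 0" using y'(6) by (cases x) auto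
      moreover have "fst (tl x ! 0) = Suc (fst (tl z ! 0))" unfolding tl[symmetric] by (rule fst_map_Suc_0[OF ne])
      moreover have "fst (tl z ! 0) = Suc (fst (w ! 0))" using left ne by simp
      ultimately show ?thesis by simp
    qed
  qed
qed


lemma left_edge_simps [simp]:
  "left_edge C (True, f) h h' \<longleftrightarrow> composable C f h \<and> h' = f \<cdot>\<^bsub>C\<^esub> h"
  "left_edge C (False, f) h h' \<longleftrightarrow> composable C f h' \<and> h = f \<cdot>\<^bsub>C\<^esub> h'"
  by (simp_all add: left_edge_def)

lemma right_edge_simps [simp]:
  "right_edge C (True, f) h h' \<longleftrightarrow> composable C h' f \<and> h = h' \<cdot>\<^bsub>C\<^esub> f"
  "right_edge C (False, f) h h' \<longleftrightarrow> composable C h f \<and> h' = h \<cdot>\<^bsub>C\<^esub> f"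
  by (simp_all add: right_edge_def)

text \<open>A step from the trace of a proof can be followed in the calculus. A step at the second node exchanges
  the last two rules of the proof, which are a left and a right rule; each of the eight resulting
  cases is one of the four generators in one of its two directions.\<close>

theorem step_perm:
  assumes "proves D C pa \<alpha> S h T" "step C (spine S) (spine T) (tr \<alpha>) y"
  shows "\<exists>\<beta>. perm D C pa S h T \<alpha> \<beta> \<and> tr \<beta> = y"
  using assms
proof (induction arbitrary: y rule: proves.induct)
  case (Ax \<delta> X Y)
  then show ?case by (simp add: step_def swap_def)
next
  case (LPush \<alpha> S f g T A B E)
  have fg: "composable C f g" using LPush.hyps by (auto simp: C.composable_iff)
  from LPush.prems have "step C ((True, f) # spine S) (spine T) ((0, g) # map (apfst Suc) (tr \<alpha>)) y"
    by simp
  then show ?case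
  proof (rule step_left_cases)
    fix y' assume y': "y = (0, g) # map (apfst Suc) y'" "valid_path C (spine S) (spine T) y'" "swap (tr \<alpha>) y'"
    then obtain \<beta> where "perm D C pa S (f \<cdot>\<^bsub>C\<^esub> g) T \<alpha> \<beta>" "tr \<beta> = y'"
      using LPush.IH[of y'] proves_valid[OF LPush.hyps(1)] by (auto simp: step_def)
    then show ?thesis using perm_composable(1)[OF _ fg HOL.refl] y' by fastforce
  next
    fix d rs' x' u
    assume y: "spine T = d # rs'" "y = (0, g) # (0, u) # map (apfst Suc) x'" "tl (tr \<alpha>) = x'"
      "x' \<noteq> []" "fst (x' ! 0) = 0" "right_edge C d g u" "left_edge C (True, f) u (snd (x' ! 0))"
    from LPush.hyps(1) show ?thesis
    proof cases
      case (RPush \<gamma> m T' E' A' h B')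
      have e: "composable C u h" "g = u \<cdot>\<^bsub>C\<^esub> h" "composable C f u" "m = f \<cdot>\<^bsub>C\<^esub> u"
        using y RPush proves_arrow[OF RPush(4)] by auto
      have p: "proves D C pa (RPush h (LPush f u \<gamma>)) (Push f S) g T"
        unfolding RPush(3) using RPush(4) e
        by (intro composable_proves(2)[OF composable_proves(1)]) auto
      have q: "proves D C pa (LPush f g (RPush h \<gamma>)) (Push f S) g T"
        using proves.LPush[OF LPush.hyps(1-3)] RPush by simp
      have pq: "perm D C pa (Push f S) g T (RPush h (LPush f u \<gamma>)) (LPush f g (RPush h \<gamma>))"
        using perm.RPush_LPush[of D C pa h f u \<gamma> "Push f S" g T] p q e(2) by simp
      have "tr (RPush h (LPush f u \<gamma>)) = y" using y RPush e by simp
      then show ?thesis using RPush(1) perm.sym[OF pq] by auto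
    next
      case (RPull \<gamma> h T' A' B' E')
      have e: "composable C g h" "u = g \<cdot>\<^bsub>C\<^esub> h" "composable C f u" "ar \<gamma> = f \<cdot>\<^bsub>C\<^esub> u"
        using y RPull by auto
      have p: "proves D C pa (RPull g h (LPush f (g \<cdot>\<^bsub>C\<^esub> h) \<gamma>)) (Push f S) g T"
        unfolding RPull(2) using RPull(3) e proves_arrow[OF RPull(3)]
        by (intro composable_proves(4)[OF composable_proves(1)]) auto
      have q: "proves D C pa (LPush f g (RPull (f \<cdot>\<^bsub>C\<^esub> g) h \<gamma>)) (Push f S) g T"
        using proves.LPush[OF LPush.hyps(1-3)] RPull by simp
      have "tr (RPull g h (LPush f (g \<cdot>\<^bsub>C\<^esub> h) \<gamma>)) = y" using y RPull e by simp
      then show ?thesis using RPull perm.sym[OF perm.RPull_LPush[OF p q]] by auto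
    next
      case Ax then show ?thesis using y by auto
    next
      case LPush then show ?thesis using y fst_map_Suc_0 by (metis trace_not_Nil list.sel(3) nat.distinct(1) trace.simps(2))
    next
      case LPull then show ?thesis using y fst_map_Suc_0 by (metis trace_not_Nil list.sel(3) nat.distinct(1) trace.simps(4))
    qed
  qed auto
next
  case (LPull \<alpha> T g' T' g B E F)
  have gg: "composable C g g'" using LPull.hyps by (auto simp: C.composable_iff)
  let ?k = "g \<cdot>\<^bsub>C\<^esub> g'"
  have ar: "ar \<alpha> = g'" using proves_arrow[OF LPull.hyps(1)] by simp
  from LPull.prems have "step C ((False, g) # spine T) (spine T') ((0, ?k) # map (apfst Suc) (tr \<alpha>)) y"
    using ar by simp
  then show ?case
  proof (rule step_left_cases)
    fix y' assume y': "y = (0, ?k) # map (apfst Suc) y'" "valid_path C (spine T) (spine T') y'" "swap (tr \<alpha>) y'"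
    then obtain \<beta> where b: "perm D C pa T g' T' \<alpha> \<beta>" "tr \<beta> = y'"
      using LPull.IH[of y'] proves_valid[OF LPull.hyps(1)] by (auto simp: step_def)
    then have "tr (LPull g \<beta>) = y" using y' perm_arrow[OF b(1)] by simp
    then show ?thesis using perm_composable(3)[OF b(1) gg HOL.refl] by blast
  next
    fix d rs' x' u
    assume y: "spine T' = d # rs'" "y = (0, ?k) # (0, u) # map (apfst Suc) x'" "tl (tr \<alpha>) = x'"
      "x' \<noteq> []" "fst (x' ! 0) = 0" "right_edge C d ?k u" "left_edge C (False, g) u (snd (x' ! 0))"
    have q: "proves D C pa (LPull g \<alpha>) (Pull g T) ?k T'"
      using proves.LPull[OF LPull.hyps(1-3)] .
    from LPull.hyps(1) show ?thesis
    proof cases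
      case (RPush \<gamma> m S' E' A' h B')
      have e: "composable C u h" "?k = u \<cdot>\<^bsub>C\<^esub> h" "composable C g m" "u = g \<cdot>\<^bsub>C\<^esub> m" "m = ar \<gamma>"
        using y RPush proves_arrow[OF RPush(4)] by auto
      have p: "proves D C pa (RPush h (LPull g \<gamma>)) (Pull g T) ?k T'"
        unfolding RPush(3) using RPush(4) e(1,2,3,4)
        by (intro composable_proves(2)[OF composable_proves(3)]) (auto simp: RPush(2))
      have "tr (RPush h (LPull g \<gamma>)) = y" using y RPush e by simp
      then show ?thesis
        using RPush(1) perm.sym[OF perm.RPush_LPull[OF p q[unfolded RPush(1)]]] by auto
    next
      case (RPull \<gamma> h T1 A' B' E')
      have e: "composable C ?k h" "u = ?k \<cdot>\<^bsub>C\<^esub> h" "composable C g (ar \<gamma>)" "u = g \<cdot>\<^bsub>C\<^esub> ar \<gamma>"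
        using y RPull by auto
      have p: "proves D C pa (RPull ?k h (LPull g \<gamma>)) (Pull g T) ?k T'"
        unfolding RPull(2) using RPull(3) e proves_arrow[OF RPull(3)]
        by (intro composable_proves(4)[OF composable_proves(3)]) auto
      have "tr (RPull ?k h (LPull g \<gamma>)) = y" using y RPull e by simp
      then show ?thesis
        using RPull(1) perm.sym[OF perm.RPull_LPull[OF p q[unfolded RPull(1)]]] by auto
    next
      case Ax then show ?thesis using y by auto
    next
      case LPush then show ?thesis using y fst_map_Suc_0 by (metis trace_not_Nil list.sel(3) nat.distinct(1) trace.simps(2))
    next
      case LPull then show ?thesis using y fst_map_Suc_0 by (metis trace_not_Nil list.sel(3) nat.distinct(1) trace.simps(4))
    qed
  qed auto
next
  case (RPush \<alpha> S' f' S E A f B)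
  have ff: "composable C f' f" using RPush.hyps by (auto simp: C.composable_iff)
  let ?k = "f' \<cdot>\<^bsub>C\<^esub> f"
  have ar: "ar \<alpha> = f'" using proves_arrow[OF RPush.hyps(1)] by simp
  from RPush.prems have "step C (spine S') ((True, f) # spine S) ((0, ?k) # tr \<alpha>) y"
    using ar by simp
  then show ?case
  proof (rule step_right_cases)
    fix y' assume y': "y = (0, ?k) # y'" "valid_path C (spine S') (spine S) y'" "swap (tr \<alpha>) y'"
    then obtain \<beta> where b: "perm D C pa S' f' S \<alpha> \<beta>" "tr \<beta> = y'"
      using RPush.IH[of y'] proves_valid[OF RPush.hyps(1)] by (auto simp: step_def)
    then have "tr (RPush f \<beta>) = y" using y' perm_arrow[OF b(1)] by simp
    then show ?thesis using perm_composable(2)[OF b(1) ff HOL.refl] by blast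
  next
    fix c ls' x' u
    assume y: "spine S' = c # ls'" "y = (0, ?k) # (Suc 0, u) # map (apfst Suc) x'"
      "tl (tr \<alpha>) = map (apfst Suc) x'" "x' \<noteq> []" "fst (x' ! 0) = 0"
      "left_edge C c ?k u" "right_edge C (True, f) u (snd (x' ! 0))"
    have q: "proves D C pa (RPush f \<alpha>) S' ?k (Push f S)"
      using proves.RPush[OF RPush.hyps(1-3)] .
    from RPush.hyps(1) show ?thesis
    proof cases
      case (LPush \<gamma> S1 a A' B' E')
      have e: "composable C a ?k" "u = a \<cdot>\<^bsub>C\<^esub> ?k" "composable C (ar \<gamma>) f" "u = ar \<gamma> \<cdot>\<^bsub>C\<^esub> f"
        using y LPush by auto
      have p: "proves D C pa (LPush a ?k (RPush f \<gamma>)) S' ?k (Push f S)"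
        unfolding LPush(2) using LPush(3) e proves_arrow[OF LPush(3)]
        by (intro composable_proves(1)[OF composable_proves(2)]) auto
      have "tr (LPush a ?k (RPush f \<gamma>)) = y" using y LPush e by simp
      then show ?thesis
        using LPush(1) perm.RPush_LPush[OF q[unfolded LPush(1)] p] by auto
    next
      case (LPull \<gamma> T1 m a B' E' F')
      have e: "composable C a u" "?k = a \<cdot>\<^bsub>C\<^esub> u" "composable C m f" "u = m \<cdot>\<^bsub>C\<^esub> f" "m = ar \<gamma>"
        using y LPull proves_arrow[OF LPull(4)] by auto
      have p: "proves D C pa (LPull a (RPush f \<gamma>)) S' ?k (Push f S)"
        unfolding LPull(2) using LPull(4) e(1-4)
        by (intro composable_proves(3)[OF composable_proves(2)]) auto
      have "tr (LPull a (RPush f \<gamma>)) = y" using y LPull e by simp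
      then show ?thesis
        using LPull(1) perm.RPush_LPull[OF q[unfolded LPull(1)] p] by auto
    next
      case Ax then show ?thesis using y by auto
    next
      case RPush then show ?thesis using y by auto
    next
      case RPull then show ?thesis using y by auto
    qed
  qed auto
next
  case (RPull \<alpha> S f g T A B E)
  have fg: "composable C f g" using RPull.hyps by (auto simp: C.composable_iff)
  from RPull.prems have "step C (spine S) ((False, g) # spine T) ((0, f) # tr \<alpha>) y"
    by simp
  then show ?case
  proof (rule step_right_cases)
    fix y' assume y': "y = (0, f) # y'" "valid_path C (spine S) (spine T) y'" "swap (tr \<alpha>) y'"
    then obtain \<beta> where b: "perm D C pa S (f \<cdot>\<^bsub>C\<^esub> g) T \<alpha> \<beta>" "tr \<beta> = y'"
      using RPull.IH[of y'] proves_valid[OF RPull.hyps(1)] by (auto simp: step_def)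
    then have "tr (RPull f g \<beta>) = y" using y' by simp
    then show ?thesis using perm_composable(4)[OF b(1) fg HOL.refl] by blast
  next
    fix c ls' x' u
    assume y: "spine S = c # ls'" "y = (0, f) # (Suc 0, u) # map (apfst Suc) x'"
      "tl (tr \<alpha>) = map (apfst Suc) x'" "x' \<noteq> []" "fst (x' ! 0) = 0"
      "left_edge C c f u" "right_edge C (False, g) u (snd (x' ! 0))"
    have q: "proves D C pa (RPull f g \<alpha>) S f (Pull g T)"
      using proves.RPull[OF RPull.hyps(1-3)] .
    from RPull.hyps(1) show ?thesis
    proof cases
      case (LPush \<gamma> S1 a A' B' E')
      have e: "composable C a f" "u = a \<cdot>\<^bsub>C\<^esub> f" "composable C u g" "ar \<gamma> = u \<cdot>\<^bsub>C\<^esub> g"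
        using y LPush by auto
      have p: "proves D C pa (LPush a f (RPull (a \<cdot>\<^bsub>C\<^esub> f) g \<gamma>)) S f (Pull g T)"
        unfolding LPush(2) using LPush(3) e proves_arrow[OF LPush(3)]
        by (intro composable_proves(1)[OF composable_proves(4)]) auto
      have "tr (LPush a f (RPull (a \<cdot>\<^bsub>C\<^esub> f) g \<gamma>)) = y" using y LPush e by simp
      then show ?thesis
        using LPush(1) perm.RPull_LPush[OF q[unfolded LPush(1)] p] by auto
    next
      case (LPull \<gamma> T1 m a B' E' F')
      have e: "composable C a u" "f = a \<cdot>\<^bsub>C\<^esub> u" "composable C u g" "m = u \<cdot>\<^bsub>C\<^esub> g" "m = ar \<gamma>"
        using y LPull proves_arrow[OF LPull(4)] by auto
      have p: "proves D C pa (LPull a (RPull u g \<gamma>)) S f (Pull g T)"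
        unfolding LPull(2) using LPull(4) e(1-4)
        by (intro composable_proves(3)[OF composable_proves(4)]) auto
      have "tr (LPull a (RPull u g \<gamma>)) = y" using y LPull e by simp
      then show ?thesis
        using LPull(1) perm.RPull_LPull[of D C pa a u g \<gamma> S f "Pull g T"] q p e(2) by auto
    next
      case Ax then show ?thesis using y by auto
    next
      case RPush then show ?thesis using y by auto
    next
      case RPull then show ?thesis using y by auto
    qed
  qed auto
qed

theorem perm_iff_steps:
  assumes "proves D C pa \<alpha> S h T" "proves D C pa \<beta> S h T"
  shows "perm D C pa S h T \<alpha> \<beta> \<longleftrightarrow>
    (step C (spine S) (spine T))\<^sup>*\<^sup>* (tr \<alpha>) (tr \<beta>) \<and> leaf \<alpha> = leaf \<beta>"
proof (intro iffI)
  assume st: "(step C (spine S) (spine T))\<^sup>*\<^sup>* (tr \<alpha>) (tr \<beta>) \<and> leaf \<alpha> = leaf \<beta>"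
  have "\<exists>\<gamma>. perm D C pa S h T \<alpha> \<gamma> \<and> tr \<gamma> = y"
    if "(step C (spine S) (spine T))\<^sup>*\<^sup>* (tr \<alpha>) y" for y
    using that
  proof (induction rule: rtranclp_induct)
    case base
    then show ?case using perm.refl[OF assms(1)] by blast
  next
    case (step y z)
    then obtain \<gamma> where g: "perm D C pa S h T \<alpha> \<gamma>" "tr \<gamma> = y" by blast
    then obtain \<gamma>' where g': "perm D C pa S h T \<gamma> \<gamma>'" "tr \<gamma>' = z"
      using step_perm[of \<gamma> S h T z] step.hyps(2) perm_proves[OF g(1)] by auto
    show ?case using perm.trans[OF g(1) g'(1)] g'(2) by blast
  qed
  then obtain \<gamma> where g: "perm D C pa S h T \<alpha> \<gamma>" "tr \<gamma> = tr \<beta>" using st by blast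
  then have "leaf \<gamma> = leaf \<beta>" using perm_steps[OF g(1)] st by simp
  then have "\<gamma> = \<beta>" using proves_inj g perm_proves[OF g(1)] assms(2) by blast
  then show "perm D C pa S h T \<alpha> \<beta>" using g by simp
qed (rule perm_steps)

end

section \<open>Recursion on the codes of proofs\<close>

lemma recursive_call2:
  "recursive (\<lambda>z. F (pfst z) (psnd z)) \<Longrightarrow> recursive a \<Longrightarrow> recursive b \<Longrightarrow>
    recursive (\<lambda>n. F (a n) (b n))"
  using recursive.comp[of "\<lambda>z. F (pfst z) (psnd z)" "\<lambda>n. prod_encode (a n, b n)"]
  by (simp add: recursive.pair)

text \<open>The tag of the last rule of a coded proof, and the code of its immediate subproof.\<close>

definition ctag :: "nat \<Rightarrow> nat" where "ctag c = cnth c 0"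

definition csub :: "nat \<Rightarrow> nat" where
  "csub c = (if ctag c = 1 \<or> ctag c = 4 then cnth c 3 else cnth c 2)"

text \<open>Structural recursion over a coded proof with base function \<open>b\<close> and step function \<open>g\<close>, which also
  receives the code of the current subproof. The recursion follows at most \<open>m\<close> subproofs, so that it is
  primitive recursive on arbitrary numbers. The code itself is enough fuel
  for the proof that it codes (\<open>depth_le_name\<close>).\<close>

definition fuel_fold :: "(nat \<Rightarrow> nat) \<Rightarrow> (nat \<Rightarrow> nat \<Rightarrow> nat) \<Rightarrow> nat \<Rightarrow> nat \<Rightarrow> nat" where
  "fuel_fold b g m c = rec_nat (b ((csub ^^ m) c))
    (\<lambda>i r. if ctag ((csub ^^ (m - Suc i)) c) = 0 then b ((csub ^^ (m - Suc i)) c)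
       else g ((csub ^^ (m - Suc i)) c) r) m"

definition cfold :: "(nat \<Rightarrow> nat) \<Rightarrow> (nat \<Rightarrow> nat \<Rightarrow> nat) \<Rightarrow> nat \<Rightarrow> nat" where
  "cfold b g c = fuel_fold b g c c"

lemma recursive_ctag [rec_intros]: "recursive f \<Longrightarrow> recursive (\<lambda>n. ctag (f n))"
  unfolding ctag_def by (intro rec_intros)

lemma recursive_csub [rec_intros]: "recursive f \<Longrightarrow> recursive (\<lambda>n. csub (f n))"
  unfolding csub_def by (intro rec_intros)

lemma recursive_cfold [rec_intros]:
  assumes b: "recursive b" and g: "recursive (\<lambda>z. g (pfst z) (psnd z))" and m: "recursive m"
  shows "recursive (\<lambda>n. cfold b g (m n))"
proof -
  have "recursive (\<lambda>n. cfold b g n)"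
    unfolding cfold_def fuel_fold_def
    by (intro rec_intros recursive.comp[OF b] recursive_call2[OF g])
  from recursive.comp[OF this m] show ?thesis .
qed

lemma rec_nat_cong: "(\<And>i. i < n \<Longrightarrow> F i = G i) \<Longrightarrow> rec_nat z F n = rec_nat z G n"
  by (induction n) auto

lemma fuel_fold_0: "fuel_fold b g 0 c = b c"
  by (simp add: fuel_fold_def)

lemma fuel_fold_Suc:
  "fuel_fold b g (Suc m) c = (if ctag c = 0 then b c else g c (fuel_fold b g m (csub c)))"
proof -
  have "rec_nat (b ((csub ^^ m) (csub c)))
      (\<lambda>i r. if ctag ((csub ^^ (Suc m - Suc i)) c) = 0 then b ((csub ^^ (Suc m - Suc i)) c)
       else g ((csub ^^ (Suc m - Suc i)) c) r) m = fuel_fold b g m (csub c)"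
    unfolding fuel_fold_def
  proof (rule rec_nat_cong)
    fix i assume "i < m"
    then have "(csub ^^ (Suc m - Suc i)) c = (csub ^^ (m - Suc i)) (csub c)"
      by (metis Suc_diff_Suc diff_Suc_Suc funpow_simps_right(2) o_apply)
    then show "(\<lambda>r. if ctag ((csub ^^ (Suc m - Suc i)) c) = 0 then b ((csub ^^ (Suc m - Suc i)) c)
       else g ((csub ^^ (Suc m - Suc i)) c) r) =
       (\<lambda>r. if ctag ((csub ^^ (m - Suc i)) (csub c)) = 0 then b ((csub ^^ (m - Suc i)) (csub c))
       else g ((csub ^^ (m - Suc i)) (csub c)) r)" by (simp only:)
  qed
  then show ?thesis
    by (subst fuel_fold_def) (simp add: funpow_Suc_right del: funpow.simps)
qed

lemma proof_name_simps:
  "proof_name \<nu> \<mu> c (Ax \<delta>) \<longleftrightarrow> (\<exists>d. c = list_encode [0, d] \<and> \<mu> d = Some \<delta>)"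
  "proof_name \<nu> \<mu> c (LPush f g \<alpha>) \<longleftrightarrow> (\<exists>f' g' a. c = list_encode [1, f', g', a] \<and>
     \<nu> f' = Some f \<and> \<nu> g' = Some g \<and> proof_name \<nu> \<mu> a \<alpha>)"
  "proof_name \<nu> \<mu> c (RPush f \<alpha>) \<longleftrightarrow> (\<exists>f' a. c = list_encode [2, f', a] \<and>
     \<nu> f' = Some f \<and> proof_name \<nu> \<mu> a \<alpha>)"
  "proof_name \<nu> \<mu> c (LPull f \<alpha>) \<longleftrightarrow> (\<exists>f' a. c = list_encode [3, f', a] \<and>
     \<nu> f' = Some f \<and> proof_name \<nu> \<mu> a \<alpha>)"
  "proof_name \<nu> \<mu> c (RPull f g \<alpha>) \<longleftrightarrow> (\<exists>f' g' a. c = list_encode [4, f', g', a] \<and>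
     \<nu> f' = Some f \<and> \<nu> g' = Some g \<and> proof_name \<nu> \<mu> a \<alpha>)"
proof -
  let ?R = "rel_proof_term (\<lambda>i f. \<nu> i = Some f) (\<lambda>i \<delta>. \<mu> i = Some \<delta>)"
  have inv:
    "?R P (Ax \<delta>) \<longleftrightarrow> (\<exists>d. P = Ax d \<and> \<mu> d = Some \<delta>)"
    "?R P (LPush f g \<alpha>) \<longleftrightarrow> (\<exists>f' g' Q. P = LPush f' g' Q \<and> \<nu> f' = Some f \<and> \<nu> g' = Some g \<and> ?R Q \<alpha>)"
    "?R P (RPush f \<alpha>) \<longleftrightarrow> (\<exists>f' Q. P = RPush f' Q \<and> \<nu> f' = Some f \<and> ?R Q \<alpha>)"
    "?R P (LPull f \<alpha>) \<longleftrightarrow> (\<exists>f' Q. P = LPull f' Q \<and> \<nu> f' = Some f \<and> ?R Q \<alpha>)"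
    "?R P (RPull f g \<alpha>) \<longleftrightarrow> (\<exists>f' g' Q. P = RPull f' g' Q \<and> \<nu> f' = Some f \<and> \<nu> g' = Some g \<and> ?R Q \<alpha>)"
    for P by (cases P; simp)+
  have "proof_name \<nu> \<mu> c (Ax \<delta>) \<longleftrightarrow>
      (\<exists>d. c = proof_code (Ax d) \<and> \<mu> d = Some \<delta>)"
    unfolding proof_name_def inv by blast
  then show "proof_name \<nu> \<mu> c (Ax \<delta>) \<longleftrightarrow>
      (\<exists>d. c = list_encode [0, d] \<and> \<mu> d = Some \<delta>)"
    unfolding proof_name_def proof_code.simps by blast
  have "proof_name \<nu> \<mu> c (LPush f g \<alpha>) \<longleftrightarrow>
      (\<exists>f' g' Q. c = proof_code (LPush f' g' Q) \<and> \<nu> f' = Some f \<and> \<nu> g' = Some g \<and> ?R Q \<alpha>)"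
    unfolding proof_name_def inv by blast
  then show "proof_name \<nu> \<mu> c (LPush f g \<alpha>) \<longleftrightarrow>
      (\<exists>f' g' a. c = list_encode [1, f', g', a] \<and> \<nu> f' = Some f \<and> \<nu> g' = Some g \<and> proof_name \<nu> \<mu> a \<alpha>)"
    unfolding proof_name_def proof_code.simps by blast
  have "proof_name \<nu> \<mu> c (RPush f \<alpha>) \<longleftrightarrow>
      (\<exists>f' Q. c = proof_code (RPush f' Q) \<and> \<nu> f' = Some f \<and> ?R Q \<alpha>)"
    unfolding proof_name_def inv by blast
  then show "proof_name \<nu> \<mu> c (RPush f \<alpha>) \<longleftrightarrow>
      (\<exists>f' a. c = list_encode [2, f', a] \<and> \<nu> f' = Some f \<and> proof_name \<nu> \<mu> a \<alpha>)"
    unfolding proof_name_def proof_code.simps by blast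
  have "proof_name \<nu> \<mu> c (LPull f \<alpha>) \<longleftrightarrow>
      (\<exists>f' Q. c = proof_code (LPull f' Q) \<and> \<nu> f' = Some f \<and> ?R Q \<alpha>)"
    unfolding proof_name_def inv by blast
  then show "proof_name \<nu> \<mu> c (LPull f \<alpha>) \<longleftrightarrow>
      (\<exists>f' a. c = list_encode [3, f', a] \<and> \<nu> f' = Some f \<and> proof_name \<nu> \<mu> a \<alpha>)"
    unfolding proof_name_def proof_code.simps by blast
  have "proof_name \<nu> \<mu> c (RPull f g \<alpha>) \<longleftrightarrow>
      (\<exists>f' g' Q. c = proof_code (RPull f' g' Q) \<and> \<nu> f' = Some f \<and> \<nu> g' = Some g \<and> ?R Q \<alpha>)"
    unfolding proof_name_def inv by blast
  then show "proof_name \<nu> \<mu> c (RPull f g \<alpha>) \<longleftrightarrow>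
      (\<exists>f' g' a. c = list_encode [4, f', g', a] \<and> \<nu> f' = Some f \<and> \<nu> g' = Some g \<and> proof_name \<nu> \<mu> a \<alpha>)"
    unfolding proof_name_def proof_code.simps by blast
qed

lemma proof_name_parts:
  "proof_name \<nu> \<mu> c (Ax \<delta>) \<Longrightarrow> ctag c = 0 \<and> \<mu> (cnth c 1) = Some \<delta>"
  "proof_name \<nu> \<mu> c (LPush f g \<alpha>) \<Longrightarrow> ctag c = 1 \<and> \<nu> (cnth c 1) = Some f \<and> \<nu> (cnth c 2) = Some g \<and>
     proof_name \<nu> \<mu> (csub c) \<alpha> \<and> csub c < c"
  "proof_name \<nu> \<mu> c (RPush f \<alpha>) \<Longrightarrow> ctag c = 2 \<and> \<nu> (cnth c 1) = Some f \<and>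
     proof_name \<nu> \<mu> (csub c) \<alpha> \<and> csub c < c"
  "proof_name \<nu> \<mu> c (LPull f \<alpha>) \<Longrightarrow> ctag c = 3 \<and> \<nu> (cnth c 1) = Some f \<and>
     proof_name \<nu> \<mu> (csub c) \<alpha> \<and> csub c < c"
  "proof_name \<nu> \<mu> c (RPull f g \<alpha>) \<Longrightarrow> ctag c = 4 \<and> \<nu> (cnth c 1) = Some f \<and> \<nu> (cnth c 2) = Some g \<and>
     proof_name \<nu> \<mu> (csub c) \<alpha> \<and> csub c < c"
  unfolding proof_name_simps
  by (auto simp: ctag_def csub_def cnth_encode mem_less_list_encode simp del: list_encode.simps)

text \<open>The number of rules of a proof term, axioms not counted.\<close>

fun depth :: "('ca, 'da) proof_term \<Rightarrow> nat" where
  "depth (Ax \<delta>) = 0"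
| "depth (LPush f g \<alpha>) = Suc (depth \<alpha>)"
| "depth (RPush f \<alpha>) = Suc (depth \<alpha>)"
| "depth (LPull g \<alpha>) = Suc (depth \<alpha>)"
| "depth (RPull f g \<alpha>) = Suc (depth \<alpha>)"

lemma length_trace: "length (trace C pa \<alpha>) = Suc (depth \<alpha>)"
  by (induction \<alpha>) auto

lemma depth_le_name: "proof_name \<nu> \<mu> c \<alpha> \<Longrightarrow> depth \<alpha> \<le> c"
proof (induction \<alpha> arbitrary: c)
  case (LPush f g \<alpha>)
  then show ?case using proof_name_parts(2)[OF LPush.prems] LPush.IH by fastforce
next
  case (RPush f \<alpha>)
  then show ?case using proof_name_parts(3)[OF RPush.prems] RPush.IH by fastforce
next
  case (LPull f \<alpha>)
  then show ?case using proof_name_parts(4)[OF LPull.prems] LPull.IH by fastforce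
next
  case (RPull f g \<alpha>)
  then show ?case using proof_name_parts(5)[OF RPull.prems] RPull.IH by fastforce
qed simp

text \<open>A relation \<open>R\<close> between numbers and proofs that is respected by \<open>b\<close> and \<open>t\<close> in each case of
  the definition of proof terms holds between the value of the recursion and the named proof.\<close>

lemma cfold_induct:
  assumes name: "proof_name \<nu> \<mu> c \<alpha>"
    and Ax: "\<And>c \<delta>. \<mu> (cnth c 1) = Some \<delta> \<Longrightarrow> R (b c) (Ax \<delta>)"
    and LPush: "\<And>c f g \<alpha> r. ctag c = 1 \<Longrightarrow> \<nu> (cnth c 1) = Some f \<Longrightarrow> \<nu> (cnth c 2) = Some g \<Longrightarrow>
      proof_name \<nu> \<mu> (csub c) \<alpha> \<Longrightarrow> R r \<alpha> \<Longrightarrow> R (t c r) (LPush f g \<alpha>)"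
    and RPush: "\<And>c f \<alpha> r. ctag c = 2 \<Longrightarrow> \<nu> (cnth c 1) = Some f \<Longrightarrow>
      proof_name \<nu> \<mu> (csub c) \<alpha> \<Longrightarrow> R r \<alpha> \<Longrightarrow> R (t c r) (RPush f \<alpha>)"
    and LPull: "\<And>c f \<alpha> r. ctag c = 3 \<Longrightarrow> \<nu> (cnth c 1) = Some f \<Longrightarrow>
      proof_name \<nu> \<mu> (csub c) \<alpha> \<Longrightarrow> R r \<alpha> \<Longrightarrow> R (t c r) (LPull f \<alpha>)"
    and RPull: "\<And>c f g \<alpha> r. ctag c = 4 \<Longrightarrow> \<nu> (cnth c 1) = Some f \<Longrightarrow> \<nu> (cnth c 2) = Some g \<Longrightarrow>
      proof_name \<nu> \<mu> (csub c) \<alpha> \<Longrightarrow> R r \<alpha> \<Longrightarrow> R (t c r) (RPull f g \<alpha>)"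
  shows "R (cfold b t c) \<alpha>"
proof -
  have "R (fuel_fold b t m c) \<alpha>" if "proof_name \<nu> \<mu> c \<alpha>" "depth \<alpha> \<le> m" for m c \<alpha>
    using that
  proof (induction m arbitrary: c \<alpha>)
    case 0
    then show ?case using proof_name_parts(1)[of \<nu> \<mu> c] Ax by (cases \<alpha>) (auto simp: fuel_fold_0)
  next
    case (Suc m)
    show ?case
    proof (cases \<alpha>)
      case (Ax \<delta>)
      then show ?thesis using proof_name_parts(1)[of \<nu> \<mu> c \<delta>] assms(2) Suc.prems
        by (auto simp: fuel_fold_Suc)
    next
      case (LPush f g \<beta>)
      then show ?thesis using proof_name_parts(2)[of \<nu> \<mu> c f g \<beta>] assms(3) Suc
        by (auto simp: fuel_fold_Suc)
    next
      case (RPush f \<beta>)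
      then show ?thesis using proof_name_parts(3)[of \<nu> \<mu> c f \<beta>] assms(4) Suc
        by (auto simp: fuel_fold_Suc)
    next
      case (LPull f \<beta>)
      then show ?thesis using proof_name_parts(4)[of \<nu> \<mu> c f \<beta>] assms(5) Suc
        by (auto simp: fuel_fold_Suc)
    next
      case (RPull f g \<beta>)
      then show ?thesis using proof_name_parts(5)[of \<nu> \<mu> c f g \<beta>] assms(6) Suc
        by (auto simp: fuel_fold_Suc)
    qed
  qed
  from this[OF name depth_le_name[OF name]] show ?thesis by (simp add: cfold_def)
qed

text \<open>The name of the axiom, the number of rules, and the coded lists of left and right connectives.
  Directions are coded by \<open>1\<close> for push and \<open>0\<close> for pull.\<close>

definition cleaf :: "nat \<Rightarrow> nat" where "cleaf = cfold (\<lambda>c. cnth c 1) (\<lambda>c r. r)"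

definition cdepth :: "nat \<Rightarrow> nat" where "cdepth = cfold (\<lambda>c. 0) (\<lambda>c r. Suc r)"

definition clefts :: "nat \<Rightarrow> nat" where
  "clefts = cfold (\<lambda>c. 0) (\<lambda>c r.
    if ctag c = 1 then Suc (prod_encode (prod_encode (1, cnth c 1), r))
    else if ctag c = 3 then Suc (prod_encode (prod_encode (0, cnth c 1), r)) else r)"

definition crights :: "nat \<Rightarrow> nat" where
  "crights = cfold (\<lambda>c. 0) (\<lambda>c r.
    if ctag c = 2 then Suc (prod_encode (prod_encode (1, cnth c 1), r))
    else if ctag c = 4 then Suc (prod_encode (prod_encode (0, cnth c 2), r)) else r)"

lemma recursive_cleaf [rec_intros]: "recursive f \<Longrightarrow> recursive (\<lambda>n. cleaf (f n))"
  unfolding cleaf_def by (intro rec_intros)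

lemma recursive_cdepth [rec_intros]: "recursive f \<Longrightarrow> recursive (\<lambda>n. cdepth (f n))"
  unfolding cdepth_def by (intro rec_intros)

lemma recursive_clefts [rec_intros]: "recursive f \<Longrightarrow> recursive (\<lambda>n. clefts (f n))"
  unfolding clefts_def by (intro rec_intros)

lemma recursive_crights [rec_intros]: "recursive f \<Longrightarrow> recursive (\<lambda>n. crights (f n))"
  unfolding crights_def by (intro rec_intros)

text \<open>A number names a pair if it codes a pair of a code, under \<open>e\<close>, of the first component and a name of
  the second. Lists are named entrywise.\<close>

definition names_pair :: "('y \<Rightarrow> nat) \<Rightarrow> (nat \<Rightarrow> 'a option) \<Rightarrow> nat \<Rightarrow> 'y \<times> 'a \<Rightarrow> bool" where
  "names_pair e \<nu> n p \<longleftrightarrow> pfst n = e (fst p) \<and> \<nu> (psnd n) = Some (snd p)"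

abbreviation names_spine :: "(nat \<Rightarrow> 'a option) \<Rightarrow> nat \<Rightarrow> (bool \<times> 'a) list \<Rightarrow> bool" where
  "names_spine \<nu> n cs \<equiv> list_all2 (names_pair of_bool \<nu>) (list_decode n) cs"

abbreviation names_path :: "(nat \<Rightarrow> 'a option) \<Rightarrow> nat \<Rightarrow> (nat \<times> 'a) list \<Rightarrow> bool" where
  "names_path \<nu> n x \<equiv> list_all2 (names_pair (\<lambda>l. l) \<nu>) (list_decode n) x"

lemma cleaf_name: "proof_name \<nu> \<mu> c \<alpha> \<Longrightarrow> \<mu> (cleaf c) = Some (leaf \<alpha>)"
  unfolding cleaf_def by (rule cfold_induct[where R = "\<lambda>r \<alpha>. \<mu> r = Some (leaf \<alpha>)"]) auto

lemma cdepth_name: "proof_name \<nu> \<mu> c \<alpha> \<Longrightarrow> cdepth c = depth \<alpha>"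
  unfolding cdepth_def by (rule cfold_induct[where R = "\<lambda>r \<alpha>. r = depth \<alpha>"]) auto

lemma clefts_name:
  assumes "proof_name \<nu> \<mu> c \<alpha>" "proves D C pa \<alpha> S h T"
  shows "names_spine \<nu> (clefts c) (spine S)"
proof -
  have "\<forall>S h T. proves D C pa \<alpha> S h T \<longrightarrow> names_spine \<nu> (clefts c) (spine S)"
    unfolding clefts_def
    apply (rule cfold_induct[OF assms(1), where R = "\<lambda>r \<alpha>. \<forall>S h T. proves D C pa \<alpha> S h T \<longrightarrow> names_spine \<nu> r (spine S)"])
    apply (intro allI impI, erule proves.cases; (auto simp: names_pair_def)[])+
    done
  then show ?thesis using assms(2) by blast
qed

lemma crights_name:
  assumes "proof_name \<nu> \<mu> c \<alpha>" "proves D C pa \<alpha> S h T"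
  shows "names_spine \<nu> (crights c) (spine T)"
proof -
  have "\<forall>S h T. proves D C pa \<alpha> S h T \<longrightarrow> names_spine \<nu> (crights c) (spine T)"
    unfolding crights_def
    apply (rule cfold_induct[OF assms(1), where R = "\<lambda>r \<alpha>. \<forall>S h T. proves D C pa \<alpha> S h T \<longrightarrow> names_spine \<nu> r (spine T)"])
    apply (intro allI impI, erule proves.cases; (auto simp: names_pair_def)[])+
    done
  then show ?thesis using assms(2) by blast
qed

section \<open>The search procedure\<close>

lemma names_nth:
  assumes "list_all2 (names_pair e \<nu>) (list_decode n) x" "k < length x"
  shows "pfst (cnth n k) = e (fst (x ! k))" "\<nu> (psnd (cnth n k)) = Some (snd (x ! k))"
  using assms list_all2_nthD2[OF assms] by (auto simp: names_pair_def list_all2_lengthD cnth_decode)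

lemma names_bound:
  assumes "list_all2 (names_pair e \<nu>) (list_decode n) x" "k < length x"
  shows "psnd (cnth n k) < n"
proof -
  have l: "k < length (list_decode n)" using assms by (simp add: list_all2_lengthD)
  then have "cnth n k \<in> set (list_decode n)" by (simp add: cnth_decode)
  from mem_less_list_encode[OF this] psnd_le[of "cnth n k"] show ?thesis by simp
qed

lemma names_path_update:
  assumes "names_path \<nu> s x" "\<nu> i = Some u" "length x = m" "k < m"
  shows "names_path \<nu> (tab m (\<lambda>j. if j = k then prod_encode (l, i) else cnth s j)) (x[k := (l, u)])"
  unfolding list_all2_conv_all_nth
proof (intro conjI allI impI)
  fix j assume "j < length (list_decode (tab m (\<lambda>j. if j = k then prod_encode (l, i) else cnth s j)))"
  then have j: "j < m" by simp
  then show "names_pair (\<lambda>l. l) \<nu> (list_decode (tab m (\<lambda>j. if j = k then prod_encode (l, i) else cnth s j)) ! j)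
      (x[k := (l, u)] ! j)"
    using names_nth[OF assms(1), of j] assms(2-) by (auto simp: names_pair_def)
qed (use assms in simp)

text \<open>The recursive functions that come with an effectively given functor: \<open>\<nu>\<close> and \<open>\<mu>\<close> name the arrows of
  the base and of the total category, \<open>paN\<close> and \<open>compN\<close> compute the functor and composition on names,
  \<open>eqC\<close> and \<open>eqD\<close> decide equality.\<close>

locale effective_functor = cat_functor D C po pa
  for D :: "('do, 'da) cat" and C :: "('co, 'ca) cat" and po pa +
  fixes \<nu> :: "nat \<Rightarrow> 'ca option" and \<mu> :: "nat \<Rightarrow> 'da option"
    and paN compN eqC eqD :: "nat \<Rightarrow> nat"
  assumes rec_paN: "recursive paN" and rec_compN: "recursive compN" and rec_eqC: "recursive eqC"
    and rec_eqD: "recursive eqD"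
    and paN: "\<mu> n = Some \<delta> \<Longrightarrow> \<nu> (paN n) = Some (pa \<delta>)"
    and compN: "\<nu> m = Some f \<Longrightarrow> \<nu> n = Some g \<Longrightarrow> Tgt C f = Src C g \<Longrightarrow>
      \<nu> (compN (prod_encode (m, n))) = Some (f \<cdot>\<^bsub>C\<^esub> g)"
    and eqC: "\<nu> m = Some f \<Longrightarrow> \<nu> n = Some g \<Longrightarrow> eqC (prod_encode (m, n)) = (if f = g then 1 else 0)"
    and eqD: "\<mu> m = Some \<delta> \<Longrightarrow> \<mu> n = Some \<epsilon> \<Longrightarrow> eqD (prod_encode (m, n)) = (if \<delta> = \<epsilon> then 1 else 0)"
begin

lemmas recs = rec_paN[THEN recursive.comp] rec_compN[THEN recursive.comp] rec_eqC[THEN recursive.comp]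
  rec_eqD[THEN recursive.comp]

text \<open>The coded trace. In the recursion, \<open>cnth r 0\<close> is the first node of the trace of the subproof, and thus
  carries the arrow of its sequent.\<close>

definition ctrace :: "nat \<Rightarrow> nat" where
  "ctrace = cfold (\<lambda>c. Suc (prod_encode (prod_encode (0, paN (cnth c 1)), 0)))
    (\<lambda>c r. Suc (prod_encode (prod_encode (0,
        if ctag c = 1 then cnth c 2
        else if ctag c = 2 then compN (prod_encode (psnd (cnth r 0), cnth c 1))
        else if ctag c = 3 then compN (prod_encode (cnth c 1, psnd (cnth r 0)))
        else cnth c 1),
      if ctag c = 1 \<or> ctag c = 3
      then tab (Suc (cdepth (csub c))) (\<lambda>j. prod_encode (Suc (pfst (cnth r j)), psnd (cnth r j)))
      else r)))"

lemma recursive_ctrace: "recursive f \<Longrightarrow> recursive (\<lambda>n. ctrace (f n))"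
  unfolding ctrace_def by (intro rec_intros recs)

lemma ctrace_name:
  assumes "proof_name \<nu> \<mu> c \<alpha>" "proves D C pa \<alpha> S h T"
  shows "names_path \<nu> (ctrace c) (tr \<alpha>)"
proof -
  let ?R = "\<lambda>r \<alpha>. \<forall>S h T. proves D C pa \<alpha> S h T \<longrightarrow> names_path \<nu> r (tr \<alpha>)"
  have head: "\<nu> (psnd (cnth r 0)) = Some (ar \<alpha>)" if "names_path \<nu> r (tr \<alpha>)" for r \<alpha>
    using names_nth(2)[OF that, of 0] by simp
  have shift: "names_path \<nu> (tab (Suc (cdepth c)) (\<lambda>j. prod_encode (Suc (pfst (cnth r j)), psnd (cnth r j))))
      (map (apfst Suc) (tr \<alpha>))"
    if "names_path \<nu> r (tr \<alpha>)" "proof_name \<nu> \<mu> c \<alpha>" for r \<alpha> c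
    using that(1) cdepth_name[OF that(2)] names_nth[OF that(1)]
    by (auto simp: list_all2_conv_all_nth length_trace names_pair_def simp del: upt_Suc)
  have "?R (ctrace c) \<alpha>"
    unfolding ctrace_def
  proof (rule cfold_induct[OF assms(1), where R = ?R], goal_cases)
    case (1 c \<delta>)
    then show ?case by (auto simp: names_pair_def paN)
  next
    case (2 c f g \<alpha> r)
    show ?case
    proof (intro allI impI)
      fix S h T assume "proves D C pa (LPush f g \<alpha>) S h T"
      then show "names_path \<nu> (Suc (prod_encode (prod_encode (0,
        if ctag c = 1 then cnth c 2
        else if ctag c = 2 then compN (prod_encode (psnd (cnth r 0), cnth c 1))
        else if ctag c = 3 then compN (prod_encode (cnth c 1, psnd (cnth r 0)))
        else cnth c 1),
      if ctag c = 1 \<or> ctag c = 3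
      then tab (Suc (cdepth (csub c))) (\<lambda>j. prod_encode (Suc (pfst (cnth r j)), psnd (cnth r j)))
      else r))) (tr (LPush f g \<alpha>))"
        using 2 shift[of r \<alpha> "csub c"] by cases (auto simp: names_pair_def simp del: decode_tab)
    qed
  next
    case (3 c f \<alpha> r)
    show ?case
    proof (intro allI impI)
      fix S h T assume "proves D C pa (RPush f \<alpha>) S h T"
      then obtain S' f' E A B where p: "proves D C pa \<alpha> S f' S'" "f' \<in> Hom C E A" "f \<in> Hom C A B"
        by cases auto
      then have "names_path \<nu> r (tr \<alpha>)" "\<nu> (psnd (cnth r 0)) = Some f'" "ar \<alpha> = f'"
        using 3 head proves_arrow[OF p(1)] by auto
      then show "names_path \<nu> (Suc (prod_encode (prod_encode (0,
        if ctag c = 1 then cnth c 2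
        else if ctag c = 2 then compN (prod_encode (psnd (cnth r 0), cnth c 1))
        else if ctag c = 3 then compN (prod_encode (cnth c 1, psnd (cnth r 0)))
        else cnth c 1),
      if ctag c = 1 \<or> ctag c = 3
      then tab (Suc (cdepth (csub c))) (\<lambda>j. prod_encode (Suc (pfst (cnth r j)), psnd (cnth r j)))
      else r))) (tr (RPush f \<alpha>))"
        using 3(1,2) p compN[of "psnd (cnth r 0)" f' "cnth c 1" f] by (auto simp: names_pair_def Hom_def)
    qed
  next
    case (4 c f \<alpha> r)
    show ?case
    proof (intro allI impI)
      fix S h T assume "proves D C pa (LPull f \<alpha>) S h T"
      then obtain S' f' E A B where p: "proves D C pa \<alpha> S' f' T" "f \<in> Hom C E A" "f' \<in> Hom C A B"
        by cases auto
      then have "names_path \<nu> r (tr \<alpha>)" "\<nu> (psnd (cnth r 0)) = Some f'" "ar \<alpha> = f'"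
        using 4 head proves_arrow[OF p(1)] by auto
      then show "names_path \<nu> (Suc (prod_encode (prod_encode (0,
        if ctag c = 1 then cnth c 2
        else if ctag c = 2 then compN (prod_encode (psnd (cnth r 0), cnth c 1))
        else if ctag c = 3 then compN (prod_encode (cnth c 1, psnd (cnth r 0)))
        else cnth c 1),
      if ctag c = 1 \<or> ctag c = 3
      then tab (Suc (cdepth (csub c))) (\<lambda>j. prod_encode (Suc (pfst (cnth r j)), psnd (cnth r j)))
      else r))) (tr (LPull f \<alpha>))"
        using 4(1-3) p compN[of "cnth c 1" f "psnd (cnth r 0)" f'] shift[of r \<alpha> "csub c"]
        by (auto simp: names_pair_def Hom_def simp del: decode_tab)
    qed
  next
    case (5 c f g \<alpha> r)
    then show ?case by (auto simp: names_pair_def elim: proves.cases)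
  qed
  then show ?thesis using assms(2) by blast
qed

end

text \<open>What the search needs beyond an effective functor, and what both finite homsets and unique fillers
  provide: \<open>fillN\<close> attempts to find a filler of a commuting square, guided by a choice \<open>ch\<close>, where
  \<open>0\<close> is failure and \<open>Suc i\<close> the name \<open>i\<close> of a filler; choices up to \<open>chN\<close>, which depends on the two
  connectives only, reach all fillers; and \<open>bdN\<close> bounds the size of classes. The names of the sides of
  a square are in the order of \<^const>\<open>effective_fillers\<close>.\<close>

locale effective_calculus = effective_functor D C po pa \<nu> \<mu> paN compN eqC eqD
  for D :: "('do, 'da) cat" and C :: "('co, 'ca) cat" and po pa \<nu> \<mu> paN compN eqC eqD +
  fixes fillN chN bdN :: "nat \<Rightarrow> nat"
  assumes rec_fillN: "recursive fillN" and rec_chN: "recursive chN" and rec_bdN: "recursive bdN"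
    and fillN_sound: "\<nu> a = Some f \<Longrightarrow> \<nu> b = Some k \<Longrightarrow> \<nu> c = Some w \<Longrightarrow> \<nu> d = Some h \<Longrightarrow>
      commuting_square C f k w h \<Longrightarrow> fillN (prod_encode (list_encode [a, b, c, d], ch)) = Suc i \<Longrightarrow>
      \<exists>g\<in>fillers C f k w h. \<nu> i = Some g"
    and fillN_complete: "\<nu> a = Some f \<Longrightarrow> \<nu> b = Some k \<Longrightarrow> \<nu> c = Some w \<Longrightarrow> \<nu> d = Some h \<Longrightarrow>
      commuting_square C f k w h \<Longrightarrow> g \<in> fillers C f k w h \<Longrightarrow>
      \<exists>ch\<le>chN (prod_encode (a, d)). \<exists>i. fillN (prod_encode (list_encode [a, b, c, d], ch)) = Suc i \<and>
        \<nu> i = Some g"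
    and bdN: "proves D C pa \<alpha> S h T \<Longrightarrow> proof_name \<nu> \<mu> n \<alpha> \<Longrightarrow>
      finite {y. (step C (spine S) (spine T))\<^sup>*\<^sup>* (trace C pa \<alpha>) y} \<and>
      card {y. (step C (spine S) (spine T))\<^sup>*\<^sup>* (trace C pa \<alpha>) y} \<le> bdN n"
begin

lemmas recs' = recs rec_fillN[THEN recursive.comp] rec_chN[THEN recursive.comp]
  rec_bdN[THEN recursive.comp]

text \<open>The new decoration of a node between \<open>h\<close> and \<open>h'\<close>, for connectives \<open>c\<close> and \<open>d\<close>, plus one; \<open>0\<close> if no filler
  is found. The node moves to the left-first corner if \<open>b\<close> holds, to the right-first corner otherwise.\<close>

definition cornerN :: "bool \<Rightarrow> nat \<Rightarrow> nat \<Rightarrow> nat \<Rightarrow> nat \<Rightarrow> nat \<Rightarrow> nat" where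
  "cornerN b c d h h' ch =
    (if b then
       if pfst c = 1 then Suc (compN (prod_encode (psnd c, h)))
       else if pfst d = 1 then Suc (compN (prod_encode (h', psnd d)))
       else fillN (prod_encode (list_encode [psnd c, h', h, psnd d], ch))
     else
       if pfst d = 0 then Suc (compN (prod_encode (h, psnd d)))
       else if pfst c = 0 then Suc (compN (prod_encode (psnd c, h')))
       else fillN (prod_encode (list_encode [psnd c, h, h', psnd d], ch)))"

text \<open>An instruction \<open>q\<close> codes a position and a choice. Position \<open>j\<close> means an attempt to move node \<open>Suc j\<close>,
  and \<open>moveN\<close> leaves the path unchanged where this is impossible. Here \<open>l\<close> and \<open>r\<close> code the connectives, \<open>m\<close> is the
  number of rules and \<open>s\<close> codes a path.\<close>

definition tryN :: "nat \<Rightarrow> nat \<Rightarrow> nat \<Rightarrow> nat \<Rightarrow> nat" where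
  "tryN l r s q = cornerN (pfst (cnth s (Suc (pfst q))) = pfst (cnth s (pfst q)))
     (cnth l (pfst (cnth s (pfst q)))) (cnth r (pfst q - pfst (cnth s (pfst q))))
     (psnd (cnth s (pfst q))) (psnd (cnth s (Suc (Suc (pfst q))))) (psnd q)"

definition moveN :: "nat \<Rightarrow> nat \<Rightarrow> nat \<Rightarrow> nat \<Rightarrow> nat \<Rightarrow> nat" where
  "moveN l r m s q =
    (if Suc (pfst q) < m \<and> pfst (cnth s (Suc (Suc (pfst q)))) = Suc (pfst (cnth s (pfst q))) \<and>
        0 < tryN l r s q
     then tab (Suc m) (\<lambda>j. if j = Suc (pfst q)
       then prod_encode (if pfst (cnth s (Suc (pfst q))) = pfst (cnth s (pfst q))
         then Suc (pfst (cnth s (pfst q))) else pfst (cnth s (pfst q)), tryN l r s q - 1)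
       else cnth s j)
     else s)"

text \<open>Execution of the first \<open>t\<close> instructions of the list coded by \<open>q\<close>.\<close>

definition runN :: "nat \<Rightarrow> nat \<Rightarrow> nat \<Rightarrow> nat \<Rightarrow> nat \<Rightarrow> nat \<Rightarrow> nat" where
  "runN l r m s q t = rec_nat s (\<lambda>i z. moveN l r m z (cnth q i)) t"

text \<open>A bound for all choices; connectives have names below the codes \<open>l\<close> and \<open>r\<close> of the lists.\<close>

definition choiceN :: "nat \<Rightarrow> nat \<Rightarrow> nat" where
  "choiceN l r = (\<Sum>a<l. \<Sum>b<r. chN (prod_encode (a, b)))"

text \<open>All lists of \<open>bdN n * bdN n\<close> instructions of bounded position and choice have codes below \<open>searchN n\<close>. The square
  bounds the number of pairs of members of a class, and so the length of the sequences of steps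
  that have to be tried.\<close>

definition searchN :: "nat \<Rightarrow> nat" where
  "searchN n = Suc (tab (bdN n * bdN n) (\<lambda>_. prod_encode (cdepth n, choiceN (clefts n) (crights n))))"

definition resultN :: "nat \<Rightarrow> nat \<Rightarrow> nat" where
  "resultN n q = runN (clefts n) (crights n) (cdepth n) (ctrace n) q (bdN n * bdN n)"

definition decideN :: "nat \<Rightarrow> nat" where
  "decideN n = (if eqD (prod_encode (cleaf (pfst n), cleaf (psnd n))) = 1 \<and>
    (\<exists>q < searchN (pfst n). \<forall>k < Suc (cdepth (pfst n)).
       pfst (cnth (resultN (pfst n) q) k) = pfst (cnth (ctrace (psnd n)) k) \<and>
       eqC (prod_encode (psnd (cnth (resultN (pfst n) q) k), psnd (cnth (ctrace (psnd n)) k))) = 1)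
    then 1 else 0)"

lemma recursive_tryN:
  "recursive l \<Longrightarrow> recursive r \<Longrightarrow> recursive s \<Longrightarrow> recursive q \<Longrightarrow>
    recursive (\<lambda>n. tryN (l n) (r n) (s n) (q n))"
  unfolding tryN_def cornerN_def list_encode.simps by (intro rec_intros recs')

lemma recursive_moveN:
  assumes "recursive l" "recursive r" "recursive m" "recursive s" "recursive q"
  shows "recursive (\<lambda>n. moveN (l n) (r n) (m n) (s n) (q n))"
proof -
  have "recursive (\<lambda>z. moveN (pfst (pfst z)) (psnd (pfst z)) (pfst (psnd z)) (pfst (psnd (psnd z)))
      (psnd (psnd (psnd z))))"
    unfolding moveN_def by (intro rec_intros recursive_tryN)
  from recursive.comp[OF this, of "\<lambda>n. prod_encode (prod_encode (l n, r n),
      prod_encode (m n, prod_encode (s n, q n)))"] show ?thesis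
    using assms by (simp add: recursive.pair)
qed

lemma recursive_runN:
  assumes "recursive l" "recursive r" "recursive m" "recursive s" "recursive q" "recursive t"
  shows "recursive (\<lambda>n. runN (l n) (r n) (m n) (s n) (q n) (t n))"
  unfolding runN_def
  by (intro rec_intros recursive_moveN assms assms[THEN recursive.comp])

lemma recursive_resultN:
  "recursive f \<Longrightarrow> recursive g \<Longrightarrow> recursive (\<lambda>n. resultN (f n) (g n))"
  unfolding resultN_def by (intro rec_intros recursive_runN recursive_ctrace recs')

lemma recursive_searchN:
  assumes "recursive f" shows "recursive (\<lambda>n. searchN (f n))"
proof -
  have "recursive (\<lambda>n. searchN n)"
    unfolding searchN_def choiceN_def by (intro rec_intros recs')
  from recursive.comp[OF this assms] show ?thesis .
qed

lemma recursive_decideN: "recursive decideN"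
  unfolding decideN_def
  by (intro rec_intros recs' recursive_resultN recursive_searchN recursive_ctrace)

lemma cornerN_left:
  assumes "pfst c = of_bool s" "\<nu> (psnd c) = Some f" "pfst d = of_bool t" "\<nu> (psnd d) = Some g"
    "\<nu> a = Some h" "\<nu> b = Some h'" and ne: "right_corners C (s, f) (t, g) h h' \<noteq> {}"
  shows "cornerN True c d a b ch = Suc i \<Longrightarrow> \<exists>u\<in>left_corners C (s, f) (t, g) h h'. \<nu> i = Some u"
    and "u \<in> left_corners C (s, f) (t, g) h h' \<Longrightarrow>
      \<exists>ch\<le>chN (prod_encode (psnd c, psnd d)). \<exists>i. cornerN True c d a b ch = Suc i \<and> \<nu> i = Some u"
proof -
  note eq = C.left_corners_eq[OF ne]
  consider "s" | "\<not> s" "t" | "\<not> s" "\<not> t" by blast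
  then have "(cornerN True c d a b ch = Suc i \<longrightarrow> (\<exists>u\<in>left_corners C (s, f) (t, g) h h'. \<nu> i = Some u)) \<and>
    (u \<in> left_corners C (s, f) (t, g) h h' \<longrightarrow>
      (\<exists>ch\<le>chN (prod_encode (psnd c, psnd d)). \<exists>i. cornerN True c d a b ch = Suc i \<and> \<nu> i = Some u))"
    for ch i u
  proof cases
    case 1
    then have "f \<cdot>\<^bsub>C\<^esub> h \<in> left_corners C (s, f) (t, g) h h'" using eq by simp
    then have "Tgt C f = Src C h" using 1 by (simp add: left_corners_def composable_def)
    then show ?thesis using 1 eq assms compN[of "psnd c" f a h] by (auto simp: cornerN_def)
  next
    case 2
    then have "h' \<cdot>\<^bsub>C\<^esub> g \<in> left_corners C (s, f) (t, g) h h'" using eq by simp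
    then have "Tgt C h' = Src C g" using 2 by (simp add: left_corners_def composable_def)
    then show ?thesis using 2 eq assms compN[of b h' "psnd d" g] by (auto simp: cornerN_def)
  next
    case 3
    then have sq: "commuting_square C f h' h g" using C.left_corner_square ne by simp
    have "cornerN True c d a b ch = fillN (prod_encode (list_encode [psnd c, b, a, psnd d], ch))" for ch
      using 3 assms by (simp add: cornerN_def del: list_encode.simps)
    then show ?thesis
      using fillN_sound[OF assms(2,6,5,4) sq] fillN_complete[OF assms(2,6,5,4) sq] eq 3 by auto
  qed
  then show "cornerN True c d a b ch = Suc i \<Longrightarrow> \<exists>u\<in>left_corners C (s, f) (t, g) h h'. \<nu> i = Some u"
    and "u \<in> left_corners C (s, f) (t, g) h h' \<Longrightarrow>
      \<exists>ch\<le>chN (prod_encode (psnd c, psnd d)). \<exists>i. cornerN True c d a b ch = Suc i \<and> \<nu> i = Some u"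
    by blast+
qed

lemma cornerN_right:
  assumes "pfst c = of_bool s" "\<nu> (psnd c) = Some f" "pfst d = of_bool t" "\<nu> (psnd d) = Some g"
    "\<nu> a = Some h" "\<nu> b = Some h'" and ne: "left_corners C (s, f) (t, g) h h' \<noteq> {}"
  shows "cornerN False c d a b ch = Suc i \<Longrightarrow> \<exists>u\<in>right_corners C (s, f) (t, g) h h'. \<nu> i = Some u"
    and "u \<in> right_corners C (s, f) (t, g) h h' \<Longrightarrow>
      \<exists>ch\<le>chN (prod_encode (psnd c, psnd d)). \<exists>i. cornerN False c d a b ch = Suc i \<and> \<nu> i = Some u"
proof -
  note eq = C.right_corners_eq[OF ne]
  consider "\<not> t" | "t" "\<not> s" | "s" "t" by blast
  then have "(cornerN False c d a b ch = Suc i \<longrightarrow> (\<exists>u\<in>right_corners C (s, f) (t, g) h h'. \<nu> i = Some u)) \<and>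
    (u \<in> right_corners C (s, f) (t, g) h h' \<longrightarrow>
      (\<exists>ch\<le>chN (prod_encode (psnd c, psnd d)). \<exists>i. cornerN False c d a b ch = Suc i \<and> \<nu> i = Some u))"
    for ch i u
  proof cases
    case 1
    then have "h \<cdot>\<^bsub>C\<^esub> g \<in> right_corners C (s, f) (t, g) h h'" using eq by simp
    then have "Tgt C h = Src C g" using 1 by (simp add: right_corners_def composable_def)
    then show ?thesis using 1 eq assms compN[of a h "psnd d" g] by (auto simp: cornerN_def)
  next
    case 2
    then have "f \<cdot>\<^bsub>C\<^esub> h' \<in> right_corners C (s, f) (t, g) h h'" using eq by simp
    then have "Tgt C f = Src C h'" using 2 by (simp add: right_corners_def composable_def)
    then show ?thesis using 2 eq assms compN[of "psnd c" f b h'] by (auto simp: cornerN_def)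
  next
    case 3
    then have sq: "commuting_square C f h h' g" using C.right_corner_square ne by simp
    have "cornerN False c d a b ch = fillN (prod_encode (list_encode [psnd c, a, b, psnd d], ch))" for ch
      using 3 assms by (simp add: cornerN_def del: list_encode.simps)
    then show ?thesis
      using fillN_sound[OF assms(2,5,6,4) sq] fillN_complete[OF assms(2,5,6,4) sq] eq 3 by auto
  qed
  then show "cornerN False c d a b ch = Suc i \<Longrightarrow> \<exists>u\<in>right_corners C (s, f) (t, g) h h'. \<nu> i = Some u"
    and "u \<in> right_corners C (s, f) (t, g) h h' \<Longrightarrow>
      \<exists>ch\<le>chN (prod_encode (psnd c, psnd d)). \<exists>i. cornerN False c d a b ch = Suc i \<and> \<nu> i = Some u"
    by blast+
qed

end

section \<open>Correctness of the search\<close>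

text \<open>In a finite class, everything reachable is reachable in as many steps as there are pairs of members.\<close>

lemma steps_bounded:
  assumes "finite {z. r\<^sup>*\<^sup>* x z}" "r\<^sup>*\<^sup>* x y"
  obtains n where "n \<le> card {z. r\<^sup>*\<^sup>* x z} * card {z. r\<^sup>*\<^sup>* x z}" "(r ^^ n) x y"
proof -
  let ?Z = "{z. r\<^sup>*\<^sup>* x z}"
  let ?R = "{(a, b). r a b \<and> r\<^sup>*\<^sup>* x a}"
  have sub: "?R \<subseteq> ?Z \<times> ?Z" by (auto intro: rtranclp.rtrancl_into_rtrancl)
  then have fin: "finite ?R" using assms(1) finite_subset by blast
  have card: "card ?R \<le> card ?Z * card ?Z"
    using card_mono[OF _ sub] assms(1) by (simp add: card_cartesian_product)
  have "(x, y) \<in> ?R\<^sup>*" using assms(2)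
  proof (induction rule: rtranclp_induct)
    case (step y z)
    then have "(y, z) \<in> ?R" by simp
    then show ?case using step.IH by (rule rtrancl_into_rtrancl[rotated])
  qed simp
  then obtain n where n: "n \<le> card ?R" "(x, y) \<in> ?R ^^ n"
    using rtrancl_finite_eq_relpow[OF fin] by auto
  have "(r ^^ n) x y" using n(2)
  proof (induction n arbitrary: y)
    case (Suc n)
    then show ?case by auto
  qed simp
  then show ?thesis by (rule that[OF order_trans[OF n(1) card]])
qed

context effective_calculus
begin

text \<open>The decorations of the left-first or right-first corner, selected by \<open>b\<close>.\<close>

definition corners :: "bool \<Rightarrow> bool \<times> 'ca \<Rightarrow> bool \<times> 'ca \<Rightarrow> 'ca \<Rightarrow> 'ca \<Rightarrow> 'ca set" where
  "corners b c d h h' = (if b then left_corners C c d h h' else right_corners C c d h h')"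

lemma chN_le_choiceN: "a < l \<Longrightarrow> b < r \<Longrightarrow> chN (prod_encode (a, b)) \<le> choiceN l r"
proof -
  assume ab: "a < l" "b < r"
  have "chN (prod_encode (a, b)) \<le> (\<Sum>b<r. chN (prod_encode (a, b)))"
    using ab by (intro member_le_sum) auto
  also have "\<dots> \<le> choiceN l r"
    unfolding choiceN_def using ab by (intro member_le_sum[of a "{..<l}" "\<lambda>a. \<Sum>b<r. chN (prod_encode (a, b))"]) auto
  finally show ?thesis .
qed

lemma tryN_spec:
  assumes s: "names_path \<nu> s x" and x: "valid_path C ls rs x"
    and l: "names_spine \<nu> l ls" and r: "names_spine \<nu> r rs"
    and j: "Suc (Suc j) < length x" and up: "fst (x ! Suc (Suc j)) = Suc (fst (x ! j))"
  defines "K \<equiv> corners (fst (x ! Suc j) = fst (x ! j)) (ls ! fst (x ! j)) (rs ! (j - fst (x ! j)))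
    (snd (x ! j)) (snd (x ! Suc (Suc j)))"
  shows "tryN l r s (prod_encode (j, ch)) = Suc n \<Longrightarrow> \<exists>u\<in>K. \<nu> n = Some u"
    and "u \<in> K \<Longrightarrow> \<exists>ch\<le>choiceN l r. \<exists>n. tryN l r s (prod_encode (j, ch)) = Suc n \<and> \<nu> n = Some u"
proof -
  let ?i = "fst (x ! j)"
  have e1: "node_edge C ls rs j (x ! j) (x ! Suc j)"
    and e2: "node_edge C ls rs (Suc j) (x ! Suc j) (x ! Suc (Suc j))"
    using valid_path_edge[OF x] j by auto
  have fu: "fst (x ! Suc j) = ?i \<or> fst (x ! Suc j) = Suc ?i"
    using e1 unfolding node_edge_def by blast
  have "?i < length ls \<and> j - ?i < length rs"
    using fu e1 e2 up unfolding node_edge_def by fastforce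
  then have il: "?i < length ls" and jr: "j - ?i < length rs" by auto
  obtain sf f where c: "ls ! ?i = (sf, f)" by fastforce
  obtain sg g where d: "rs ! (j - ?i) = (sg, g)" by fastforce
  have nm: "pfst (cnth l ?i) = of_bool sf" "\<nu> (psnd (cnth l ?i)) = Some f"
    "pfst (cnth r (j - ?i)) = of_bool sg" "\<nu> (psnd (cnth r (j - ?i))) = Some g"
    "\<nu> (psnd (cnth s j)) = Some (snd (x ! j))"
    "\<nu> (psnd (cnth s (Suc (Suc j)))) = Some (snd (x ! Suc (Suc j)))"
    using names_nth[OF l il] names_nth[OF r jr] c d names_nth[OF s, of j]
      names_nth[OF s, of "Suc (Suc j)"] j by auto
  have tr: "tryN l r s (prod_encode (j, ch)) = cornerN (fst (x ! Suc j) = ?i) (cnth l ?i)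
      (cnth r (j - ?i)) (psnd (cnth s j)) (psnd (cnth s (Suc (Suc j)))) ch" for ch
    using names_nth(1)[OF s, of j] names_nth(1)[OF s, of "Suc j"] j
    by (simp add: tryN_def)
  have ch: "chN (prod_encode (psnd (cnth l ?i), psnd (cnth r (j - ?i)))) \<le> choiceN l r"
    using names_bound[OF l il] names_bound[OF r jr] by (rule chN_le_choiceN)
  have "(tryN l r s (prod_encode (j, ch)) = Suc n \<longrightarrow> (\<exists>u\<in>K. \<nu> n = Some u)) \<and>
    (u \<in> K \<longrightarrow> (\<exists>ch\<le>choiceN l r. \<exists>n. tryN l r s (prod_encode (j, ch)) = Suc n \<and> \<nu> n = Some u))"
    for ch n u
  proof (cases "fst (x ! Suc j) = ?i")
    case True
    then have "right_corners C (sf, f) (sg, g) (snd (x ! j)) (snd (x ! Suc (Suc j))) \<noteq> {}"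
      using node_edges_right[OF e1 e2 _ up] c d by auto
    note cor = cornerN_left[OF nm this]
    have K: "K = left_corners C (sf, f) (sg, g) (snd (x ! j)) (snd (x ! Suc (Suc j)))"
      using True c d by (simp add: K_def corners_def)
    show ?thesis
      unfolding tr K using cor ch True by (auto intro: order_trans) (meson ch order_trans)
  next
    case False
    then have "left_corners C (sf, f) (sg, g) (snd (x ! j)) (snd (x ! Suc (Suc j))) \<noteq> {}"
      using node_edges_left[OF e1 e2 _ up] fu c d by auto
    note cor = cornerN_right[OF nm this]
    have K: "K = right_corners C (sf, f) (sg, g) (snd (x ! j)) (snd (x ! Suc (Suc j)))"
      using False c d by (simp add: K_def corners_def)
    show ?thesis
      unfolding tr K using cor ch False by (auto intro: order_trans) (meson ch order_trans)
  qed
  then show "tryN l r s (prod_encode (j, ch)) = Suc n \<Longrightarrow> \<exists>u\<in>K. \<nu> n = Some u"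
    and "u \<in> K \<Longrightarrow> \<exists>ch\<le>choiceN l r. \<exists>n. tryN l r s (prod_encode (j, ch)) = Suc n \<and> \<nu> n = Some u"
    by blast+
qed

lemma moveN_eq:
  assumes s: "names_path \<nu> s x" and x: "valid_path C ls rs x"
    and j: "Suc (Suc j) < length x" and up: "fst (x ! Suc (Suc j)) = Suc (fst (x ! j))"
    and t: "tryN l r s (prod_encode (j, ch)) = Suc n" and n: "\<nu> n = Some u"
  defines "i \<equiv> fst (x ! j)"
  shows "names_path \<nu> (moveN l r (length ls + length rs) s (prod_encode (j, ch)))
    (x[Suc j := (if fst (x ! Suc j) = i then Suc i else i, u)])"
proof -
  have len: "length x = Suc (length ls + length rs)" using x by (simp add: valid_path_def)
  have "moveN l r (length ls + length rs) s (prod_encode (j, ch)) =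
    tab (Suc (length ls + length rs)) (\<lambda>k. if k = Suc j
      then prod_encode (if fst (x ! Suc j) = i then Suc i else i, n) else cnth s k)"
    unfolding moveN_def
    using names_nth(1)[OF s, of j] names_nth(1)[OF s, of "Suc j"] names_nth(1)[OF s, of "Suc (Suc j)"]
      j up t len by (simp add: i_def cong: if_cong)
  then show ?thesis using names_path_update[OF s n len, of "Suc j"] j len by simp
qed

lemma moveN_sound:
  assumes s: "names_path \<nu> s x" and x: "valid_path C ls rs x"
    and l: "names_spine \<nu> l ls" and r: "names_spine \<nu> r rs"
  shows "\<exists>y. names_path \<nu> (moveN l r (length ls + length rs) s q) y \<and> (y = x \<or> step C ls rs x y)"
proof -
  obtain j ch where q: "q = prod_encode (j, ch)" by (metis prod_decode_inverse surj_pair)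
  have len: "length x = Suc (length ls + length rs)" using x by (simp add: valid_path_def)
  show ?thesis
  proof (cases "Suc (Suc j) < length x \<and> fst (x ! Suc (Suc j)) = Suc (fst (x ! j)) \<and>
      0 < tryN l r s q")
    case True
    then obtain n where n: "tryN l r s (prod_encode (j, ch)) = Suc n"
      using q gr0_implies_Suc by blast
    have j: "Suc (Suc j) < length x" and up: "fst (x ! Suc (Suc j)) = Suc (fst (x ! j))"
      using True by auto
    let ?i = "fst (x ! j)"
    obtain u where u: "u \<in> corners (fst (x ! Suc j) = ?i) (ls ! ?i) (rs ! (j - ?i))
      (snd (x ! j)) (snd (x ! Suc (Suc j)))" "\<nu> n = Some u"
      using tryN_spec(1)[OF s x l r j up n] by blast
    let ?v = "(if fst (x ! Suc j) = ?i then Suc ?i else ?i, u)"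
    have ne: "fst ?v \<noteq> fst (x ! Suc j)" by auto
    have "valid_path C ls rs (x[Suc j := ?v])"
      unfolding valid_path_update_iff[OF x j up ne] using u(1) by (auto simp: corners_def Let_def)
    moreover have "swap x (x[Suc j := ?v])"
      unfolding swap_def using j ne by (auto intro!: exI[of _ "Suc j"])
    ultimately show ?thesis
      using moveN_eq[OF s x j up n u(2)] x q by (auto simp: step_def)
  next
    case False
    then have "moveN l r (length ls + length rs) s q = s"
      using names_nth(1)[OF s, of j] names_nth(1)[OF s, of "Suc (Suc j)"] len q
      by (auto simp: moveN_def)
    then show ?thesis using s by auto
  qed
qed

lemma moveN_complete:
  assumes s: "names_path \<nu> s x" and st: "step C ls rs x y"
    and l: "names_spine \<nu> l ls" and r: "names_spine \<nu> r rs"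
  shows "\<exists>q\<le>prod_encode (length ls + length rs, choiceN l r).
    names_path \<nu> (moveN l r (length ls + length rs) s q) y"
proof -
  have x: "valid_path C ls rs x" and y: "valid_path C ls rs y" using st by (auto simp: step_def)
  have len: "length x = Suc (length ls + length rs)" using x by (simp add: valid_path_def)
  obtain j u v where j: "Suc (Suc j) < length x" "y = x[Suc j := v]" "x ! Suc j = u"
    "fst u \<noteq> fst v" "fst (x ! Suc (Suc j)) = Suc (fst (x ! j))"
    by (rule step_cases[OF st])
  let ?i = "fst (x ! j)"
  have ne: "fst v \<noteq> fst (x ! Suc j)" using j by simp
  from y[unfolded j(2) valid_path_update_iff[OF x j(1,5) ne]]
  have v: "v = (if fst (x ! Suc j) = ?i then Suc ?i else ?i, snd v)"
    and c: "snd v \<in> corners (fst (x ! Suc j) = ?i) (ls ! ?i) (rs ! (j - ?i))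
      (snd (x ! j)) (snd (x ! Suc (Suc j)))"
    by (auto simp: corners_def Let_def prod_eq_iff split: if_splits)
  obtain ch n where n: "ch \<le> choiceN l r" "tryN l r s (prod_encode (j, ch)) = Suc n" "\<nu> n = Some (snd v)"
    using tryN_spec(2)[OF s x l r j(1,5) c] by blast
  have "names_path \<nu> (moveN l r (length ls + length rs) s (prod_encode (j, ch))) y"
    unfolding j(2) by (subst v) (rule moveN_eq[OF s x j(1,5) n(2,3)])
  moreover have "prod_encode (j, ch) \<le> prod_encode (length ls + length rs, choiceN l r)"
    using n(1) j(1) len by (intro prod_encode_mono) auto
  ultimately show ?thesis by blast
qed

lemma runN_0: "runN l r m s q 0 = s"
  by (simp add: runN_def)

lemma runN_Suc: "runN l r m s q (Suc t) = moveN l r m (runN l r m s q t) (cnth q t)"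
  by (simp add: runN_def)

lemma runN_sound:
  assumes s: "names_path \<nu> s x" and x: "valid_path C ls rs x"
    and l: "names_spine \<nu> l ls" and r: "names_spine \<nu> r rs"
  shows "\<exists>y. names_path \<nu> (runN l r (length ls + length rs) s q t) y \<and>
    (step C ls rs)\<^sup>*\<^sup>* x y \<and> valid_path C ls rs y"
proof (induction t)
  case 0
  show ?case unfolding runN_0 using s x by blast
next
  case (Suc t)
  then obtain y where y: "names_path \<nu> (runN l r (length ls + length rs) s q t) y"
    "(step C ls rs)\<^sup>*\<^sup>* x y" "valid_path C ls rs y" by blast
  obtain z where z: "names_path \<nu> (runN l r (length ls + length rs) s q (Suc t)) z"
    "z = y \<or> step C ls rs y z"
    using moveN_sound[OF y(1,3) l r] unfolding runN_Suc by blast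
  from z(2) have "(step C ls rs)\<^sup>*\<^sup>* x z \<and> valid_path C ls rs z"
  proof
    assume "step C ls rs y z"
    then show ?thesis using y(2) rtranclp.rtrancl_into_rtrancl step_def by metis
  qed (use y in simp)
  then show ?case using z(1) by blast
qed

text \<open>Shorter sequences are padded with an instruction at position \<open>length ls + length rs\<close>, which lies
  beyond the last square and does nothing.\<close>

lemma runN_complete:
  assumes s: "names_path \<nu> s x" and x: "valid_path C ls rs x"
    and l: "names_spine \<nu> l ls" and r: "names_spine \<nu> r rs"
    and "(step C ls rs ^^ t) x y" and "t \<le> t'"
  shows "\<exists>qs. length qs = t' \<and> (\<forall>q\<in>set qs. q \<le> prod_encode (length ls + length rs, choiceN l r)) \<and>
    names_path \<nu> (runN l r (length ls + length rs) s (list_encode qs) t') y"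
proof -
  let ?m = "length ls + length rs"
  let ?b = "prod_encode (?m, choiceN l r)"
  have prefix: "runN l r ?m s (list_encode (qs @ [q])) k = runN l r ?m s (list_encode qs) k"
    if "k \<le> length qs" for qs q k
    unfolding runN_def
    by (rule rec_nat_cong) (use that in \<open>simp add: cnth_encode nth_append del: list_encode.simps\<close>)
  have ext: "\<exists>qs. length qs = Suc k \<and> (\<forall>q\<in>set qs. q \<le> ?b) \<and> names_path \<nu> (runN l r ?m s (list_encode qs) (Suc k)) z"
    if "length qs = k" "\<forall>q\<in>set qs. q \<le> ?b" "q \<le> ?b"
      "names_path \<nu> (moveN l r ?m (runN l r ?m s (list_encode qs) k) q) z" for qs q k z
  proof (intro exI conjI)
    have "runN l r ?m s (list_encode (qs @ [q])) (Suc k) = moveN l r ?m (runN l r ?m s (list_encode qs) k) q"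
      unfolding runN_Suc using prefix[of k qs q] that(1)
      by (simp add: cnth_encode nth_append del: list_encode.simps)
    then show "names_path \<nu> (runN l r ?m s (list_encode (qs @ [q])) (Suc k)) z" using that(4) by metis
  qed (use that in auto)
  have "\<exists>qs. length qs = t \<and> (\<forall>q\<in>set qs. q \<le> ?b) \<and> names_path \<nu> (runN l r ?m s (list_encode qs) t) y"
    using assms(5)
  proof (induction t arbitrary: y)
    case 0
    then show ?case unfolding runN_0 using s by auto
  next
    case (Suc t)
    then obtain z where z: "(step C ls rs ^^ t) x z" "step C ls rs z y" by auto
    then obtain qs where qs: "length qs = t" "\<forall>q\<in>set qs. q \<le> ?b"
      "names_path \<nu> (runN l r ?m s (list_encode qs) t) z" using Suc.IH by blast
    then obtain q where "q \<le> ?b" "names_path \<nu> (moveN l r ?m (runN l r ?m s (list_encode qs) t) q) y"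
      using moveN_complete[OF qs(3) z(2) l r] by blast
    then show ?case using ext qs by blast
  qed
  then show ?thesis using assms(6)
  proof (induction rule: dec_induct[OF assms(6)])
    case (2 k)
    then obtain qs where qs: "length qs = k" "\<forall>q\<in>set qs. q \<le> ?b"
      "names_path \<nu> (runN l r ?m s (list_encode qs) k) y" by auto
    have "moveN l r ?m (runN l r ?m s (list_encode qs) k) (prod_encode (?m, 0)) =
        runN l r ?m s (list_encode qs) k" by (simp add: moveN_def)
    show ?case
    proof (rule ext[OF qs(1,2)])
      show "prod_encode (?m, 0) \<le> ?b" by (rule prod_encode_mono) simp_all
      show "names_path \<nu> (moveN l r ?m (runN l r ?m s (list_encode qs) k) (prod_encode (?m, 0))) y"
        unfolding \<open>moveN l r ?m _ _ = _\<close> by (rule qs(3))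
    qed
  qed blast
qed

theorem decideN_correct:
  assumes p: "proves D C pa \<alpha> S h T" "proves D C pa \<beta> S h T"
    and n: "proof_name \<nu> \<mu> a \<alpha>" "proof_name \<nu> \<mu> b \<beta>"
  shows "decideN (prod_encode (a, b)) = (if perm D C pa S h T \<alpha> \<beta> then 1 else 0)"
proof -
  let ?ls = "spine S" and ?rs = "spine T"
  have l: "names_spine \<nu> (clefts a) ?ls" and r: "names_spine \<nu> (crights a) ?rs"
    and s: "names_path \<nu> (ctrace a) (tr \<alpha>)" and s': "names_path \<nu> (ctrace b) (tr \<beta>)"
    using clefts_name[OF n(1) p(1)] crights_name[OF n(1) p(1)] ctrace_name[OF n(1) p(1)]
      ctrace_name[OF n(2) p(2)] by auto
  have x: "valid_path C ?ls ?rs (tr \<alpha>)" and x': "valid_path C ?ls ?rs (tr \<beta>)"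
    using proves_valid p by auto
  have m: "cdepth a = length ?ls + length ?rs"
    using cdepth_name[OF n(1)] x length_trace[of C pa \<alpha>] by (simp add: valid_path_def)
  have leaf: "eqD (prod_encode (cleaf a, cleaf b)) = 1 \<longleftrightarrow> leaf \<alpha> = leaf \<beta>"
    using eqD[OF cleaf_name[OF n(1)] cleaf_name[OF n(2)]] by simp
  have agree: "(\<forall>k < Suc (cdepth a). pfst (cnth z k) = pfst (cnth (ctrace b) k) \<and>
       eqC (prod_encode (psnd (cnth z k), psnd (cnth (ctrace b) k))) = 1) \<longleftrightarrow> y = tr \<beta>"
    if y: "names_path \<nu> z y" "valid_path C ?ls ?rs y" for z y
  proof -
    have len: "length y = Suc (cdepth a)" "length (tr \<beta>) = Suc (cdepth a)"
      using y(2) x' m by (auto simp: valid_path_def)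
    have "pfst (cnth z k) = pfst (cnth (ctrace b) k) \<and>
       eqC (prod_encode (psnd (cnth z k), psnd (cnth (ctrace b) k))) = 1 \<longleftrightarrow> y ! k = tr \<beta> ! k"
      if "k < Suc (cdepth a)" for k
      using names_nth[OF y(1), of k] names_nth[OF s', of k] that len
        eqC[of "psnd (cnth z k)" _ "psnd (cnth (ctrace b) k)"]
      by (auto simp: prod_eq_iff)
    then show ?thesis using len by (auto simp: list_eq_iff_nth_eq)
  qed
  let ?K = "bdN a * bdN a"
  let ?b = "prod_encode (cdepth a, choiceN (clefts a) (crights a))"
  have "(\<exists>q < searchN a. \<forall>k < Suc (cdepth a).
       pfst (cnth (resultN a q) k) = pfst (cnth (ctrace b) k) \<and>
       eqC (prod_encode (psnd (cnth (resultN a q) k), psnd (cnth (ctrace b) k))) = 1) \<longleftrightarrow>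
     (step C ?ls ?rs)\<^sup>*\<^sup>* (tr \<alpha>) (tr \<beta>)" (is "?l \<longleftrightarrow> ?r")
  proof
    assume ?l
    then obtain q where q: "\<forall>k < Suc (cdepth a).
       pfst (cnth (resultN a q) k) = pfst (cnth (ctrace b) k) \<and>
       eqC (prod_encode (psnd (cnth (resultN a q) k), psnd (cnth (ctrace b) k))) = 1" by blast
    obtain y where "names_path \<nu> (resultN a q) y" "(step C ?ls ?rs)\<^sup>*\<^sup>* (tr \<alpha>) y" "valid_path C ?ls ?rs y"
      using runN_sound[OF s x l r, of q ?K] unfolding resultN_def m by blast
    then show ?r using agree q by blast
  next
    assume st: ?r
    let ?Z = "{z. (step C ?ls ?rs)\<^sup>*\<^sup>* (tr \<alpha>) z}"
    have fin: "finite ?Z" "card ?Z \<le> bdN a" using bdN[OF p(1) n(1)] by auto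
    obtain t where t: "t \<le> card ?Z * card ?Z" "(step C ?ls ?rs ^^ t) (tr \<alpha>) (tr \<beta>)"
      by (rule steps_bounded[OF fin(1) st])
    have "t \<le> ?K" using t(1) mult_le_mono[OF fin(2) fin(2)] by linarith
    then obtain qs where qs: "length qs = ?K" "\<forall>q\<in>set qs. q \<le> ?b"
      "names_path \<nu> (resultN a (list_encode qs)) (tr \<beta>)"
      using runN_complete[OF s x l r t(2)] unfolding resultN_def m by blast
    have "list_all2 (\<le>) qs (map (\<lambda>_. ?b) [0..<?K])"
      using qs(1,2) by (auto simp: list_all2_conv_all_nth)
    from list_encode_mono[OF this] have "list_encode qs < searchN a"
      unfolding searchN_def tab_def by simp
    then show ?l using agree[OF qs(3) x'] by blast
  qed
  then show ?thesis
    unfolding decideN_def perm_iff_steps[OF p] using leaf by simp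
qed

end

section \<open>Bounds on classes and the two kinds of base category\<close>

text \<open>Moving a node creates no new source or target, because a left edge keeps targets and a right edge
  keeps sources.\<close>

lemma (in category) step_sources:
  assumes "step C ls rs x y"
  shows "(\<lambda>p. Src C (snd p)) ` set y \<subseteq> (\<lambda>p. Src C (snd p)) ` set x"
    and "(\<lambda>p. Tgt C (snd p)) ` set y \<subseteq> (\<lambda>p. Tgt C (snd p)) ` set x"
proof -
  obtain j u v where j: "Suc (Suc j) < length x" "y = x[Suc j := v]"
    "fst (x ! Suc (Suc j)) = Suc (fst (x ! j))"
    by (rule step_cases[OF assms])
  have y: "valid_path C ls rs y" using assms by (simp add: step_def)
  have e: "node_edge C ls rs j (x ! j) v" "node_edge C ls rs (Suc j) v (x ! Suc (Suc j))"
    using valid_path_edge[OF y, of j] valid_path_edge[OF y, of "Suc j"] j(1,2) by auto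
  have "fst v = fst (x ! j) \<or> fst v = Suc (fst (x ! j))"
    using e(1) unfolding node_edge_def by blast
  then have "(Src C (snd v) = Src C (snd (x ! j)) \<or> Src C (snd v) = Src C (snd (x ! Suc (Suc j)))) \<and>
    (Tgt C (snd v) = Tgt C (snd (x ! j)) \<or> Tgt C (snd v) = Tgt C (snd (x ! Suc (Suc j))))"
  proof
    assume "fst v = fst (x ! j)"
    then have "right_edge C (rs ! (j - fst (x ! j))) (snd (x ! j)) (snd v)"
      "left_edge C (ls ! fst v) (snd v) (snd (x ! Suc (Suc j)))"
      using e j(3) unfolding node_edge_def by auto
    then show ?thesis using edge_src_tgt by metis
  next
    assume v: "fst v = Suc (fst (x ! j))"
    then have "left_edge C (ls ! fst (x ! j)) (snd (x ! j)) (snd v)"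
      "right_edge C (rs ! (Suc j - fst v)) (snd v) (snd (x ! Suc (Suc j)))"
      using e j(3) unfolding node_edge_def by auto
    then show ?thesis using edge_src_tgt by metis
  qed
  moreover have "x ! j \<in> set x" "x ! Suc (Suc j) \<in> set x" using j(1) by auto
  ultimately have v: "Src C (snd v) \<in> (\<lambda>p. Src C (snd p)) ` set x"
    "Tgt C (snd v) \<in> (\<lambda>p. Tgt C (snd p)) ` set x" by auto
  have "set y \<subseteq> insert v (set x)" unfolding j(2) by (rule set_update_subset_insert)
  with v show "(\<lambda>p. Src C (snd p)) ` set y \<subseteq> (\<lambda>p. Src C (snd p)) ` set x"
    and "(\<lambda>p. Tgt C (snd p)) ` set y \<subseteq> (\<lambda>p. Tgt C (snd p)) ` set x" by blast+
qed

lemma (in category) steps_sources: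
  "(step C ls rs)\<^sup>*\<^sup>* x y \<Longrightarrow>
    (\<lambda>p. Src C (snd p)) ` set y \<subseteq> (\<lambda>p. Src C (snd p)) ` set x \<and>
    (\<lambda>p. Tgt C (snd p)) ` set y \<subseteq> (\<lambda>p. Tgt C (snd p)) ` set x"
proof (induction rule: rtranclp_induct)
  case (step y z)
  then show ?case
    using subset_trans[OF step_sources(1)[OF step.hyps(2)]] subset_trans[OF step_sources(2)[OF step.hyps(2)]]
    by simp
qed simp

lemma steps_valid:
  "(step C ls rs)\<^sup>*\<^sup>* x y \<Longrightarrow> valid_path C ls rs x \<Longrightarrow> valid_path C ls rs y"
  by (induction rule: rtranclp_induct) (auto simp: step_def)

lemma (in category) valid_path_arr:
  assumes "valid_path C ls rs x" "p \<in> set x" shows "snd p \<in> Arr C"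
proof -
  obtain k where k: "k < length x" "x ! k = p" using assms(2) by (auto simp: in_set_conv_nth)
  have "snd (x ! k) \<in> Arr C"
  proof (cases k)
    case 0
    then show ?thesis using assms(1) by (simp add: valid_path_def)
  next
    case (Suc i)
    then have "node_edge C ls rs i (x ! i) (x ! k)" using valid_path_edge[OF assms(1), of i] k(1) by simp
    then show ?thesis unfolding node_edge_def using edge_arr by blast
  qed
  then show ?thesis using k by simp
qed

lemma (in category) class_finite_locally_finite:
  assumes x: "valid_path C ls rs x" and m: "length ls + length rs = m"
    and fin: "finite H"
    and H: "\<And>p q. p \<in> set x \<Longrightarrow> q \<in> set x \<Longrightarrow> Hom C (Src C (snd p)) (Tgt C (snd q)) \<subseteq> H"
  shows "finite {y. (step C ls rs)\<^sup>*\<^sup>* x y} \<and>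
    card {y. (step C ls rs)\<^sup>*\<^sup>* x y} \<le> (Suc m * card H) ^ Suc m"
proof -
  let ?Z = "{..m} \<times> H"
  have "{y. (step C ls rs)\<^sup>*\<^sup>* x y} \<subseteq> {y. set y \<subseteq> ?Z \<and> length y = Suc m}"
  proof (rule subsetI, unfold mem_Collect_eq)
    fix y assume st: "(step C ls rs)\<^sup>*\<^sup>* x y"
    then have y: "valid_path C ls rs y" using steps_valid x by blast
    have "p \<in> ?Z" if p: "p \<in> set y" for p
    proof -
      obtain k where k: "k < length y" "y ! k = p" using p by (auto simp: in_set_conv_nth)
      then have "fst p \<le> m" using valid_path_fst_le[OF y k(1)] m by simp
      moreover have "Src C (snd p) \<in> (\<lambda>p. Src C (snd p)) ` set x"
        "Tgt C (snd p) \<in> (\<lambda>p. Tgt C (snd p)) ` set x"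
        using steps_sources[OF st] p by auto
      then obtain q r where qr: "q \<in> set x" "r \<in> set x" "Src C (snd p) = Src C (snd q)"
        "Tgt C (snd p) = Tgt C (snd r)" by (elim imageE)
      have "snd p \<in> Hom C (Src C (snd q)) (Tgt C (snd r))"
        using valid_path_arr[OF y p] qr(3,4) by (simp add: Hom_def)
      then have "snd p \<in> H" using H[OF qr(1,2)] by (rule subsetD[rotated])
      ultimately show ?thesis by (simp add: mem_Times_iff)
    qed
    then show "set y \<subseteq> ?Z \<and> length y = Suc m" using y m by (auto simp: valid_path_def)
  qed
  note sub = this
  have Z: "finite ?Z" "card ?Z = Suc m * card H"
    using fin by (simp_all add: card_cartesian_product)
  have fZ: "finite {y. set y \<subseteq> ?Z \<and> length y = Suc m}"
    by (rule finite_lists_length_eq[OF Z(1)])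
  have "card {y. set y \<subseteq> ?Z \<and> length y = Suc m} = (Suc m * card H) ^ Suc m"
    unfolding card_lists_length_eq[OF Z(1)] Z(2) ..
  then show ?thesis using card_mono[OF fZ sub] finite_subset[OF sub fZ] by metis
qed

lemma (in category) class_finite_preordered:
  assumes fp: "factorization_preordered C"
    and x: "valid_path C ls rs x" and m: "length ls + length rs = m"
  shows "finite {y. (step C ls rs)\<^sup>*\<^sup>* x y} \<and>
    card {y. (step C ls rs)\<^sup>*\<^sup>* x y} \<le> Suc m ^ Suc m"
proof -
  let ?Y = "{y. (step C ls rs)\<^sup>*\<^sup>* x y}"
  have inj: "inj_on (map fst) ?Y"
  proof (rule inj_onI)
    fix y z assume yz: "y \<in> ?Y" "z \<in> ?Y" "map fst y = map fst z"
    then have "(step C ls rs)\<^sup>*\<^sup>* z y" by (auto intro: rtranclp_trans steps_sym)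
    then show "y = z" using steps_unique[OF fp] yz(3) by blast
  qed
  have "map fst y \<in> {zs. set zs \<subseteq> {..m} \<and> length zs = Suc m}" if "y \<in> ?Y" for y
  proof -
    have y: "valid_path C ls rs y" using that steps_valid x by blast
    then have "fst (y ! k) \<le> m" if "k < length y" for k
      using valid_path_fst_le[OF y that] m by simp
    then show ?thesis using y m by (auto simp: valid_path_def set_conv_nth)
  qed
  then have sub: "map fst ` ?Y \<subseteq> {zs. set zs \<subseteq> {..m} \<and> length zs = Suc m}" by blast
  have fin: "finite {zs. set zs \<subseteq> {..m} \<and> length zs = Suc m}"
    by (rule finite_lists_length_eq) simp
  have "card {zs. set zs \<subseteq> {..m} \<and> length zs = Suc m} = Suc m ^ Suc m"
    using card_lists_length_eq[of "{..m}" "Suc m"] by simp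
  then show ?thesis
    using inj card_image[OF inj] card_mono[OF fin sub] finite_subset[OF sub fin] finite_imageD by metis
qed

lemma (in effective_functor) effective_calculus_preordered:
  assumes fp: "factorization_preordered C" and eff: "effective_fillers C \<nu>"
  shows "\<exists>fillN chN bdN. effective_calculus D C po pa \<nu> \<mu> paN compN eqC eqD fillN chN bdN"
proof -
  obtain r where r: "recursive r" and fill: "\<And>a b c d f k m h.
      \<nu> a = Some f \<Longrightarrow> \<nu> b = Some k \<Longrightarrow> \<nu> c = Some m \<Longrightarrow> \<nu> d = Some h \<Longrightarrow>
      commuting_square C f k m h \<Longrightarrow>
      (case r (list_encode [a, b, c, d]) of
         0 \<Rightarrow> fillers C f k m h = {}
       | Suc i \<Rightarrow> \<exists>g\<in>fillers C f k m h. \<nu> i = Some g)"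
    using eff unfolding effective_fillers_def by blast
  have uniq: "g = g'" if sq: "commuting_square C f k m h" and gs: "g \<in> fillers C f k m h" "g' \<in> fillers C f k m h"
    for f k m h g g'
  proof -
    obtain A B E F where "f \<in> Hom C A B" "h \<in> Hom C E F"
      using sq unfolding commuting_square_def by blast
    moreover have "g \<in> Hom C B E" "g' \<in> Hom C B E"
      using gs calculation by (auto simp: fillers_def Hom_def)
    moreover have "f \<cdot>\<^bsub>C\<^esub> g = f \<cdot>\<^bsub>C\<^esub> g'" "g \<cdot>\<^bsub>C\<^esub> h = g' \<cdot>\<^bsub>C\<^esub> h" using gs by (auto simp: fillers_def)
    ultimately show ?thesis using fp unfolding factorization_preordered_def by blast
  qed
  have "effective_calculus D C po pa \<nu> \<mu> paN compN eqC eqD (\<lambda>z. r (pfst z)) (\<lambda>_. 0)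
      (\<lambda>n. Suc (cdepth n) ^ Suc (cdepth n))"
  proof (unfold_locales, goal_cases)
    case 1 show ?case by (rule recursive.comp[OF r recursive.left])
  next
    case 2 show ?case by (rule recursive.zero)
  next
    case 3 show ?case by (intro rec_intros)
  next
    case (4 a f b k c w d h ch i)
    then show ?case using fill[OF 4(1-5)] by (simp del: list_encode.simps)
  next
    case (5 a f b k c w d h g)
    obtain i where i: "r (list_encode [a, b, c, d]) = Suc i"
      using fill[OF 5(1-5)] 5(6) by (cases "r (list_encode [a, b, c, d])") (simp_all del: list_encode.simps)
    then obtain g' where "g' \<in> fillers C f k w h" "\<nu> i = Some g'"
      using fill[OF 5(1-5)] by (auto simp del: list_encode.simps)
    then have "\<nu> i = Some g" using uniq[OF 5(5,6)] by simp
    then show ?case using i by (simp del: list_encode.simps)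
  next
    case (6 \<alpha> S h T n)
    then have "length (spine S) + length (spine T) = cdepth n"
      using proves_valid[OF 6(1)] length_trace[of C pa \<alpha>] cdepth_name[OF 6(2)]
      by (simp add: valid_path_def)
    then show ?case using C.class_finite_preordered[OF fp proves_valid[OF 6(1)]] by simp
  qed
  then show ?thesis by blast
qed

text \<open>A choice is an index into the enumeration of the homset in which fillers live. The class bound is
  the one of \<open>class_finite_locally_finite\<close>, with the decorations taken from all homsets between a source and a
  target that occur in the given trace; the sum \<open>sizeN\<close> over-estimates their number, as the code of a
  list exceeds its entries.\<close>

lemma (in effective_functor) effective_calculus_locally_finite:
  assumes eff: "effective_hom_enumeration C \<nu>o \<nu>"
    and "computable_map \<nu> \<nu>o (Src C)" "computable_map \<nu> \<nu>o (Tgt C)"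
  shows "\<exists>fillN chN bdN. effective_calculus D C po pa \<nu> \<mu> paN compN eqC eqD fillN chN bdN"
proof -
  obtain srcN tgtN where srcN: "recursive srcN" "\<And>n f. \<nu> n = Some f \<Longrightarrow> \<nu>o (srcN n) = Some (Src C f)"
    and tgtN: "recursive tgtN" "\<And>n f. \<nu> n = Some f \<Longrightarrow> \<nu>o (tgtN n) = Some (Tgt C f)"
    using assms(2,3) unfolding computable_map_def by blast
  obtain homN where homN: "recursive homN" and hom: "\<And>m n A B. \<nu>o m = Some A \<Longrightarrow> \<nu>o n = Some B \<Longrightarrow>
      \<nu> ` set (list_decode (homN (prod_encode (m, n)))) = Some ` Hom C A B"
    using eff unfolding effective_hom_enumeration_def by blast
  define restN where "restN t ch = (ctl ^^ ch) (homN (prod_encode (tgtN (cnth t 0), srcN (cnth t 3))))" for t ch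
  define checkN where "checkN t g \<longleftrightarrow> eqC (prod_encode (compN (prod_encode (cnth t 0, g)), cnth t 2)) = 1 \<and>
    eqC (prod_encode (compN (prod_encode (g, cnth t 3)), cnth t 1)) = 1" for t g
  define fillN where "fillN z = (if 0 < restN (pfst z) (psnd z) \<and> checkN (pfst z) (chd (restN (pfst z) (psnd z)))
    then Suc (chd (restN (pfst z) (psnd z))) else 0)" for z
  define chN where "chN z = homN (prod_encode (tgtN (pfst z), srcN (psnd z)))" for z
  define sizeN where "sizeN s = (\<Sum>a<s. \<Sum>b<s. homN (prod_encode (srcN a, tgtN b)))" for s
  define bdN where "bdN n = (Suc (cdepth n) * sizeN (ctrace n)) ^ Suc (cdepth n)" for n
  note comps = recs srcN(1)[THEN recursive.comp] tgtN(1)[THEN recursive.comp] homN[THEN recursive.comp]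
  have rec: "recursive fillN" "recursive chN" "recursive bdN"
  proof -
    show "recursive fillN"
      unfolding fillN_def restN_def checkN_def by (intro rec_intros comps)
    show "recursive chN"
      unfolding chN_def by (intro rec_intros comps)
    have "recursive sizeN"
      unfolding sizeN_def by (intro rec_intros comps)
    then show "recursive bdN"
      unfolding bdN_def by (intro rec_intros recursive_ctrace) (rule recursive.comp, assumption, intro rec_intros recursive_ctrace)
  qed
  have fill: "fillN (prod_encode (list_encode [a, b, c, d], ch)) = Suc i \<longleftrightarrow>
      ch < length (list_decode (chN (prod_encode (a, d)))) \<and> i = list_decode (chN (prod_encode (a, d))) ! ch \<and>
      (\<exists>g\<in>fillers C f k w h. \<nu> i = Some g)"
    if nm: "\<nu> a = Some f" "\<nu> b = Some k" "\<nu> c = Some w" "\<nu> d = Some h" for a b c d f k w h ch i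
  proof -
    let ?xs = "list_decode (chN (prod_encode (a, d)))"
    let ?t = "list_encode [a, b, c, d]"
    have t: "cnth ?t 0 = a" "cnth ?t 1 = b" "cnth ?t 2 = c" "cnth ?t 3 = d"
      by (simp_all add: cnth_encode del: list_encode.simps)
    have rest: "restN ?t ch = list_encode (drop ch ?xs)"
      unfolding restN_def t funpow_ctl[symmetric] by (simp add: chN_def)
    have pos: "0 < restN ?t ch \<longleftrightarrow> ch < length ?xs"
      unfolding rest by (cases "ch < length ?xs") (simp_all add: Cons_nth_drop_Suc[symmetric])
    have hd: "chd (restN ?t ch) = ?xs ! ch" if "ch < length ?xs"
      unfolding rest using that by (simp add: chd_def Cons_nth_drop_Suc[symmetric])
    have "checkN ?t (?xs ! ch) \<longleftrightarrow> (\<exists>g\<in>fillers C f k w h. \<nu> (?xs ! ch) = Some g)" if ch: "ch < length ?xs"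
    proof -
      have "\<nu> (?xs ! ch) \<in> Some ` Hom C (Tgt C f) (Src C h)"
        using hom[OF tgtN(2)[OF nm(1)] srcN(2)[OF nm(4)]] ch by (auto simp: chN_def)
      then obtain g where g: "\<nu> (?xs ! ch) = Some g" "g \<in> Hom C (Tgt C f) (Src C h)" by auto
      then have "\<nu> (compN (prod_encode (a, ?xs ! ch))) = Some (f \<cdot>\<^bsub>C\<^esub> g)"
        "\<nu> (compN (prod_encode (?xs ! ch, d))) = Some (g \<cdot>\<^bsub>C\<^esub> h)"
        using compN[OF nm(1) g(1)] compN[OF g(1) nm(4)] by (auto simp: Hom_def)
      then show ?thesis
        using eqC nm g unfolding checkN_def t by (simp add: fillers_def)
    qed
    then show ?thesis unfolding fillN_def using pos hd by auto
  qed
  have "effective_calculus D C po pa \<nu> \<mu> paN compN eqC eqD fillN chN bdN"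
  proof (unfold_locales, goal_cases)
    case (4 a f b k c w d h ch i)
    show ?case using fill[OF 4(1-4)] 4(6) by blast
  next
    case (5 a f b k c w d h g)
    let ?xs = "list_decode (chN (prod_encode (a, d)))"
    have "Some g \<in> \<nu> ` set ?xs"
      using hom[OF tgtN(2)[OF 5(1)] srcN(2)[OF 5(4)]] 5(6) by (auto simp: chN_def fillers_def)
    then obtain ch where ch: "ch < length ?xs" "\<nu> (?xs ! ch) = Some g" by (metis imageE in_set_conv_nth)
    moreover have "ch \<le> chN (prod_encode (a, d))"
      using ch(1) length_le_list_encode[of ?xs] by simp
    ultimately show ?case using fill[OF 5(1-4)] 5(6) by blast
  next
    case (6 \<alpha> S h T n)
    let ?s = "ctrace n"
    let ?H = "(\<lambda>i. the (\<nu> i)) ` {..<sizeN ?s}"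
    note s = ctrace_name[OF 6(2,1)]
    have m: "length (spine S) + length (spine T) = cdepth n"
      using proves_valid[OF 6(1)] length_trace[of C pa \<alpha>] cdepth_name[OF 6(2)]
      by (simp add: valid_path_def)
    have "Hom C (Src C (snd p)) (Tgt C (snd q)) \<subseteq> ?H" if pq: "p \<in> set (tr \<alpha>)" "q \<in> set (tr \<alpha>)" for p q
    proof
      fix g assume g: "g \<in> Hom C (Src C (snd p)) (Tgt C (snd q))"
      obtain k where k: "k < length (tr \<alpha>)" "tr \<alpha> ! k = p" using pq by (auto simp: in_set_conv_nth)
      obtain k' where k': "k' < length (tr \<alpha>)" "tr \<alpha> ! k' = q" using pq by (auto simp: in_set_conv_nth)
      let ?a = "psnd (cnth ?s k)" and ?b = "psnd (cnth ?s k')"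
      let ?l = "homN (prod_encode (srcN ?a, tgtN ?b))"
      have ab: "\<nu> ?a = Some (snd p)" "\<nu> ?b = Some (snd q)" "?a < ?s" "?b < ?s"
        using names_nth[OF s k(1)] names_nth[OF s k'(1)] names_bound[OF s k(1)] names_bound[OF s k'(1)] k k'
        by auto
      have "Some g \<in> \<nu> ` set (list_decode ?l)"
        using hom[OF srcN(2)[OF ab(1)] tgtN(2)[OF ab(2)]] g by auto
      then obtain e where e: "e \<in> set (list_decode ?l)" "\<nu> e = Some g" by (metis imageE)
      have "e < ?l" using mem_less_list_encode[OF e(1)] by simp
      also have "?l \<le> (\<Sum>b<?s. homN (prod_encode (srcN ?a, tgtN b)))"
        using ab by (intro member_le_sum) auto
      also have "\<dots> \<le> sizeN ?s"
        unfolding sizeN_def using ab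
        by (intro member_le_sum[of ?a "{..<?s}" "\<lambda>a. \<Sum>b<?s. homN (prod_encode (srcN a, tgtN b))"]) auto
      finally show "g \<in> ?H" using e(2) by (intro image_eqI[of _ _ e]) auto
    qed
    note fin = C.class_finite_locally_finite[OF proves_valid[OF 6(1)] m _ this]
    have "card ?H \<le> sizeN ?s" using card_image_le[of "{..<sizeN ?s}" "\<lambda>i. the (\<nu> i)"] by simp
    then have "(Suc (cdepth n) * card ?H) ^ Suc (cdepth n) \<le> bdN n"
      unfolding bdN_def by (intro power_mono mult_le_mono) auto
    with fin show ?case by (meson finite_imageI finite_lessThan order_trans)
  qed (fact rec)+
  then show ?thesis by blast
qed

theorem theorem3p28:
  fixes D :: "('do, 'da) cat" and C :: "('co, 'ca) cat"
    and po :: "'do \<Rightarrow> 'co" and pa :: "'da \<Rightarrow> 'ca"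
    and \<nu>Do :: "nat \<Rightarrow> 'do option" and \<nu>Da :: "nat \<Rightarrow> 'da option"
    and \<nu>Co :: "nat \<Rightarrow> 'co option" and \<nu>Ca :: "nat \<Rightarrow> 'ca option"
  assumes "cat_functor D C po pa"
    and "effective_cat D \<nu>Do \<nu>Da"
    and "effective_cat C \<nu>Co \<nu>Ca"
    and "computable_map \<nu>Do \<nu>Co po"
    and "computable_map \<nu>Da \<nu>Ca pa"
    and "(locally_finite C \<and> effective_hom_enumeration C \<nu>Co \<nu>Ca) \<or>
         (factorization_preordered C \<and> effective_fillers C \<nu>Ca)"
  shows "\<exists>d. recursive d \<and>
    (\<forall>S f T \<alpha>1 \<alpha>2 n1 n2.
      proves D C pa \<alpha>1 S f T \<longrightarrow> proves D C pa \<alpha>2 S f T \<longrightarrow>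
      proof_name \<nu>Ca \<nu>Da n1 \<alpha>1 \<longrightarrow> proof_name \<nu>Ca \<nu>Da n2 \<alpha>2 \<longrightarrow>
      d (prod_encode (n1, n2)) = (if perm D C pa S f T \<alpha>1 \<alpha>2 then 1 else 0))"
proof -
  interpret cat_functor D C po pa by fact
  obtain paN where paN: "recursive paN" "\<And>n \<delta>. \<nu>Da n = Some \<delta> \<Longrightarrow> \<nu>Ca (paN n) = Some (pa \<delta>)"
    using assms(5) unfolding computable_map_def by blast
  obtain compN where compN: "recursive compN" "\<And>m n f g. \<nu>Ca m = Some f \<Longrightarrow> \<nu>Ca n = Some g \<Longrightarrow>
      Tgt C f = Src C g \<Longrightarrow> \<nu>Ca (compN (prod_encode (m, n))) = Some (f \<cdot>\<^bsub>C\<^esub> g)"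
    using assms(3) unfolding effective_cat_def computable_comp_def by blast
  obtain eqC where eqC: "recursive eqC" "\<And>m n f g. \<nu>Ca m = Some f \<Longrightarrow> \<nu>Ca n = Some g \<Longrightarrow>
      eqC (prod_encode (m, n)) = (if f = g then 1 else 0)"
    using assms(3) unfolding effective_cat_def decidable_equality_def by blast
  obtain eqD where eqD: "recursive eqD" "\<And>m n f g. \<nu>Da m = Some f \<Longrightarrow> \<nu>Da n = Some g \<Longrightarrow>
      eqD (prod_encode (m, n)) = (if f = g then 1 else 0)"
    using assms(2) unfolding effective_cat_def decidable_equality_def by blast
  interpret effective_functor D C po pa \<nu>Ca \<nu>Da paN compN eqC eqD
    by unfold_locales (fact paN compN eqC eqD)+
  have "\<exists>fillN chN bdN. effective_calculus D C po pa \<nu>Ca \<nu>Da paN compN eqC eqD fillN chN bdN"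
    using assms(6)
  proof
    assume "locally_finite C \<and> effective_hom_enumeration C \<nu>Co \<nu>Ca"
    then show ?thesis using effective_calculus_locally_finite assms(3) unfolding effective_cat_def by blast
  next
    assume "factorization_preordered C \<and> effective_fillers C \<nu>Ca"
    then show ?thesis using effective_calculus_preordered by blast
  qed
  then obtain fillN chN bdN where
    ec: "effective_calculus D C po pa \<nu>Ca \<nu>Da paN compN eqC eqD fillN chN bdN" by blast
  interpret effective_calculus D C po pa \<nu>Ca \<nu>Da paN compN eqC eqD fillN chN bdN by (fact ec)
  show ?thesis using recursive_decideN decideN_correct by blast
qed

end
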